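(* Let $A=\mathbb{F}_2[x,y]$ with $y^2+y=x^3+x+1$ and $G=GL_2(A)$. Then the inner automorphisms of $G$, the Reiner automorphisms at $\infty$, and the cyclic spike automorphisms together generate $\mathrm{Aut}(G)$.
   Context: Here $A$ is the ring of functions on the elliptic curve $y^2+y=x^3+x+1$ over $\mathbb{F}_2$ regular away from the point at infinity (a principal ideal domain with $A^*=\{1\}$). Let $U(A)=\{\begin{pmatrix}1&a\\0&1\end{pmatrix}:a\in A\}$ (the stabilizer of $\infty\in\mathbb{P}^1(K)$ in $G$) and $H$ the subgroup generated by $GL_2(\mathbb{F}_2)$ and $U(A)$; $H=GL_2(\mathbb{F}_2)\ast_{B}U(A)\cong GL_2(\mathbb{F}_2[t])$ with $B=\{I_2,\begin{pmatrix}1&1\\0&1\end{pmatrix}\}$. There are elements $M_0,M_1\in G$ of order $3$, generating non-conjugate subgroups, such that $G=H\ast\langle M_0\rangle\ast\langle M_1\rangle$ (free product); fix such $M_0,M_1$ (coming from a lift of a maximal tree of the quotient of the Bruhat–Tits tree by $G$). A Reiner automorphism at $\infty$ is an automorphism $\rho$ of $G$ for which there are an $\mathbb{F}_2$-subspace $V^*$ with $A=\mathbb{F}_2\oplus V^*$ and an $\mathbb{F}_2$-linear automorphism $\varphi$ of $V^*$ such that $\rho\begin{pmatrix}1&\epsilon+v\\0&1\end{pmatrix}=\begin{pmatrix}1&\epsilon+\varphi(v)\\0&1\end{pmatrix}$ ($\epsilon\in\mathbb{F}_2,v\in V^*$) and $\rho$ is the identity on $GL_2(\mathbb{F}_2)$,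 $M_0$ and $M_1$. The cyclic spike automorphisms form the subgroup of $\mathrm{Aut}(G)$ generated by: (i) automorphisms restricting to an automorphism of $\langle M_i\rangle$ ($i=0,1$) and to the identity on the other two free factors; (ii) automorphisms restricting to an isomorphism $\langle M_0\rangle\to\langle M_1\rangle$ on $\langle M_0\rangle$, its inverse on $\langle M_1\rangle$, and the identity on $H$; (iii) partial conjugations: for distinct free factors $X,Y$ among $H,\langle M_0\rangle,\langle M_1\rangle$ and $x\in X$, the automorphism equal to conjugation by $x$ on $Y$ and the identity on the other two factors. *)

theory Defs
  imports
    "HOL-Analysis.Cartesian_Space"
    "HOL-Library.Z2"
    "HOL-Computational_Algebra.Polynomial"
    "HOL-Algebra.Bij"
    "HOL-Algebra.Generated_Groups"
    "HOL-Algebra.Multiplicative_Group"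
begin

text \<open>
  The type \<^typ>\<open>bit poly poly\<close> is the polynomial ring in \<open>y\<close> over the polynomial ring in \<open>x\<close>
  over the field with two elements (\<^typ>\<open>bit\<close>): the outer variable is \<open>y\<close>, the inner one \<open>x\<close>.
  The polynomial below is \<open>y^2 + y - (x^3 + x + 1)\<close>.
\<close>

definition curve_poly :: "bit poly poly" where
  "curve_poly = [:- [:1, 1, 0, 1:], 1, 1:]"

quotient_type coord_ring = "bit poly poly" / "\<lambda>p q. curve_poly dvd p - q"
proof (rule equivpI)
  show "reflp (\<lambda>p q. curve_poly dvd p - q)"
    by (simp add: reflp_def)
  show "symp (\<lambda>p q. curve_poly dvd p - q)"
    by (metis dvd_minus_iff minus_diff_eq sympI)
  show "transp (\<lambda>p q. curve_poly dvd p - q)"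
    by (rule transpI) (metis diff_add_cancel add_diff_eq dvd_add)
qed

instantiation coord_ring :: comm_ring_1
begin

lift_definition zero_coord_ring :: coord_ring is 0 .

lift_definition one_coord_ring :: coord_ring is 1 .

lift_definition plus_coord_ring :: "coord_ring \<Rightarrow> coord_ring \<Rightarrow> coord_ring" is "(+)"
  by (metis add_diff_add dvd_add)

lift_definition uminus_coord_ring :: "coord_ring \<Rightarrow> coord_ring" is uminus
  by (metis dvd_minus_iff minus_diff_minus)

lift_definition minus_coord_ring :: "coord_ring \<Rightarrow> coord_ring \<Rightarrow> coord_ring" is "(-)"
proof -
  fix a b c d :: "bit poly poly"
  assume "curve_poly dvd a - b" "curve_poly dvd c - d"
  then have "curve_poly dvd (a - b) - (c - d)"
    by (rule dvd_diff)
  then show "curve_poly dvd (a - c) - (b - d)"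
    by (simp only: diff_diff_eq2 diff_diff_eq add_diff_eq diff_add_eq ac_simps)
qed

lift_definition times_coord_ring :: "coord_ring \<Rightarrow> coord_ring \<Rightarrow> coord_ring" is "(*)"
proof -
  fix a b c d :: "bit poly poly"
  assume "curve_poly dvd a - b" "curve_poly dvd c - d"
  then have "curve_poly dvd (a - b) * c + b * (c - d)"
    by (intro dvd_add dvd_mult dvd_mult2)
  then show "curve_poly dvd a * c - b * d"
    by (simp only: left_diff_distrib right_diff_distrib diff_add_cancel add_diff_eq)
qed

lemma curve_poly_not_dvd_1: "\<not> curve_poly dvd 1"
proof
  assume "curve_poly dvd 1"
  then have "degree curve_poly \<le> degree (1 :: bit poly poly)"
    by (rule dvd_imp_degree_le) simp
  then show False
    by (simp add: curve_poly_def)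
qed

instance
proof
  fix a b c :: coord_ring
  show "a + b + c = a + (b + c)" by transfer (simp add: algebra_simps)
  show "a + b = b + a" by transfer (simp add: algebra_simps)
  show "0 + a = a" by transfer simp
  show "- a + a = 0" by transfer simp
  show "a - b = a + - b" by transfer simp
  show "a * b * c = a * (b * c)" by transfer (simp add: algebra_simps)
  show "a * b = b * a" by transfer (simp add: algebra_simps)
  show "1 * a = a" by transfer simp
  show "(a + b) * c = a * c + b * c" by transfer (simp add: algebra_simps)
  show "(0::coord_ring) \<noteq> 1" using curve_poly_not_dvd_1 by transfer simp
qed

end

lift_definition F2_emb :: "bit \<Rightarrow> coord_ring" is "\<lambda>c. [:[:c:]:]" .

lemma F2_emb_simps [simp]: "F2_emb 0 = 0" "F2_emb 1 = 1"
  by (transfer; simp add: one_pCons)+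

lemma F2_emb_add: "F2_emb (a + b) = F2_emb a + F2_emb b"
  by transfer simp

lemma F2_emb_mult: "F2_emb (a * b) = F2_emb a * F2_emb b"
  by transfer simp

interpretation F2: vector_space "\<lambda>c a. F2_emb c * a"
  by unfold_locales
    (simp_all only: F2_emb_add F2_emb_mult F2_emb_simps distrib_left distrib_right mult.assoc mult_1_left)

definition GL2A :: "(coord_ring^2^2) monoid" where
  "GL2A = \<lparr>carrier = {M. invertible M}, mult = (**), one = mat 1\<rparr>"

lemma group_GL2A: "group GL2A"
proof (rule groupI)
  fix M :: "coord_ring^2^2"
  assume "M \<in> carrier GL2A"
  then obtain N where "M ** N = mat 1" "N ** M = mat 1"
    by (auto simp: GL2A_def invertible_def)
  then have "N \<in> carrier GL2A" "N \<otimes>\<^bsub>GL2A\<^esub> M = \<one>\<^bsub>GL2A\<^esub>"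
    by (auto simp: GL2A_def invertible_def)
  then show "\<exists>N\<in>carrier GL2A. N \<otimes>\<^bsub>GL2A\<^esub> M = \<one>\<^bsub>GL2A\<^esub>" ..
qed (auto simp: GL2A_def matrix_mul_assoc invertible_mult, auto simp: invertible_def)

definition GL2F2 :: "(coord_ring^2^2) set" where
  "GL2F2 = (\<lambda>M. \<chi> i j. F2_emb (M $ i $ j)) ` {M :: bit^2^2. invertible M}"

definition unip :: "coord_ring \<Rightarrow> coord_ring^2^2" where
  "unip a = vector [vector [1, a], vector [0, 1]]"

definition UA :: "(coord_ring^2^2) set" where
  "UA = range unip"

definition H_subgroup :: "(coord_ring^2^2) set" where
  "H_subgroup = generate GL2A (GL2F2 \<union> UA)"

abbreviation cyc :: "coord_ring^2^2 \<Rightarrow> (coord_ring^2^2) set" where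
  "cyc M \<equiv> generate GL2A {M}"

text \<open>
  The free product of a family of groups consists of the reduced words: finite sequences of
  nontrivial elements of the factors in which neighbours come from factors with different indices.
  A group is the (internal) free product of a family of subgroups if multiplying out is a bijection
  from the reduced words onto the group.
\<close>

definition reduced_word ::
    "('a, 'b) monoid_scheme \<Rightarrow> 'i set \<Rightarrow> ('i \<Rightarrow> 'a set) \<Rightarrow> ('i \<times> 'a) list \<Rightarrow> bool" where
  "reduced_word G I X w \<longleftrightarrow>
     (\<forall>(i, x) \<in> set w. i \<in> I \<and> x \<in> X i \<and> x \<noteq> \<one>\<^bsub>G\<^esub>) \<and> distinct_adj (map fst w)"

definition word_prod :: "('a, 'b) monoid_scheme \<Rightarrow> ('i \<times> 'a) list \<Rightarrow> 'a" where
  "word_prod G w = foldr (\<otimes>\<^bsub>G\<^esub>) (map snd w) \<one>\<^bsub>G\<^esub>"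

definition is_free_product ::
    "('a, 'b) monoid_scheme \<Rightarrow> 'i set \<Rightarrow> ('i \<Rightarrow> 'a set) \<Rightarrow> bool" where
  "is_free_product G I X \<longleftrightarrow>
     (\<forall>i\<in>I. subgroup (X i) G) \<and> bij_betw (word_prod G) {w. reduced_word G I X w} (carrier G)"

definition factor :: "coord_ring^2^2 \<Rightarrow> coord_ring^2^2 \<Rightarrow> nat \<Rightarrow> (coord_ring^2^2) set" where
  "factor M0 M1 i = [H_subgroup, cyc M0, cyc M1] ! i"

text \<open>
  The cyclic factors have indices 1 and 2. Factors are addressed by index, so distinct factors
  below means distinct indices.
\<close>

definition conjugate_subsets :: "('a, 'b) monoid_scheme \<Rightarrow> 'a set \<Rightarrow> 'a set \<Rightarrow> bool" where
  "conjugate_subsets G X Y \<longleftrightarrow>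
     (\<exists>g\<in>carrier G. Y = (\<lambda>x. g \<otimes>\<^bsub>G\<^esub> x \<otimes>\<^bsub>G\<^esub> inv\<^bsub>G\<^esub> g) ` X)"

definition cyclic_spike_pair :: "coord_ring^2^2 \<Rightarrow> coord_ring^2^2 \<Rightarrow> bool" where
  "cyclic_spike_pair M0 M1 \<longleftrightarrow>
     M0 \<in> carrier GL2A \<and> M1 \<in> carrier GL2A \<and>
     group.ord GL2A M0 = 3 \<and> group.ord GL2A M1 = 3 \<and>
     \<not> conjugate_subsets GL2A (cyc M0) (cyc M1) \<and>
     is_free_product GL2A {..<3} (factor M0 M1)"

text \<open>
  Elements of \<^term>\<open>auto G\<close> are extensional functions, hence the restrictions to carriers below.
\<close>

definition inner_autos :: "('a, 'b) monoid_scheme \<Rightarrow> ('a \<Rightarrow> 'a) set" where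
  "inner_autos G = {\<lambda>h\<in>carrier G. g \<otimes>\<^bsub>G\<^esub> h \<otimes>\<^bsub>G\<^esub> inv\<^bsub>G\<^esub> g | g. g \<in> carrier G}"

definition reiner_autos ::
    "coord_ring^2^2 \<Rightarrow> coord_ring^2^2 \<Rightarrow> (coord_ring^2^2 \<Rightarrow> coord_ring^2^2) set" where
  "reiner_autos M0 M1 = {f \<in> auto GL2A. \<exists>V \<phi>.
     F2.subspace V \<and>
     range F2_emb \<inter> V = {0} \<and> (\<forall>a. \<exists>c. \<exists>v\<in>V. a = F2_emb c + v) \<and>
     bij_betw \<phi> V V \<and>
     (\<forall>u\<in>V. \<forall>v\<in>V. \<phi> (u + v) = \<phi> u + \<phi> v) \<and>
     (\<forall>c. \<forall>v\<in>V. \<phi> (F2_emb c * v) = F2_emb c * \<phi> v) \<and>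
     (\<forall>c. \<forall>v\<in>V. f (unip (F2_emb c + v)) = unip (F2_emb c + \<phi> v)) \<and>
     (\<forall>M\<in>GL2F2. f M = M) \<and> f M0 = M0 \<and> f M1 = M1}"

definition factor_autos ::
    "coord_ring^2^2 \<Rightarrow> coord_ring^2^2 \<Rightarrow> (coord_ring^2^2 \<Rightarrow> coord_ring^2^2) set" where
  "factor_autos M0 M1 = {f \<in> auto GL2A. \<exists>i\<in>{1, 2}.
     restrict f (factor M0 M1 i) \<in> auto (GL2A\<lparr>carrier := factor M0 M1 i\<rparr>) \<and>
     (\<forall>j\<in>{..<3} - {i}. \<forall>z\<in>factor M0 M1 j. f z = z)}"

definition swap_autos ::
    "coord_ring^2^2 \<Rightarrow> coord_ring^2^2 \<Rightarrow> (coord_ring^2^2 \<Rightarrow> coord_ring^2^2) set" where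
  "swap_autos M0 M1 = {f \<in> auto GL2A.
     f \<in> iso (GL2A\<lparr>carrier := cyc M0\<rparr>) (GL2A\<lparr>carrier := cyc M1\<rparr>) \<and>
     (\<forall>z\<in>cyc M1. f z = inv_into (cyc M0) f z) \<and>
     (\<forall>z\<in>H_subgroup. f z = z)}"

definition partial_conjugations ::
    "coord_ring^2^2 \<Rightarrow> coord_ring^2^2 \<Rightarrow> (coord_ring^2^2 \<Rightarrow> coord_ring^2^2) set" where
  "partial_conjugations M0 M1 = {f \<in> auto GL2A.
     \<exists>i\<in>{..<3}. \<exists>j\<in>{..<3} - {i}. \<exists>x\<in>factor M0 M1 i.
       (\<forall>z\<in>factor M0 M1 j. f z = x \<otimes>\<^bsub>GL2A\<^esub> z \<otimes>\<^bsub>GL2A\<^esub> inv\<^bsub>GL2A\<^esub> x) \<and>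
       (\<forall>k\<in>{..<3} - {j}. \<forall>z\<in>factor M0 M1 k. f z = z)}"

definition cyclic_spike_autos ::
    "coord_ring^2^2 \<Rightarrow> coord_ring^2^2 \<Rightarrow> (coord_ring^2^2 \<Rightarrow> coord_ring^2^2) set" where
  "cyclic_spike_autos M0 M1 = generate (AutoGroup GL2A)
     (factor_autos M0 M1 \<union> swap_autos M0 M1 \<union> partial_conjugations M0 M1)"

end

theory Submission
  imports Defs "HOL-Analysis.Determinants"
begin

text \<open>
  By torsion and malnormality in the free product, an automorphism carries \<open>H\<close> and the two cyclic
  factors to conjugates of these factors: \<open>H\<close> is generated by torsion elements linked by
  commutation and inversion relations, so its image lies in a single conjugate. A swap fixes the
  order of the factors. If the automorphism sends \<open>X i\<close> to the conjugate of \<open>X i\<close> by \<open>g i\<close>, either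
  all \<open>g i\<close> can be taken trivial, or a partial conjugation shortens one of them: once no shortening is
  possible, no letter cancels in products of elements of the conjugates, and surjectivity forces the
  \<open>g i\<close> to be trivial. What remains is an automorphism of \<open>H\<close>.

  The degree on \<open>A\<close> at infinity provides normal forms for \<open>H\<close> as an amalgam of \<open>GL\<^sub>2(F\<^sub>2)\<close> and
  \<open>U(A)\<close>, and trace degrees show that elements of order 2 or 3 of \<open>H\<close> are conjugate into these two
  groups. Hence, up to inner automorphisms, an automorphism of \<open>H\<close> fixes \<open>GL\<^sub>2(F\<^sub>2)\<close> and acts on \<open>A\<close>
  by an additive bijection fixing 1. Such a bijection need not preserve a complement of \<open>F\<^sub>2\<close>, but it is
  a product of a transvection and a bijection that both do.
\<close>

text \<open>\<open>H\<close> also contains elements of order 3, so orders alone do not separate it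
  from the cyclic factors. An involution, however, can only be conjugate into \<open>H\<close>, and
  from the image of \<open>unip 1\<close> the rest of the image of \<open>H\<close> is reached by
  malnormality. A cyclic factor cannot land in a conjugate of \<open>H\<close>, because an
  automorphism maps \<open>H\<close> onto such a conjugate and distinct factors share no nontrivial
  elements up to conjugation.

  Inside \<open>H\<close> two conjugators compete: one straightens U(A), the centralizer of
  \<open>unip 1\<close>, the other an element of order 3 of GL_2(F_2). They can be reconciled
  because \<open>p^2 + p q + q^2 = 1\<close> has only constant solutions in A, which rests on the
  residue field F_2 at infinity.

  The transvection is unavoidable. If \<open>l\<close> is a nonzero functional with
  \<open>l 1 = 0\<close>, then \<open>a \<mapsto> a + l a\<close> is additive, bijective and fixes
  1, but it preserves no complement of F_2: a complement is the kernel of a functional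
  \<open>d\<close> with \<open>d 1 = 1\<close>, and its invariance means
  \<open>d (a + l a) = d a\<close> for all \<open>a\<close>, that is \<open>l = 0\<close>.\<close>

section \<open>Internal free products\<close>

lemma (in group) inv_cancel [simp]:
  assumes "g \<in> carrier G" "x \<in> carrier G"
  shows "inv g \<otimes> (g \<otimes> x) = x" "g \<otimes> (inv g \<otimes> x) = x"
  using assms by (simp_all flip: m_assoc)

lemma (in group) conj_conj:
  assumes "g \<in> carrier G" "h \<in> carrier G" "x \<in> carrier G"
  shows "g \<otimes> (h \<otimes> x \<otimes> inv h) \<otimes> inv g = (g \<otimes> h) \<otimes> x \<otimes> inv (g \<otimes> h)"
  using assms by (simp add: m_assoc inv_mult_group)

lemma (in group) conj_mult:
  assumes "g \<in> carrier G" "x \<in> carrier G" "y \<in> carrier G"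
  shows "g \<otimes> (x \<otimes> y) \<otimes> inv g = (g \<otimes> x \<otimes> inv g) \<otimes> (g \<otimes> y \<otimes> inv g)"
  using assms by (simp add: m_assoc)

lemma (in group) conj_pow:
  assumes "g \<in> carrier G" "x \<in> carrier G"
  shows "(g \<otimes> x \<otimes> inv g) [^] (n::nat) = g \<otimes> x [^] n \<otimes> inv g"
  by (induction n) (use assms in \<open>simp_all add: conj_mult\<close>)

lemma (in group) conj_eq_iff:
  assumes "g \<in> carrier G" "x \<in> carrier G" "y \<in> carrier G"
  shows "g \<otimes> x \<otimes> inv g = y \<longleftrightarrow> x = inv g \<otimes> y \<otimes> g"
proof
  assume "g \<otimes> x \<otimes> inv g = y"
  then have "inv g \<otimes> y \<otimes> g = inv g \<otimes> (g \<otimes> x \<otimes> inv g) \<otimes> g" by simp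
  then show "x = inv g \<otimes> y \<otimes> g" using assms by (simp add: m_assoc)
next
  assume "x = inv g \<otimes> y \<otimes> g"
  then have "g \<otimes> x \<otimes> inv g = g \<otimes> (inv g \<otimes> y \<otimes> g) \<otimes> inv g" by simp
  then show "g \<otimes> x \<otimes> inv g = y" using assms by (simp add: m_assoc)
qed

lemma carrier_AutoGroup [simp]: "carrier (AutoGroup G) = auto G"
  by (simp add: AutoGroup_def)

lemma AutoGroup_mult:
  "\<lbrakk>f \<in> auto G; h \<in> auto G\<rbrakk> \<Longrightarrow> f \<otimes>\<^bsub>AutoGroup G\<^esub> h = compose (carrier G) f h"
  by (simp add: AutoGroup_def BijGroup_def auto_def)

lemma AutoGroup_one: "\<one>\<^bsub>AutoGroup G\<^esub> = (\<lambda>x\<in>carrier G. x)"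
  by (simp add: AutoGroup_def BijGroup_def)

text \<open>Applied to the normal forms of \<open>g i\<close> and \<open>g j\<close>: once the
  common prefix is removed, the product \<open>inv (g i) \<otimes> g j\<close> can at most merge one
  letter from each side.\<close>

lemma longest_common_prefix:
  "\<exists>p b c. u = p @ b \<and> v = p @ c \<and> (b = [] \<or> c = [] \<or> hd b \<noteq> hd c)"
proof (induction u arbitrary: v)
  case (Cons x u)
  show ?case
  proof (cases "v \<noteq> [] \<and> hd v = x")
    case True
    then obtain v' where v: "v = x # v'" by (cases v) auto
    obtain p b c where "u = p @ b" "v' = p @ c" "b = [] \<or> c = [] \<or> hd b \<noteq> hd c"
      using Cons by blast
    then show ?thesis using v by (intro exI[of _ "x # p"] exI[of _ b] exI[of _ c]) simp
  next
    case False
    then show ?thesis by (intro exI[of _ "[]"] exI[of _ "x # u"] exI[of _ v]) auto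
  qed
qed simp

section \<open>Reduced words and their inverses\<close>

lemma word_prod_Nil [simp]: "word_prod G [] = \<one>\<^bsub>G\<^esub>"
  by (simp add: word_prod_def)

lemma word_prod_Cons [simp]: "word_prod G ((i, x) # w) = x \<otimes>\<^bsub>G\<^esub> word_prod G w"
  by (simp add: word_prod_def)

lemma reduced_word_Nil [simp]: "reduced_word G I X []"
  by (simp add: reduced_word_def)

lemma reduced_word_append_iff:
  "reduced_word G I X (u @ v) \<longleftrightarrow>
     reduced_word G I X u \<and> reduced_word G I X v \<and>
     (u = [] \<or> v = [] \<or> fst (last u) \<noteq> fst (hd v))"
  by (auto simp: reduced_word_def distinct_adj_append_iff last_map hd_map)

lemma reduced_word_Cons_iff:
  "reduced_word G I X ((i, x) # w) \<longleftrightarrow>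
     i \<in> I \<and> x \<in> X i \<and> x \<noteq> \<one>\<^bsub>G\<^esub> \<and> reduced_word G I X w \<and> (w = [] \<or> i \<noteq> fst (hd w))"
  using reduced_word_append_iff[of G I X "[(i, x)]" w] by (auto simp: reduced_word_def)

definition inv_word :: "('a, 'b) monoid_scheme \<Rightarrow> ('i \<times> 'a) list \<Rightarrow> ('i \<times> 'a) list" where
  "inv_word G w = rev (map (\<lambda>(i, x). (i, inv\<^bsub>G\<^esub> x)) w)"

lemma inv_word_Nil [simp]: "inv_word G [] = []"
  and inv_word_Cons: "inv_word G ((i, x) # w) = inv_word G w @ [(i, inv\<^bsub>G\<^esub> x)]"
  and inv_word_eq_Nil_iff [simp]: "inv_word G w = [] \<longleftrightarrow> w = []"
  and length_inv_word [simp]: "length (inv_word G w) = length w"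
  by (simp_all add: inv_word_def)

lemma fst_hd_inv_word: "w \<noteq> [] \<Longrightarrow> fst (hd (inv_word G w)) = fst (last w)"
  by (simp add: inv_word_def hd_rev last_map split_beta)

lemma fst_last_inv_word: "w \<noteq> [] \<Longrightarrow> fst (last (inv_word G w)) = fst (hd w)"
  by (simp add: inv_word_def last_rev hd_map split_beta)

section \<open>Normal forms in a free product\<close>

locale internal_free_product = group G for G (structure) +
  fixes I :: "'i set" and X :: "'i \<Rightarrow> 'a set"
  assumes free: "is_free_product G I X"
begin

abbreviation "red \<equiv> reduced_word G I X"
abbreviation "wp \<equiv> word_prod G"

lemma sub: "i \<in> I \<Longrightarrow> subgroup (X i) G"
  using free by (auto simp: is_free_product_def)

lemma factor_carrier: "\<lbrakk>i \<in> I; x \<in> X i\<rbrakk> \<Longrightarrow> x \<in> carrier G"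
  using sub subgroup.mem_carrier by fast

lemma factor_mult: "\<lbrakk>i \<in> I; x \<in> X i; y \<in> X i\<rbrakk> \<Longrightarrow> x \<otimes> y \<in> X i"
  using sub subgroup.m_closed by fast

lemma factor_inv: "\<lbrakk>i \<in> I; x \<in> X i\<rbrakk> \<Longrightarrow> inv x \<in> X i"
  using sub subgroup.m_inv_closed by fast

lemma factor_one: "i \<in> I \<Longrightarrow> \<one> \<in> X i"
  using sub subgroup.one_closed by fast

text \<open>Trivial letters and neighbours from one factor are allowed, so such words may be
  concatenated and altered freely; \<open>len_wp\<close> still bounds the length of the reduced
  result.\<close>

definition is_word :: "('i \<times> 'a) list \<Rightarrow> bool" where
  "is_word w \<longleftrightarrow> (\<forall>(i, x) \<in> set w. i \<in> I \<and> x \<in> X i)"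

lemma is_word_Nil [simp]: "is_word []"
  and is_word_Cons [simp]: "is_word ((i, x) # w) \<longleftrightarrow> i \<in> I \<and> x \<in> X i \<and> is_word w"
  and is_word_append [simp]: "is_word (u @ v) \<longleftrightarrow> is_word u \<and> is_word v"
  by (auto simp: is_word_def)

lemma red_is_word: "red w \<Longrightarrow> is_word w"
  by (auto simp: reduced_word_def is_word_def)

lemma wp_closed [intro, simp]: "is_word w \<Longrightarrow> wp w \<in> carrier G"
  by (induction w) (auto simp: factor_carrier)

lemma wp_append: "\<lbrakk>is_word u; is_word v\<rbrakk> \<Longrightarrow> wp (u @ v) = wp u \<otimes> wp v"
  by (induction u) (auto simp: m_assoc factor_carrier)

lemma is_word_inv_word: "is_word w \<Longrightarrow> is_word (inv_word G w)"
  by (induction w) (auto simp: inv_word_Cons factor_inv)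

lemma wp_inv_word: "is_word w \<Longrightarrow> wp (inv_word G w) = inv (wp w)"
proof (induction w)
  case (Cons a w)
  obtain i x where "a = (i, x)" by force
  with Cons show ?case
    by (simp add: inv_word_Cons wp_append is_word_inv_word factor_inv factor_carrier[of i]
        inv_mult_group)
qed simp

lemma red_inv_word: "red w \<Longrightarrow> red (inv_word G w)"
proof (induction w)
  case (Cons a w)
  obtain i x where a: "a = (i, x)" by force
  then have "i \<in> I" "x \<in> X i" "x \<noteq> \<one>" "red w" "w = [] \<or> i \<noteq> fst (hd w)"
    using Cons.prems by (auto simp: reduced_word_Cons_iff)
  moreover from this have "inv x \<noteq> \<one>" "inv x \<in> X i"
    using factor_carrier factor_inv by auto
  ultimately show ?case
    using Cons.IH a
    by (auto simp: inv_word_Cons reduced_word_append_iff reduced_word_Cons_iff fst_last_inv_word)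
qed simp

definition nf :: "'a \<Rightarrow> ('i \<times> 'a) list" where
  "nf g = inv_into {w. red w} wp g"

lemma wp_inj: "\<lbrakk>red u; red v; wp u = wp v\<rbrakk> \<Longrightarrow> u = v"
  using free by (auto simp: is_free_product_def bij_betw_def inj_on_def)

lemma wp_nf [simp]: "g \<in> carrier G \<Longrightarrow> wp (nf g) = g"
  unfolding nf_def using free
  by (intro f_inv_into_f) (auto simp: is_free_product_def bij_betw_def)

lemma red_nf: "g \<in> carrier G \<Longrightarrow> red (nf g)"
  unfolding nf_def using free inv_into_into[of g wp "{w. red w}"]
  by (auto simp: is_free_product_def bij_betw_def)

lemma is_word_nf [simp]: "g \<in> carrier G \<Longrightarrow> is_word (nf g)"
  by (simp add: red_is_word red_nf)

lemma nf_wp: "red w \<Longrightarrow> nf (wp w) = w"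
  by (intro wp_inj) (auto simp: red_nf red_is_word)

lemma nf_eqI: "\<lbrakk>red w; wp w = g\<rbrakk> \<Longrightarrow> nf g = w"
  using nf_wp by blast

lemma nf_one [simp]: "nf \<one> = []"
  by (rule nf_eqI) auto

lemma nf_factor: "\<lbrakk>i \<in> I; x \<in> X i; x \<noteq> \<one>\<rbrakk> \<Longrightarrow> nf x = [(i, x)]"
  by (rule nf_eqI) (auto simp: reduced_word_Cons_iff factor_carrier)

lemma nf_eq_Nil_iff: "g \<in> carrier G \<Longrightarrow> nf g = [] \<longleftrightarrow> g = \<one>"
  using wp_nf[of g] by (auto simp del: wp_nf)

lemma carrier_is_word_induct [consumes 1, case_names one mult]:
  assumes "g \<in> carrier G" "P \<one>"
    and "\<And>i x h. \<lbrakk>i \<in> I; x \<in> X i; h \<in> carrier G; P h\<rbrakk> \<Longrightarrow> P (x \<otimes> h)"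
  shows "P g"
proof -
  have "is_word w \<Longrightarrow> P (wp w)" for w
    by (induction w) (use assms in auto)
  from this[of "nf g"] assms(1) show ?thesis by simp
qed

text \<open>The multiplication table of normal forms: a letter is prepended, cancels the first
  letter, or merges with it.\<close>

lemma nf_mult_cases:
  assumes "i \<in> I" "x \<in> X i" "x \<noteq> \<one>" "g \<in> carrier G"
  obtains "nf g = [] \<or> fst (hd (nf g)) \<noteq> i" "nf (x \<otimes> g) = (i, x) # nf g"
  | w where "nf g = (i, inv x) # w" "nf (x \<otimes> g) = w"
  | y w where "nf g = (i, y) # w" "y \<in> X i" "x \<otimes> y \<noteq> \<one>" "nf (x \<otimes> g) = (i, x \<otimes> y) # w"
proof (cases "nf g = [] \<or> fst (hd (nf g)) \<noteq> i")
  case True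
  then have "nf (x \<otimes> g) = (i, x) # nf g"
    using assms red_nf[of g] by (intro nf_eqI) (auto simp: reduced_word_Cons_iff)
  with True that(1) show ?thesis by blast
next
  case False
  then obtain y w where g: "nf g = (i, y) # w" by (cases "nf g") auto
  then have r: "y \<in> X i" "red w" "w = [] \<or> i \<noteq> fst (hd w)" "is_word w"
    using red_nf[of g] assms red_is_word by (auto simp: reduced_word_Cons_iff)
  have c: "x \<in> carrier G" "y \<in> carrier G" using assms r factor_carrier by auto
  have eq: "x \<otimes> g = (x \<otimes> y) \<otimes> wp w"
    using wp_nf[OF assms(4)] g c r by (simp add: m_assoc)
  show ?thesis
  proof (cases "x \<otimes> y = \<one>")
    case True
    then have "inv x = y" using c inv_equality inv_comm by blast
    moreover have "nf (x \<otimes> g) = w" using eq True r by (intro nf_eqI) auto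
    ultimately show ?thesis using that(2) g by blast
  next
    case False
    then have "red ((i, x \<otimes> y) # w)" using r assms factor_mult by (simp add: reduced_word_Cons_iff)
    then have "nf (x \<otimes> g) = (i, x \<otimes> y) # w" using eq by (intro nf_eqI) auto
    then show ?thesis using that(3) g r False by blast
  qed
qed

abbreviation len :: "'a \<Rightarrow> nat" where "len g \<equiv> length (nf g)"

lemma len_factor_mult:
  assumes "i \<in> I" "x \<in> X i" "g \<in> carrier G"
  shows "len (x \<otimes> g) \<le> Suc (len g)"
proof (cases "x = \<one>")
  case False
  from assms(1,2) False assms(3) show ?thesis by (cases rule: nf_mult_cases) auto
qed (use assms in simp)

lemma len_wp: "is_word w \<Longrightarrow> len (wp w) \<le> length w"
proof (induction w)
  case (Cons a w)
  then show ?case using len_factor_mult[of "fst a" "snd a" "wp w"] by (cases a) auto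
qed simp

section \<open>Homomorphisms given on the factors\<close>

lemma hom_eqI:
  assumes "group K" "\<phi> \<in> hom G K" "\<psi> \<in> hom G K"
    and "\<And>i x. \<lbrakk>i \<in> I; x \<in> X i\<rbrakk> \<Longrightarrow> \<phi> x = \<psi> x" and "g \<in> carrier G"
  shows "\<phi> g = \<psi> g"
  using assms(5)
proof (induction rule: carrier_is_word_induct)
  case one
  then show ?case using assms(1-3) by (simp add: hom_one is_group)
next
  case (mult i x h)
  then show ?case using assms(2-4) factor_carrier by (simp add: hom_mult)
qed

text \<open>The universal property of the free product. Reading off the normal form makes the map
  well defined at once; what needs proof is multiplicativity, and \<open>extend_factor_mult\<close>
  settles it for one letter. The restriction to the carrier provides the extensionality that
  \<open>auto\<close> demands.\<close>

definition extend :: "('c, 'd) monoid_scheme \<Rightarrow> ('i \<Rightarrow> 'a \<Rightarrow> 'c) \<Rightarrow> 'a \<Rightarrow> 'c" where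
  "extend K \<alpha> = (\<lambda>g\<in>carrier G. word_prod K (map (\<lambda>(i, x). (i, \<alpha> i x)) (nf g)))"

context
  fixes K (structure) and \<alpha> :: "'i \<Rightarrow> 'a \<Rightarrow> 'c"
  assumes K: "group K"
    and \<alpha>: "\<And>i. i \<in> I \<Longrightarrow> \<alpha> i \<in> hom (G\<lparr>carrier := X i\<rparr>) K"
begin

interpretation K: group K by (rule K)

lemma hom_closed': "\<lbrakk>i \<in> I; x \<in> X i\<rbrakk> \<Longrightarrow> \<alpha> i x \<in> carrier K"
  using \<alpha> by (fastforce simp: hom_def)

lemma hom_mult': "\<lbrakk>i \<in> I; x \<in> X i; y \<in> X i\<rbrakk> \<Longrightarrow> \<alpha> i (x \<otimes>\<^bsub>G\<^esub> y) = \<alpha> i x \<otimes>\<^bsub>K\<^esub> \<alpha> i y"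
  using \<alpha> by (fastforce simp: hom_def)

lemma hom_one': "i \<in> I \<Longrightarrow> \<alpha> i \<one>\<^bsub>G\<^esub> = \<one>\<^bsub>K\<^esub>"
  using hom_mult'[of i "\<one>\<^bsub>G\<^esub>" "\<one>\<^bsub>G\<^esub>"] hom_closed' factor_one K.l_cancel_one by simp

lemma extend_word_closed:
  "is_word w \<Longrightarrow> word_prod K (map (\<lambda>(i, x). (i, \<alpha> i x)) w) \<in> carrier K"
  by (induction w) (auto simp: hom_closed')

lemma extend_closed: "g \<in> carrier G \<Longrightarrow> extend K \<alpha> g \<in> carrier K"
  by (simp add: extend_def extend_word_closed)

lemma extend_factor_mult:
  assumes "i \<in> I" "x \<in> X i" "g \<in> carrier G"
  shows "extend K \<alpha> (x \<otimes>\<^bsub>G\<^esub> g) = \<alpha> i x \<otimes>\<^bsub>K\<^esub> extend K \<alpha> g"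
proof (cases "x = \<one>\<^bsub>G\<^esub>")
  case True
  then show ?thesis using assms extend_closed by (simp add: hom_one')
next
  case False
  have c: "x \<in> carrier G" "x \<otimes>\<^bsub>G\<^esub> g \<in> carrier G" using assms factor_carrier by auto
  note e = extend_def assms c
  from assms(1,2) False assms(3) show ?thesis
  proof (cases rule: nf_mult_cases)
    case (2 w)
    have i: "inv\<^bsub>G\<^esub> x \<in> X i" using factor_inv assms by blast
    have w: "is_word w" using is_word_nf[OF assms(3)] 2 by simp
    have "\<alpha> i x \<otimes>\<^bsub>K\<^esub> \<alpha> i (inv\<^bsub>G\<^esub> x) = \<one>\<^bsub>K\<^esub>"
      using hom_mult'[OF assms(1,2) i] c hom_one' assms by simp
    then show ?thesis
      using 2 extend_word_closed[OF w] assms i by (simp add: e hom_closed' flip: K.m_assoc)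
  next
    case (3 y w)
    then show ?thesis
      using extend_word_closed[of w] is_word_nf[OF assms(3)]
      by (simp add: e hom_mult' hom_closed' K.m_assoc)
  qed (simp add: e)
qed

lemma extend_factor: "\<lbrakk>i \<in> I; x \<in> X i\<rbrakk> \<Longrightarrow> extend K \<alpha> x = \<alpha> i x"
  using extend_factor_mult[of i x "\<one>\<^bsub>G\<^esub>"] factor_carrier
  by (simp add: extend_def hom_closed')

lemma extend_hom: "extend K \<alpha> \<in> hom G K"
proof (rule homI)
  fix g h assume gh: "g \<in> carrier G" "h \<in> carrier G"
  from gh(1) show "extend K \<alpha> (g \<otimes>\<^bsub>G\<^esub> h) = extend K \<alpha> g \<otimes>\<^bsub>K\<^esub> extend K \<alpha> h"
  proof (induction rule: carrier_is_word_induct)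
    case one
    then show ?case using gh extend_closed by (simp add: extend_def)
  next
    case (mult i x g)
    then show ?case using gh
      by (simp add: m_assoc factor_carrier extend_factor_mult extend_closed hom_closed' K.m_assoc)
  qed
qed (rule extend_closed)

end

text \<open>Both composites are homomorphisms fixing every factor pointwise, hence the identity by
  \<open>hom_eqI\<close>. The maps may leave their factor, as they do for swaps and partial
  conjugations.\<close>

lemma extend_auto:
  assumes \<alpha>: "\<And>i. i \<in> I \<Longrightarrow> \<alpha> i \<in> hom (G\<lparr>carrier := X i\<rparr>) G"
    and \<beta>: "\<And>i. i \<in> I \<Longrightarrow> \<beta> i \<in> hom (G\<lparr>carrier := X i\<rparr>) G"
    and \<alpha>\<beta>: "\<And>i x. \<lbrakk>i \<in> I; x \<in> X i\<rbrakk> \<Longrightarrow> extend G \<alpha> (\<beta> i x) = x"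
    and \<beta>\<alpha>: "\<And>i x. \<lbrakk>i \<in> I; x \<in> X i\<rbrakk> \<Longrightarrow> extend G \<beta> (\<alpha> i x) = x"
  shows "extend G \<alpha> \<in> auto G"
proof -
  have h: "extend G \<alpha> \<in> hom G G" "extend G \<beta> \<in> hom G G"
    using extend_hom[OF is_group] assms(1,2) by blast+
  have comp: "extend G a (extend G b g) = g"
    if "extend G a \<in> hom G G" "extend G b \<in> hom G G" "g \<in> carrier G"
      "\<And>i x. \<lbrakk>i \<in> I; x \<in> X i\<rbrakk> \<Longrightarrow> extend G a (extend G b x) = x" for a b g
  proof -
    have "(extend G a \<circ> extend G b) g = (\<lambda>x. x) g"
    proof (rule hom_eqI[OF is_group])
      show "extend G a \<circ> extend G b \<in> hom G G" 
        using that(1,2) by (intro homI) (auto simp: hom_mult hom_in_carrier)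
      show "(\<lambda>x. x) \<in> hom G G" by (rule homI) auto
    qed (use that(3,4) in auto)
    then show ?thesis by simp
  qed
  have 1: "extend G \<alpha> (extend G \<beta> g) = g" if "g \<in> carrier G" for g
    using extend_factor[OF is_group \<beta>] \<alpha>\<beta> by (intro comp[OF h that]) metis
  have 2: "extend G \<beta> (extend G \<alpha> g) = g" if "g \<in> carrier G" for g
    using extend_factor[OF is_group \<alpha>] \<beta>\<alpha> by (intro comp[OF h(2,1) that]) metis
  have "bij_betw (extend G \<alpha>) (carrier G) (carrier G)"
    using h 1 2 by (intro bij_betw_byWitness[where f' = "extend G \<beta>"]) (auto simp: hom_def)
  moreover have "extend G \<alpha> \<in> extensional (carrier G)"
    by (simp add: extend_def)
  ultimately show ?thesis using h by (simp add: auto_def Bij_def)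
qed

lemma factorwise_auto:
  assumes "\<And>i. i \<in> I \<Longrightarrow> \<alpha> i \<in> hom (G\<lparr>carrier := X i\<rparr>) (G\<lparr>carrier := X i\<rparr>)"
    and "\<And>i. i \<in> I \<Longrightarrow> bij_betw (\<alpha> i) (X i) (X i)"
  obtains f where "f \<in> auto G" "\<And>i x. \<lbrakk>i \<in> I; x \<in> X i\<rbrakk> \<Longrightarrow> f x = \<alpha> i x"
proof -
  have sg: "group (G\<lparr>carrier := X i\<rparr>)" if "i \<in> I" for i
    using subgroup.subgroup_is_group[OF sub[OF that]] is_group by blast
  have up: "f \<in> hom (G\<lparr>carrier := X i\<rparr>) G" 
    if "i \<in> I" "f \<in> hom (G\<lparr>carrier := X i\<rparr>) (G\<lparr>carrier := X i\<rparr>)" for f i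
    using that factor_carrier by (fastforce simp: hom_def)
  define \<beta> where "\<beta> i = inv_into (X i) (\<alpha> i)" for i
  have \<alpha>: "\<alpha> i \<in> hom (G\<lparr>carrier := X i\<rparr>) G" if "i \<in> I" for i
    using assms up that by blast
  have iso: "\<alpha> i \<in> iso (G\<lparr>carrier := X i\<rparr>) (G\<lparr>carrier := X i\<rparr>)" if "i \<in> I" for i
    using assms that by (auto simp: iso_def)
  have "\<beta> i \<in> iso (G\<lparr>carrier := X i\<rparr>) (G\<lparr>carrier := X i\<rparr>)" if "i \<in> I" for i
    using group.iso_set_sym[OF sg[OF that] iso[OF that]] by (simp add: \<beta>_def)
  then have \<beta>: "\<beta> i \<in> hom (G\<lparr>carrier := X i\<rparr>) G" if "i \<in> I" for i
    using up that by (auto simp: iso_def)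
  have mem: "\<alpha> i x \<in> X i" "\<beta> i x \<in> X i" "\<alpha> i (\<beta> i x) = x" "\<beta> i (\<alpha> i x) = x" if "i \<in> I" "x \<in> X i" for i x
    using that assms(2)[OF that(1)] bij_betw_inv_into[OF assms(2)[OF that(1)]]
    by (auto simp: \<beta>_def bij_betw_inv_into_right bij_betw_inv_into_left bij_betwE)
  have "extend G \<alpha> \<in> auto G"
    using \<alpha> \<beta> mem by (intro extend_auto[where \<beta> = \<beta>])
      (auto simp: extend_factor[OF is_group \<alpha>] extend_factor[OF is_group \<beta>])
  moreover have "extend G \<alpha> x = \<alpha> i x" if "i \<in> I" "x \<in> X i" for i x
    using extend_factor[OF is_group \<alpha>] that by auto
  ultimately show ?thesis using that by blast
qed

lemma partial_conjugation:
  assumes "i \<in> I" "j \<in> I" "i \<noteq> j" "x \<in> X i"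
  obtains f where "f \<in> auto G" "\<And>z. z \<in> X j \<Longrightarrow> f z = x \<otimes> z \<otimes> inv x"
    "\<And>k z. \<lbrakk>k \<in> I; k \<noteq> j; z \<in> X k\<rbrakk> \<Longrightarrow> f z = z"
proof -
  define \<alpha> where "\<alpha> x k = (\<lambda>z. if k = j then x \<otimes> z \<otimes> inv x else z)" for x k
  have h: "\<alpha> x k \<in> hom (G\<lparr>carrier := X k\<rparr>) G" if "k \<in> I" "x \<in> X i" for k x
  proof (rule homI)
    have x: "x \<in> carrier G" using that assms factor_carrier by blast
    fix y z assume "y \<in> carrier (G\<lparr>carrier := X k\<rparr>)" "z \<in> carrier (G\<lparr>carrier := X k\<rparr>)"
    then have yz: "y \<in> carrier G" "z \<in> carrier G" using that factor_carrier by auto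
    show "\<alpha> x k y \<in> carrier G" using x yz by (simp add: \<alpha>_def)
    show "\<alpha> x k (y \<otimes>\<^bsub>G\<lparr>carrier := X k\<rparr>\<^esub> z) = \<alpha> x k y \<otimes> \<alpha> x k z"
      using x yz by (simp add: \<alpha>_def conj_mult)
  qed
  have eval: "extend G (\<alpha> x) z = \<alpha> x k z" if "k \<in> I" "x \<in> X i" "z \<in> X k" for x k z
    using extend_factor[OF is_group h] that by auto
  have hm: "extend G (\<alpha> x) \<in> hom G G" if "x \<in> X i" for x
    using extend_hom[OF is_group h] that by auto
  \<comment> \<open>The elements \<open>x\<close> and \<open>y\<close> lie in \<open>X i\<close>,
    which both maps fix pointwise; so the conjugations of \<open>X j\<close> by \<open>y\<close> and
    by \<open>x\<close> compose to conjugation by a trivial product.\<close>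
  have inv: "extend G (\<alpha> x) (\<alpha> y k z) = z" if x: "x \<in> X i" "y \<in> X i" "x \<otimes> y = \<one>" and k: "k \<in> I" "z \<in> X k" for x y k z
  proof (cases "k = j")
    case True
    have c: "x \<in> carrier G" "y \<in> carrier G" "z \<in> carrier G" using x k assms factor_carrier by auto
    have "extend G (\<alpha> x) (y \<otimes> z \<otimes> inv y) = y \<otimes> (x \<otimes> z \<otimes> inv x) \<otimes> inv y"
      using hm[OF x(1)] c eval[of i x y] eval[of i x "inv y"] eval[of j x z] True x k assms factor_inv
      by (simp add: hom_mult \<alpha>_def)
    also have "\<dots> = z"
      using x c inv_comm[of x y] by (subst conj_conj) auto
    finally show ?thesis using True by (simp add: \<alpha>_def)
  next
    case False
    then show ?thesis using eval[of k x z] x k by (simp add: \<alpha>_def)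
  qed
  have "extend G (\<alpha> x) \<in> auto G"
    using h assms factor_inv factor_carrier
    by (intro extend_auto[where \<beta> = "\<alpha> (inv x)"]) (auto intro!: inv)
  then show ?thesis
    using that[of "extend G (\<alpha> x)"] eval assms by (auto simp: \<alpha>_def)
qed

section \<open>Torsion and malnormality\<close>

text \<open>Take a normal form of at least two letters. If its first and last letters lie in the
  same factor, conjugating by the first letter shortens \<open>g\<close>. Otherwise copies of the
  normal form can be concatenated without any reduction, so no positive power of \<open>g\<close> is
  trivial.\<close>

lemma torsion_conj_factor:
  assumes "g \<in> carrier G" "g [^] (n::nat) = \<one>" "n > 0" "g \<noteq> \<one>"
  shows "\<exists>k\<in>carrier G. \<exists>i\<in>I. \<exists>x\<in>X i. g = k \<otimes> x \<otimes> inv k"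
  using assms
proof (induction "len g" arbitrary: g rule: less_induct)
  case less
  have r: "red (nf g)" and g: "wp (nf g) = g" using less.prems red_nf by auto
  have ne: "nf g \<noteq> []" using nf_eq_Nil_iff less.prems by blast
  then obtain i x w where ix: "nf g = (i, x) # w" by (cases "nf g") auto
  have iI: "i \<in> I" "x \<in> X i" "x \<noteq> \<one>" "red w" using r ix by (auto simp: reduced_word_Cons_iff)
  have xc: "x \<in> carrier G" using iI factor_carrier by blast
  have w: "is_word w" "wp w \<in> carrier G" using iI red_is_word by auto
  have gx: "g = x \<otimes> wp w" using g ix by simp
  show ?case
  proof (cases "w = []")
    case True
    then have "g = \<one> \<otimes> x \<otimes> inv \<one>" using gx xc by simp
    then show ?thesis using iI by blast
  next
    case False
    show ?thesis
    proof (cases "fst (last w) = i")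
      case True
      then obtain z v where z: "w = v @ [(i, z)]"
        using False by (cases w rule: rev_cases) auto
      define g' where "g' = inv x \<otimes> g \<otimes> x"
      have zi: "z \<in> X i" "red v" "is_word v" using iI z red_is_word
        by (auto simp: reduced_word_append_iff reduced_word_Cons_iff)
      have "g' = wp v \<otimes> (z \<otimes> x)"
        using xc z zi iI gx by (simp add: g'_def wp_append factor_carrier m_assoc)
      then have "g' = wp (v @ [(i, z \<otimes> x)])"
        using zi iI by (simp add: wp_append factor_mult factor_carrier)
      moreover have "is_word (v @ [(i, z \<otimes> x)])" using zi iI factor_mult by simp
      ultimately have "len g' \<le> length (v @ [(i, z \<otimes> x)])"
        using len_wp by blast
      then have lt: "len g' < len g" using ix z by simp
      have gg: "g = x \<otimes> g' \<otimes> inv x" "g' \<in> carrier G"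
        using xc less.prems(1) by (simp_all add: g'_def m_assoc)
      have "x \<otimes> g' [^] n \<otimes> inv x = \<one>" using less.prems conj_pow gg xc by metis
      then have "g' [^] n = \<one>" using conj_eq_iff[of x "g' [^] n" \<one>] xc gg by simp
      moreover have "g' \<noteq> \<one>" using gg less.prems xc by auto
      ultimately obtain k j y where "k \<in> carrier G" "j \<in> I" "y \<in> X j" "g' = k \<otimes> y \<otimes> inv k"
        using less.hyps[OF lt] gg less.prems by blast
      moreover from this have "g = (x \<otimes> k) \<otimes> y \<otimes> inv (x \<otimes> k)"
        using gg xc conj_conj factor_carrier by simp
      ultimately show ?thesis using xc by blast
    next
      case neq: False
      have red_pow: "red (concat (replicate m (nf g))) \<and> wp (concat (replicate m (nf g))) = g [^] m \<and>
        (m > 0 \<longrightarrow> concat (replicate m (nf g)) \<noteq> [] \<and> fst (hd (concat (replicate m (nf g)))) = i)" for m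
      proof (induction m)
        case (Suc m)
        then have "red (nf g @ concat (replicate m (nf g)))"
        proof (cases "m = 0")
          case False
          moreover have "fst (last (nf g)) \<noteq> i" using ix neq \<open>w \<noteq> []\<close> by simp
          ultimately show ?thesis using r Suc by (subst reduced_word_append_iff) auto
        qed (use r in simp)
        moreover have "wp (nf g @ concat (replicate m (nf g))) = g [^] Suc m"
          using Suc wp_append[of "nf g" "concat (replicate m (nf g))"] red_is_word less.prems
            nat_pow_Suc2 by simp
        ultimately show ?case using ix by simp
      qed simp
      then have "wp (concat (replicate n (nf g))) = wp []" using less.prems by simp
      then have "concat (replicate n (nf g)) = []" using red_pow wp_inj reduced_word_Nil by blast
      then show ?thesis using red_pow less.prems by blast
    qed
  qed
qed

text \<open>A last letter of \<open>g\<close> from \<open>X i\<close> can be absorbed into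
  \<open>x\<close>, which it conjugates within \<open>X i\<close>. If there is none, the normal form
  of \<open>g \<otimes> x \<otimes> inv g\<close> consists of that of \<open>g\<close>, the letter
  \<open>x\<close> and the inverse word; it is a single letter only for
  \<open>g = \<one>\<close>.\<close>

lemma factor_malnormal:
  assumes "i \<in> I" "j \<in> I" "x \<in> X i" "x \<noteq> \<one>" "g \<in> carrier G" "g \<otimes> x \<otimes> inv g \<in> X j"
  shows "i = j \<and> g \<in> X i"
  using assms
proof (induction "len g" arbitrary: g x rule: less_induct)
  case less
  have r: "red (nf g)" "is_word (nf g)" and g: "wp (nf g) = g" using less.prems red_nf by auto
  have xc: "x \<in> carrier G" using less.prems factor_carrier by blast
  show ?case
  proof (cases "nf g \<noteq> [] \<and> fst (last (nf g)) = i")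
    case True
    then obtain w z where w: "nf g = w @ [(i, z)]" by (cases "nf g" rule: rev_cases) auto
    then have z: "z \<in> X i" "red w" "is_word w" using r red_is_word
      by (auto simp: reduced_word_append_iff reduced_word_Cons_iff)
    then have zc: "z \<in> carrier G" using less.prems factor_carrier by blast
    have gz: "g = wp w \<otimes> z" using g w z less.prems zc by (simp add: wp_append)
    have lt: "len (wp w) < len g" using nf_wp[OF z(2)] w by simp
    have "z \<otimes> x \<otimes> inv z \<in> X i" using z less.prems factor_mult factor_inv by simp
    moreover have "z \<otimes> x \<otimes> inv z \<noteq> \<one>" using conj_eq_iff[of z x \<one>] zc xc less.prems by simp
    moreover have "wp w \<otimes> (z \<otimes> x \<otimes> inv z) \<otimes> inv (wp w) \<in> X j"
      using less.prems zc xc z gz by (simp add: conj_conj)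
    ultimately have "i = j \<and> wp w \<in> X i" using less.hyps[OF lt] less.prems z by blast
    then show ?thesis using gz z less.prems factor_mult by blast
  next
    case False
    let ?w = "nf g @ (i, x) # inv_word G (nf g)"
    have "red ?w" using False r red_inv_word less.prems
      by (auto simp: reduced_word_append_iff reduced_word_Cons_iff fst_hd_inv_word)
    moreover have "wp ?w = g \<otimes> x \<otimes> inv g"
      using r g less.prems xc is_word_inv_word by (simp add: wp_append wp_inv_word m_assoc)
    ultimately have nfc: "nf (g \<otimes> x \<otimes> inv g) = ?w" by (rule nf_eqI)
    moreover have "g \<otimes> x \<otimes> inv g \<noteq> \<one>" using conj_eq_iff[of g x \<one>] xc less.prems by simp
    ultimately have eq: "?w = [(j, g \<otimes> x \<otimes> inv g)]" using nf_factor less.prems by metis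
    then have "length ?w = 1" by simp
    then have "nf g = []" by simp
    with eq have "i = j" "g = \<one>" using nf_eq_Nil_iff less.prems by auto
    then show ?thesis using factor_one less.prems by blast
  qed
qed

section \<open>Shortening the conjugators by partial conjugations\<close>

text \<open>
  The letters \<open>(i, x)\<close> of \<open>w\<close> survive: by the two hypotheses on \<open>g\<close> (minimality), in
  \<open>inv (g i) \<otimes> g j\<close> cancellation never reaches a letter at the end of \<open>g i\<close> or \<open>g j\<close>.
\<close>
lemma nf_conjugated_word:
  assumes g: "\<And>i. i \<in> I \<Longrightarrow> g i \<in> carrier G"
    and m1: "\<And>i. i \<in> I \<Longrightarrow> nf (g i) = [] \<or> fst (last (nf (g i))) \<noteq> i"
    and m2: "\<And>i j x q. \<lbrakk>i \<in> I; j \<in> I; i \<noteq> j\<rbrakk> \<Longrightarrow> nf (g j) \<noteq> nf (g i) @ (i, x) # q"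
    and "red ((i, x) # w)"
  shows "\<exists>r. nf (wp (map (\<lambda>(i, x). (i, g i \<otimes> x \<otimes> inv (g i))) ((i, x) # w))) = nf (g i) @ (i, x) # r"
  using assms(4)
proof (induction w arbitrary: i x)
  case Nil
  then have i: "i \<in> I" "x \<in> X i" "x \<noteq> \<one>" by (auto simp: reduced_word_Cons_iff)
  have xc: "x \<in> carrier G" using i factor_carrier by blast
  have r: "red (nf (g i))" using red_nf g i by blast
  let ?w = "nf (g i) @ (i, x) # inv_word G (nf (g i))"
  have "red ?w" using m1[of i] r red_inv_word[OF r] i
    by (auto simp: reduced_word_append_iff reduced_word_Cons_iff fst_hd_inv_word)
  moreover have "wp ?w = g i \<otimes> x \<otimes> inv (g i)"
    using g i xc by (simp add: wp_append wp_inv_word is_word_inv_word m_assoc)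
  ultimately have "nf (g i \<otimes> x \<otimes> inv (g i)) = ?w" by (rule nf_eqI)
  then show ?case using g i xc by simp
next
  case (Cons a w)
  obtain j y where a: "a = (j, y)" by force
  let ?Q = "\<lambda>w. wp (map (\<lambda>(i, x). (i, g i \<otimes> x \<otimes> inv (g i))) w)"
  have i: "i \<in> I" "x \<in> X i" "x \<noteq> \<one>" "j \<in> I" "i \<noteq> j" "red (a # w)"
    using Cons.prems a by (auto simp: reduced_word_Cons_iff)
  have xc: "x \<in> carrier G" using i factor_carrier by blast
  have Qc: "is_word v \<Longrightarrow> ?Q v \<in> carrier G" for v
    by (induction v) (auto simp: g factor_carrier)
  obtain r where r: "nf (?Q (a # w)) = nf (g j) @ (j, y) # r"
    using Cons.IH[of j y] i a by auto
  have Qaw: "?Q (a # w) \<in> carrier G" using Qc i red_is_word by blast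
  obtain p b c where pbc: "nf (g i) = p @ b" "nf (g j) = p @ c" "b = [] \<or> c = [] \<or> hd b \<noteq> hd c"
    using longest_common_prefix[of "nf (g i)" "nf (g j)"] by blast
  have gi: "red (nf (g i))" "wp (nf (g i)) = g i" and gj: "red (nf (g j))" "wp (nf (g j)) = g j"
    using red_nf g i by auto
  \<comment> \<open>With \<open>t\<close> the rest of the tail after \<open>p\<close>, the product
    is \<open>p b x b^-1 t\<close>; only the junction of \<open>b^-1\<close> and \<open>t\<close>
    can reduce.\<close>
  define t where "t = c @ (j, y) # r"
  have red_pt: "red (p @ t)" using red_nf[OF Qaw] r pbc by (simp add: t_def)
  then have red_t: "red t" and p: "red p" by (auto simp: reduced_word_append_iff)
  have red_b: "red b" using gi pbc by (auto simp: reduced_word_append_iff)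
  have w: "is_word p" "is_word b" "is_word t" using p red_b red_t red_is_word by auto
  have "?Q ((i, x) # a # w) = g i \<otimes> x \<otimes> inv (g i) \<otimes> ?Q (a # w)" by simp
  also have "?Q (a # w) = wp (p @ t)" using wp_nf[OF Qaw] r pbc by (simp add: t_def)
  also have "g i = wp p \<otimes> wp b" using wp_append[of p b] w gi(2) pbc by simp
  also have "\<dots> \<otimes> x \<otimes> inv (wp p \<otimes> wp b) \<otimes> wp (p @ t) = wp p \<otimes> (wp b \<otimes> (x \<otimes> (inv (wp b) \<otimes> wp t)))"
    using w xc by (simp add: wp_append m_assoc inv_mult_group)
  finally have Q: "?Q ((i, x) # a # w) = wp p \<otimes> (wp b \<otimes> (x \<otimes> (inv (wp b) \<otimes> wp t)))" .
  have finish: ?case if v: "red (nf (g i) @ (i, x) # v)" "wp v = inv (wp b) \<otimes> wp t" for v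
  proof -
    have "is_word v" using red_is_word[OF v(1)] by simp
    then have "wp (nf (g i) @ (i, x) # v) = ?Q ((i, x) # a # w)"
      unfolding Q using w xc i pbc v(2) by (simp add: wp_append m_assoc)
    then show ?thesis using nf_eqI[OF v(1)] by blast
  qed
  show ?case
  proof (cases b rule: list.exhaust)
    case Nil
    \<comment> \<open>Here \<open>nf (g i)\<close> is a prefix of \<open>nf (g j)\<close>, and
      \<open>m2\<close> forbids the letter after it to come from \<open>X i\<close>; so
      \<open>x\<close> is not absorbed.\<close>
    have "fst (hd t) \<noteq> i"
    proof (cases c)
      case Nil
      then show ?thesis using i by (simp add: t_def)
    next
      case (Cons d c')
      then show ?thesis using m2[OF i(1,4,5), of "snd d" c'] pbc \<open>b = []\<close> by (cases d) (auto simp: t_def)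
    qed
    then have "red (nf (g i) @ (i, x) # t)"
      using gi red_t i m1[OF i(1)] by (auto simp: reduced_word_append_iff reduced_word_Cons_iff)
    then show ?thesis using w Nil by (intro finish) simp_all
  next
    case (Cons d b')
    obtain k z where d: "d = (k, z)" by force
    have k: "k \<in> I" "z \<in> X k" "z \<noteq> \<one>" "red b'" "b' = [] \<or> k \<noteq> fst (hd b')"
      using red_b Cons d by (auto simp: reduced_word_Cons_iff)
    have "t \<noteq> []" by (simp add: t_def)
    then obtain l y' t' where t: "t = (l, y') # t'" by (cases t) auto
    have l: "l \<in> I" "y' \<in> X l" "y' \<noteq> \<one>" "red t'" "t' = [] \<or> l \<noteq> fst (hd t')"
      using red_t t by (auto simp: reduced_word_Cons_iff)
    have c: "z \<in> carrier G" "y' \<in> carrier G" using k l factor_carrier by auto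
    have ib: "red (inv_word G b)" "inv_word G b = inv_word G b' @ [(k, inv z)]"
      using red_inv_word[OF red_b] Cons d by (simp_all add: inv_word_Cons)
    have start: "red (nf (g i) @ (i, x) # inv_word G b)"
    proof -
      have "fst (last b) \<noteq> i" using m1[OF i(1)] pbc Cons by auto
      then have "fst (hd (inv_word G b)) \<noteq> i" using Cons by (simp add: fst_hd_inv_word)
      then show ?thesis
        using gi ib(1) i m1[OF i(1)] by (auto simp: reduced_word_append_iff reduced_word_Cons_iff)
    qed
    show ?thesis
    proof (cases "k = l")
      case False
      have "red ((nf (g i) @ (i, x) # inv_word G b) @ t)"
        using start red_t False ib(2) t by (subst reduced_word_append_iff) simp
      then show ?thesis
        using w by (intro finish[of "inv_word G b @ t"]) (simp_all add: wp_append wp_inv_word is_word_inv_word)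
    next
      case True
      \<comment> \<open>If \<open>c\<close> is empty, \<open>k = l\<close> already makes
        \<open>nf (g j)\<close> followed by a letter of \<open>X j\<close> a prefix of
        \<open>nf (g i)\<close>, against \<open>m2\<close>; otherwise \<open>y' = z\<close> would
        extend the common prefix. Hence the two letters merge into a nontrivial one and reduction
        stops.\<close>
      have "y' \<noteq> z"
      proof (cases c)
        case Nil
        then have "nf (g i) = nf (g j) @ (j, z) # b'" using pbc Cons d True t by (simp add: t_def)
        then show ?thesis using m2[OF i(4,1)] i(5) by blast
      next
        case (Cons e c')
        then show ?thesis using pbc \<open>b = d # b'\<close> d t True by (auto simp: t_def)
      qed
      then have ne: "inv z \<otimes> y' \<noteq> \<one>" using c inv_cancel(2)[of z y'] r_one[of z] by metis
      have mem: "inv z \<otimes> y' \<in> X l" using k l True factor_inv factor_mult by blast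
      let ?v = "inv_word G b' @ (l, inv z \<otimes> y') # t'"
      have "red ((nf (g i) @ (i, x) # inv_word G b') @ [(k, inv z)])" using start ib(2) by simp
      then have "red ((nf (g i) @ (i, x) # inv_word G b') @ (l, inv z \<otimes> y') # t')"
        using ne mem l True
        by (simp add: reduced_word_append_iff[of _ _ _ _ "_ # _"] reduced_word_Cons_iff del: append_assoc append_Cons)
      then have "red (nf (g i) @ (i, x) # ?v)" by simp
      moreover have "wp ?v = inv (wp b) \<otimes> wp t"
      proof -
        have "is_word b'" "is_word t'" using k l red_is_word by auto
        then show ?thesis
          using Cons d t c mem l k True
          by (simp add: wp_append is_word_inv_word wp_inv_word inv_mult_group m_assoc)
      qed
      ultimately show ?thesis by (rule finish)
    qed
  qed
qed

text \<open>Take \<open>h\<close> with \<open>f h = x\<close> for a nontrivial \<open>x\<close> in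
  \<open>X i\<close>. By \<open>nf_conjugated_word\<close> the one-letter normal form of
  \<open>x\<close> starts with some \<open>nf (g j)\<close> and a further letter of index
  \<open>j\<close>; this forces \<open>j = i\<close> and a trivial \<open>g i\<close>.\<close>

lemma reduced_conjugators:
  assumes f: "f \<in> auto G" and g: "\<And>i. i \<in> I \<Longrightarrow> g i \<in> carrier G"
    and fX: "\<And>i. i \<in> I \<Longrightarrow> f ` X i = (\<lambda>x. g i \<otimes> x \<otimes> inv (g i)) ` X i"
    and m1: "\<And>i. i \<in> I \<Longrightarrow> nf (g i) = [] \<or> fst (last (nf (g i))) \<noteq> i"
    and m2: "\<And>i j x q. \<lbrakk>i \<in> I; j \<in> I; i \<noteq> j\<rbrakk> \<Longrightarrow> nf (g j) \<noteq> nf (g i) @ (i, x) # q"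
    and i: "i \<in> I"
  shows "f ` X i = X i"
proof (cases "X i = {\<one>}")
  case True
  then show ?thesis using fX[OF i] g[OF i] by simp
next
  case False
  then obtain x where x: "x \<in> X i" "x \<noteq> \<one>" using factor_one i by blast
  have xc: "x \<in> carrier G" using x i factor_carrier by blast
  have hom: "f \<in> hom G G" and bij: "bij_betw f (carrier G) (carrier G)"
    using f by (auto simp: auto_def Bij_def)
  have f1: "f \<one> = \<one>" using hom_one[OF hom is_group is_group] .
  \<comment> \<open>\<open>\<alpha>\<close> turns a letter \<open>x\<close> into the letter of
    \<open>X i\<close> whose conjugate by \<open>g i\<close> is \<open>f x\<close>.\<close>
  define \<alpha> where "\<alpha> = (\<lambda>(i, x). (i, inv (g i) \<otimes> f x \<otimes> g i))"
  have \<alpha>: "inv (g i) \<otimes> f x \<otimes> g i \<in> X i \<and> f x = g i \<otimes> (inv (g i) \<otimes> f x \<otimes> g i) \<otimes> inv (g i) \<and>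
      (x \<noteq> \<one> \<longrightarrow> inv (g i) \<otimes> f x \<otimes> g i \<noteq> \<one>)" if ix: "i \<in> I" "x \<in> X i" for i x
  proof -
    have c: "x \<in> carrier G" using ix factor_carrier by blast
    obtain y where y: "y \<in> X i" "f x = g i \<otimes> y \<otimes> inv (g i)"
      using ix(2) fX[OF ix(1)] by blast
    then have "y \<in> carrier G" using ix factor_carrier by blast
    moreover from this have "inv (g i) \<otimes> f x \<otimes> g i = y" using y ix g by (simp add: m_assoc)
    moreover have "f x \<noteq> \<one>" if "x \<noteq> \<one>"
      using bij c f1 that inj_onD[of f "carrier G" x \<one>] by (auto simp: bij_betw_def)
    ultimately show ?thesis using y ix g by auto
  qed
  have red_map: "red w \<Longrightarrow> red (map \<alpha> w)" for w
  proof (induction w)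
    case (Cons a w)
    then show ?case using \<alpha> by (cases a; cases w) (auto simp: \<alpha>_def reduced_word_Cons_iff)
  qed simp
  have f_wp: "is_word w \<Longrightarrow> f (wp w) = wp (map (\<lambda>(i, x). (i, g i \<otimes> x \<otimes> inv (g i))) (map \<alpha> w))" for w
  proof (induction w)
    case (Cons a w)
    obtain j y where a: "a = (j, y)" by force
    then have jy: "j \<in> I" "y \<in> X j" "is_word w" using Cons by auto
    then have "f (y \<otimes> wp w) = f y \<otimes> f (wp w)" using hom hom_mult factor_carrier by fastforce
    then show ?case using Cons jy a \<alpha>[OF jy(1,2)] by (simp add: \<alpha>_def)
  qed (simp add: f1)
  obtain h where h: "h \<in> carrier G" "f h = x"
    using bij xc unfolding bij_betw_def by (metis imageE)
  then have "h \<noteq> \<one>" using x f1 by auto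
  then have "nf h \<noteq> []" using h nf_eq_Nil_iff by blast
  then obtain j y w where jyw: "map \<alpha> (nf h) = (j, y) # w"
    by (cases "nf h") (auto simp: \<alpha>_def split: prod.splits)
  have red: "red ((j, y) # w)" using red_map[OF red_nf[OF h(1)]] jyw by simp
  have "x = wp (map (\<lambda>(i, x). (i, g i \<otimes> x \<otimes> inv (g i))) ((j, y) # w))"
    using f_wp[of "nf h"] h jyw by (simp del: list.map(2))
  then obtain r where "nf x = nf (g j) @ (j, y) # r"
    using nf_conjugated_word[OF g m1 m2 red] by metis
  then have "nf (g j) @ (j, y) # r = [(i, x)]" using nf_factor[OF i x] by simp
  then have "nf (g j) = []" "j = i" by (auto simp: append_eq_Cons_conv)
  then have "g i = \<one>" using nf_eq_Nil_iff[OF g[OF i]] by simp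
  moreover have "(\<lambda>x. \<one> \<otimes> x \<otimes> inv \<one>) ` X i = X i"
    using factor_carrier[OF i] by (force simp: image_iff)
  ultimately show ?thesis using fX[OF i] by simp
qed

definition partial_conjs :: "('a \<Rightarrow> 'a) set" where
  "partial_conjs = {f \<in> auto G. \<exists>i\<in>I. \<exists>j\<in>I - {i}. \<exists>x\<in>X i.
     (\<forall>z\<in>X j. f z = x \<otimes> z \<otimes> inv x) \<and> (\<forall>k\<in>I - {j}. \<forall>z\<in>X k. f z = z)}"

theorem partial_conj_reduction:
  assumes "finite I" "f \<in> auto G" "\<And>i. i \<in> I \<Longrightarrow> g i \<in> carrier G"
    and "\<And>i. i \<in> I \<Longrightarrow> f ` X i = (\<lambda>x. g i \<otimes> x \<otimes> inv (g i)) ` X i"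
  shows "\<exists>p \<in> generate (AutoGroup G) partial_conjs. \<forall>i\<in>I. f ` p ` X i = X i"
  using assms(2-)
proof (induction "\<Sum>i\<in>I. len (g i)" arbitrary: f g rule: less_induct)
  case less
  interpret A: group "AutoGroup G" by (rule AutoGroup)
  note f = less.prems(1) and g = less.prems(2) and fX = less.prems(3)
  have pc_sub: "partial_conjs \<subseteq> carrier (AutoGroup G)"
    by (auto simp: partial_conjs_def carrier_AutoGroup)
  have upd: "(\<Sum>i\<in>I. len ((g(j := a)) i)) < (\<Sum>i\<in>I. len (g i))"
    if "j \<in> I" "len a < len (g j)" for j a
    using that assms(1) by (intro sum_strict_mono_ex1) auto
  have hom: "f \<in> hom G G" and bij: "bij_betw f (carrier G) (carrier G)"
    using f by (auto simp: auto_def Bij_def)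
  consider (m1) j where "j \<in> I" "nf (g j) \<noteq> []" "fst (last (nf (g j))) = j"
    | (m2) i j x q where "i \<in> I" "j \<in> I" "i \<noteq> j" "nf (g j) = nf (g i) @ (i, x) # q"
    | (red) "\<And>i. i \<in> I \<Longrightarrow> nf (g i) = [] \<or> fst (last (nf (g i))) \<noteq> i"
      "\<And>i j x q. \<lbrakk>i \<in> I; j \<in> I; i \<noteq> j\<rbrakk> \<Longrightarrow> nf (g j) \<noteq> nf (g i) @ (i, x) # q"
    by blast
  then show ?case
  proof cases
    case m1
    then obtain u z where u: "nf (g j) = u @ [(j, z)]"
      by (cases "nf (g j)" rule: rev_cases) auto
    then have z: "z \<in> X j" "red u" "is_word u"
      using red_nf[OF g[OF m1(1)]] red_is_word
      by (auto simp: reduced_word_append_iff reduced_word_Cons_iff)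
    then have zc: "z \<in> carrier G" using m1 factor_carrier by blast
    have gj: "g j = wp u \<otimes> z"
      using wp_nf[OF g[OF m1(1)]] u z m1 zc by (simp add: wp_append)
    have zX: "(\<lambda>x. z \<otimes> x \<otimes> inv z) ` X j = X j"
    proof (intro equalityI subsetI)
      fix x assume x: "x \<in> X j"
      then have "x \<in> carrier G" using m1 factor_carrier by blast
      then have "x = z \<otimes> (inv z \<otimes> x \<otimes> z) \<otimes> inv z" using zc by (simp add: m_assoc)
      then show "x \<in> (\<lambda>x. z \<otimes> x \<otimes> inv z) ` X j"
        using x z m1 factor_mult factor_inv by blast
    qed (use z m1 factor_mult factor_inv in auto)
    have "f ` X i = (\<lambda>x. (g(j := wp u)) i \<otimes> x \<otimes> inv ((g(j := wp u)) i)) ` X i" if "i \<in> I" for i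
    proof (cases "i = j")
      case True
      have "f ` X j = (\<lambda>x. wp u \<otimes> x \<otimes> inv (wp u)) ` (\<lambda>x. z \<otimes> x \<otimes> inv z) ` X j"
        using fX[OF m1(1)] gj z zc m1 factor_carrier by (simp add: image_image conj_conj cong: image_cong)
      then show ?thesis using True zX by simp
    qed (use fX that in simp)
    then show ?thesis
      using less.hyps[of "g(j := wp u)" f] upd[of j "wp u"] m1 u z f g nf_wp by auto
  next
    case m2
    have x: "x \<in> X i" "is_word q" "red q"
      using red_nf[OF g[OF m2(2)]] m2(4) red_is_word
      by (auto simp: reduced_word_append_iff reduced_word_Cons_iff)
    have xc: "x \<in> carrier G" using x m2 factor_carrier by blast
    \<comment> \<open>\<open>f\<close> turns conjugation by \<open>inv x'\<close> on
      \<open>X j\<close> into conjugation by \<open>g i \<otimes> inv x \<otimes> inv (g i)\<close>,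
      which deletes from \<open>g j\<close> the letter \<open>x\<close> that follows
      \<open>nf (g i)\<close>.\<close>
    obtain x' where x': "x' \<in> X i" "f x' = g i \<otimes> x \<otimes> inv (g i)"
      using fX[OF m2(1)] x by (metis (no_types, lifting) imageE imageI)
    have x'c: "x' \<in> carrier G" using x' m2 factor_carrier by blast
    obtain P where P: "P \<in> auto G" "\<And>z. z \<in> X j \<Longrightarrow> P z = inv x' \<otimes> z \<otimes> inv (inv x')"
      "\<And>k z. \<lbrakk>k \<in> I; k \<noteq> j; z \<in> X k\<rbrakk> \<Longrightarrow> P z = z"
      using partial_conjugation[OF m2(1-3) factor_inv[OF m2(1) x'(1)]] by blast
    have PPC: "P \<in> partial_conjs"
      unfolding partial_conjs_def
    proof (intro CollectI conjI bexI ballI)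
      show "inv x' \<in> X i" using factor_inv[OF m2(1) x'(1)] .
    qed (use P m2 in auto)
    define c where "c = inv (f x')"
    have cc: "c \<in> carrier G" using hom x'c by (auto simp: c_def hom_in_carrier)
    define g' where "g' = g(j := c \<otimes> g j)"
    have "c \<otimes> g j = wp (nf (g i) @ q)"
    proof -
      have "g j = g i \<otimes> (x \<otimes> wp q)"
        using wp_nf[OF g[OF m2(2)]] m2 x g by (simp add: wp_append)
      moreover have "c = g i \<otimes> (inv x \<otimes> inv (g i))"
        using x' g[OF m2(1)] xc by (simp add: c_def inv_mult_group m_assoc)
      ultimately show ?thesis using g[OF m2(1)] xc x by (simp add: wp_append m_assoc)
    qed
    then have "len (c \<otimes> g j) \<le> length (nf (g i) @ q)"
      using len_wp[of "nf (g i) @ q"] g[OF m2(1)] x by simp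
    then have lt: "(\<Sum>i\<in>I. len (g' i)) < (\<Sum>i\<in>I. len (g i))"
      unfolding g'_def using m2 by (intro upd) auto
    have fP: "compose (carrier G) f P \<in> auto G"
      using A.m_closed[of f P] f P(1) by (simp add: AutoGroup_mult carrier_AutoGroup)
    have fPX: "compose (carrier G) f P ` X k = (\<lambda>x. g' k \<otimes> x \<otimes> inv (g' k)) ` X k" if k: "k \<in> I" for k
    proof (cases "k = j")
      case True
      have "compose (carrier G) f P z = c \<otimes> f z \<otimes> inv c" if "z \<in> X j" for z
      proof -
        have zc: "z \<in> carrier G" using that m2 factor_carrier by blast
        then show ?thesis
          using that P(2) x'c group_hom.hom_inv[of G G f x'] hom is_group
          by (simp add: compose_def c_def hom_mult group_hom_def group_hom_axioms_def hom_in_carrier)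
      qed
      then have "compose (carrier G) f P ` X j = (\<lambda>y. c \<otimes> y \<otimes> inv c) ` (f ` X j)"
        by (simp add: image_image cong: image_cong)
      also have "\<dots> = (\<lambda>x. g' j \<otimes> x \<otimes> inv (g' j)) ` X j"
        unfolding fX[OF m2(2)] using cc g[OF m2(2)] factor_carrier[OF m2(2)]
        by (simp add: image_image conj_conj g'_def cong: image_cong)
      finally show ?thesis using True by simp
    next
      case False
      have "compose (carrier G) f P ` X k = f ` X k"
        using P(3)[OF k False] factor_carrier[OF k] by (simp add: compose_def cong: image_cong)
      then show ?thesis using fX[OF k] False by (simp add: g'_def)
    qed
    moreover have "g' k \<in> carrier G" if "k \<in> I" for k
      using that g cc m2 by (simp add: g'_def)
    ultimately obtain p where p: "p \<in> generate (AutoGroup G) partial_conjs"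
      "\<forall>i\<in>I. compose (carrier G) f P ` p ` X i = X i"
      using less.hyps[OF lt fP] by blast
    have pa: "p \<in> auto G"
      using A.generate_in_carrier[OF pc_sub p(1)] by (simp add: carrier_AutoGroup)
    have Pp: "P \<otimes>\<^bsub>AutoGroup G\<^esub> p \<in> generate (AutoGroup G) partial_conjs"
      using generate.eng[OF generate.incl[OF PPC] p(1)] .
    have "f ` (P \<otimes>\<^bsub>AutoGroup G\<^esub> p) ` X i = X i" if "i \<in> I" for i
    proof -
      have "p z \<in> carrier G" "z \<in> carrier G" if "z \<in> X i" for z
        using that \<open>i \<in> I\<close> factor_carrier pa by (auto simp: auto_def hom_in_carrier)
      then have "f ` (P \<otimes>\<^bsub>AutoGroup G\<^esub> p) ` X i = compose (carrier G) f P ` p ` X i"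
        unfolding image_image using P(1) pa
        by (intro image_cong) (simp_all add: AutoGroup_mult compose_def)
      then show ?thesis using p(2) that by simp
    qed
    then show ?thesis using Pp by blast
  next
    case red
    have "f ` X i = X i" if "i \<in> I" for i
      using reduced_conjugators[OF f g fX red that] by blast
    moreover have "\<one>\<^bsub>AutoGroup G\<^esub> ` X i = X i" if "i \<in> I" for i
      using factor_carrier[OF that] by (force simp: AutoGroup_one image_iff)
    ultimately show ?thesis using generate.one[of "AutoGroup G" partial_conjs]
      by (intro bexI[of _ "\<one>\<^bsub>AutoGroup G\<^esub>"]) auto
  qed
qed

end

section \<open>The coordinate ring\<close>

definition cubic :: "bit poly" where "cubic = [:1, 1, 0, 1:]"

lemma curve_poly_eq: "curve_poly = [:- cubic, 1, 1:]"
  by (simp add: curve_poly_def cubic_def)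

lifting_forget poly.lifting

text \<open>\<open>lin p q\<close> is the class of \<open>p + q y\<close>. By the next two lemmas 1
  and \<open>y\<close> form a basis of the ring over the polynomials in \<open>x\<close>.\<close>

lift_definition lin :: "bit poly \<Rightarrow> bit poly \<Rightarrow> coord_ring" is "\<lambda>p q. [:p, q:]" .

lemma lin_surj: "\<exists>p q. a = lin p q"
proof transfer
  fix P :: "bit poly poly"
  show "\<exists>p q. curve_poly dvd P - [:p, q:]"
  proof (induction P)
    case 0
    have "curve_poly dvd 0 - [:0, 0:]" by simp
    then show ?case by blast
  next
    case (pCons a P)
    then obtain p q where "curve_poly dvd P - [:p, q:]" by blast
    \<comment> \<open>Multiply by \<open>y\<close> and replace \<open>y^2\<close> by
      \<open>cubic - y\<close>.\<close>
    then have "curve_poly dvd [:0, 1:] * (P - [:p, q:]) + [:q:] * curve_poly"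
      by (intro dvd_add dvd_mult dvd_refl)
    also have "[:0, 1:] * (P - [:p, q:]) + [:q:] * curve_poly = pCons a P - [:a + q * cubic, p - q:]"
      by (simp add: curve_poly_eq)
    finally show ?case by blast
  qed
qed

lemma lin_eq_iff [simp]: "lin p q = lin p' q' \<longleftrightarrow> p = p' \<and> q = q'"
proof
  assume "lin p q = lin p' q'"
  then have d: "curve_poly dvd [:p - p', q - q':]" by transfer simp
  have "[:p - p', q - q':] = 0"
  proof (rule ccontr)
    assume "[:p - p', q - q':] \<noteq> 0"
    with d have "degree curve_poly \<le> degree [:p - p', q - q':]" by (rule dvd_imp_degree_le)
    moreover have "degree [:p - p', q - q':] \<le> 1" by (simp add: degree_pCons_le order_trans[OF degree_pCons_le])
    ultimately show False by (simp add: curve_poly_def)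
  qed
  then show "p = p' \<and> q = q'" by simp
qed simp

lemma lin_add: "lin p q + lin p' q' = lin (p + p') (q + q')"
  by transfer simp

lemma lin_mult: "lin p q * lin p' q' = lin (p * p' + q * q' * cubic) (p * q' + q * p' - q * q')"
proof transfer
  fix p q p' q' :: "bit poly"
  have "[:p, q:] * [:p', q':] - [:p * p' + q * q' * cubic, p * q' + q * p' - q * q':] = [:q * q':] * curve_poly"
    by (simp add: curve_poly_eq del: diff_pCons mult_pCons_left mult_pCons_right)
      (simp add: algebra_simps)
  then show "curve_poly dvd [:p, q:] * [:p', q':] - [:p * p' + q * q' * cubic, p * q' + q * p' - q * q':]"
    by (simp only: dvd_triv_right)
qed

lemma zero_eq_lin: "0 = lin 0 0" and one_eq_lin: "1 = lin 1 0"
  by (transfer; simp add: one_pCons)+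

lemma coord_ring_add_self [simp]: "a + a = (0 :: coord_ring)"
proof -
  have "c + c = 0" for c :: bit by (cases c) simp_all
  then have "p + p = 0" for p :: "bit poly" by (intro poly_eqI) (simp only: coeff_add coeff_0)
  then have pp: "p + p = 0" for p :: "bit poly" .
  obtain p q where "a = lin p q" using lin_surj by blast
  then show ?thesis by (simp only: lin_add zero_eq_lin pp)
qed

lemma coord_ring_uminus [simp]: "- a = (a :: coord_ring)"
  by (simp add: minus_unique)

lemma coord_ring_diff [simp]: "a - b = a + (b :: coord_ring)"
  by (simp only: diff_conv_add_uminus coord_ring_uminus)

lemma coord_ring_add_add [simp]: "a + (a + b) = (b :: coord_ring)" "b + a + a = b"
  by (simp flip: add.assoc) (simp add: add.assoc)

section \<open>Norm and pole degree\<close>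

text \<open>The norm \<open>(p + q y) (p + q y')\<close> down to the polynomials in
  \<open>x\<close>, where \<open>y' = - 1 - y\<close> is the conjugate of \<open>y\<close>; the
  product \<open>y y'\<close> is \<open>- cubic\<close>.\<close>

definition lin_norm :: "bit poly \<Rightarrow> bit poly \<Rightarrow> bit poly" where
  "lin_norm p q = p * p - p * q - q * q * cubic"

lemma quadratic_norm_mult:
  fixes e :: "'a :: comm_ring_1"
  shows "(p * p' + q * q' * e) * (p * p' + q * q' * e)
      - (p * p' + q * q' * e) * (p * q' + q * p' - q * q')
      - (p * q' + q * p' - q * q') * (p * q' + q * p' - q * q') * e
    = (p * p - p * q - q * q * e) * (p' * p' - p' * q' - q' * q' * e)"
  by (simp add: algebra_simps)

lemma lin_norm_mult:
  "lin_norm (p * p' + q * q' * cubic) (p * q' + q * p' - q * q') = lin_norm p q * lin_norm p' q'"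
  unfolding lin_norm_def by (rule quadratic_norm_mult)

text \<open>The two leading terms cannot cancel, their degrees having different parity.\<close>
lemma degree_lin_norm:
  "degree (lin_norm p q) = max (2 * degree p) (if q = 0 then 0 else 2 * degree q + 3)"
  and lin_norm_eq_0_iff: "lin_norm p q = 0 \<longleftrightarrow> p = 0 \<and> q = 0"
proof -
  have dsum: "degree (r + s) = degree r" if "degree s < degree r" for r s :: "bit poly"
    using that by (rule degree_add_eq_left)
  have main: "degree (lin_norm p q) = max (2 * degree p) (2 * degree q + 3)" if q: "q \<noteq> 0"
  proof -
    have e: "degree (q * q * cubic) = 2 * degree q + 3"
      using q by (subst degree_mult_eq) (simp_all add: degree_mult_eq cubic_def)
    have pp: "degree (p * p) = 2 * degree p" by (cases "p = 0") (simp_all add: degree_mult_eq)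
    have pq: "degree (p * q) \<le> degree p + degree q" by (rule degree_mult_le)
    show ?thesis
    proof (cases "degree p \<le> degree q + 1")
      case True
      then have "degree (p * p - p * q) \<le> 2 * degree q + 2"
        using pp pq by (intro degree_diff_le) auto
      then have "degree (- (q * q * cubic) + (p * p - p * q)) = degree (- (q * q * cubic))"
        using e by (intro dsum) simp
      moreover have "lin_norm p q = - (q * q * cubic) + (p * p - p * q)"
        by (simp only: lin_norm_def uminus_add_conv_diff)
      ultimately show ?thesis using e True by simp
    next
      case False
      then have "degree (p * q + q * q * cubic) \<le> 2 * degree p - 1"
        using pq e by (intro degree_add_le) auto
      then have "degree (p * p + - (p * q + q * q * cubic)) = degree (p * p)"
        using pp False by (intro dsum, unfold Polynomial.degree_minus pp) arith
      moreover have "lin_norm p q = p * p + - (p * q + q * q * cubic)"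
        by (simp only: lin_norm_def diff_diff_eq flip: diff_conv_add_uminus)
      ultimately show ?thesis using pp False by simp
    qed
  qed
  then show pole_deg: "degree (lin_norm p q) = max (2 * degree p) (if q = 0 then 0 else 2 * degree q + 3)"
    by (cases "p = 0") (auto simp: lin_norm_def degree_mult_eq)
  show "lin_norm p q = 0 \<longleftrightarrow> p = 0 \<and> q = 0"
    using main by (cases "q = 0") (auto simp: lin_norm_def)
qed

lemma lin_eq_0_iff: "lin p q = 0 \<longleftrightarrow> p = 0 \<and> q = 0"
  by (simp add: zero_eq_lin)

text \<open>The norm is multiplicative and vanishes only at 0, so it transfers the absence of zero
  divisors from the polynomials in \<open>x\<close>.\<close>

instance coord_ring :: idom
proof
  fix a b :: coord_ring
  assume "a \<noteq> 0" "b \<noteq> 0"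
  moreover obtain p q p' q' where "a = lin p q" "b = lin p' q'" using lin_surj by metis
  ultimately have "lin_norm p q * lin_norm p' q' \<noteq> 0" "a = lin p q" "b = lin p' q'"
    by (auto simp: lin_norm_eq_0_iff lin_eq_0_iff)
  then show "a * b \<noteq> 0"
    unfolding lin_norm_mult[symmetric] by (simp add: lin_mult lin_eq_0_iff lin_norm_eq_0_iff)
qed

text \<open>The pole order at infinity: \<open>x\<close> has degree 2 and \<open>y\<close> degree 3. Here 0 gets degree 0.\<close>
definition pole_deg :: "coord_ring \<Rightarrow> nat" where
  "pole_deg a = (THE n. \<exists>p q. a = lin p q \<and> n = degree (lin_norm p q))"

lemma pole_deg_lin: "pole_deg (lin p q) = max (2 * degree p) (if q = 0 then 0 else 2 * degree q + 3)"
  unfolding pole_deg_def by (rule the_equality) (auto simp: degree_lin_norm)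

lemma pole_deg_0 [simp]: "pole_deg 0 = 0" and pole_deg_1 [simp]: "pole_deg 1 = 0"
  by (simp_all add: zero_eq_lin one_eq_lin pole_deg_lin)

lemma pole_deg_mult: "\<lbrakk>a \<noteq> 0; b \<noteq> 0\<rbrakk> \<Longrightarrow> pole_deg (a * b) = pole_deg a + pole_deg b"
proof -
  assume "a \<noteq> 0" "b \<noteq> 0"
  moreover obtain p q p' q' where ab: "a = lin p q" "b = lin p' q'" using lin_surj by metis
  ultimately have "lin_norm p q \<noteq> 0" "lin_norm p' q' \<noteq> 0"
    by (auto simp: lin_norm_eq_0_iff lin_eq_0_iff)
  then show ?thesis
    unfolding ab lin_mult pole_deg_lin degree_lin_norm[symmetric] lin_norm_mult by (rule degree_mult_eq)
qed

lemma pole_deg_eq_0_iff: "pole_deg a = 0 \<longleftrightarrow> a = 0 \<or> a = 1"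
proof
  assume d: "pole_deg a = 0"
  obtain p q where a: "a = lin p q" using lin_surj by blast
  then have "q = 0" "degree p = 0" using d by (auto simp: pole_deg_lin split: if_splits)
  then obtain c where "p = [:c:]" using degree_eq_zeroE by blast
  then show "a = 0 \<or> a = 1"
    using a \<open>q = 0\<close> by (cases c) (auto simp: zero_eq_lin one_eq_lin one_pCons)
qed auto

lemma pole_deg_add_le: "pole_deg (a + b) \<le> max (pole_deg a) (pole_deg b)"
proof -
  obtain p q p' q' where ab: "a = lin p q" "b = lin p' q'" using lin_surj by metis
  define m where "m = max (pole_deg a) (pole_deg b)"
  have "pole_deg a \<le> m" "pole_deg b \<le> m" by (simp_all add: m_def)
  then have "2 * degree p \<le> m" "2 * degree p' \<le> m"
    "q = 0 \<or> 2 * degree q + 3 \<le> m" "q' = 0 \<or> 2 * degree q' + 3 \<le> m"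
    unfolding ab pole_deg_lin by (auto split: if_splits)
  moreover have "degree (p + p') \<le> max (degree p) (degree p')" "degree (q + q') \<le> max (degree q) (degree q')"
    by (rule degree_add_le_max)+
  ultimately have "2 * degree (p + p') \<le> m" "q + q' = 0 \<or> 2 * degree (q + q') + 3 \<le> m"
    by (cases "q = 0"; cases "q' = 0"; auto)+
  then have "pole_deg (a + b) \<le> m" unfolding ab lin_add pole_deg_lin by auto
  then show ?thesis by (simp only: m_def)
qed

lemma pole_deg_add_eq: "pole_deg a < pole_deg b \<Longrightarrow> pole_deg (a + b) = pole_deg b"
  using pole_deg_add_le[of a b] pole_deg_add_le[of "a + b" a] by (simp add: add.commute add.left_commute)

lemma degree_add_less_bit_poly:
  fixes p q :: "bit poly"
  assumes "degree p = degree q" "p \<noteq> 0" "q \<noteq> 0" "p + q \<noteq> 0"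
  shows "degree (p + q) < degree p"
proof -
  have "lead_coeff p = 1" "lead_coeff q = 1" using assms by (metis bit_not_zero_iff leading_coeff_0_iff)+
  then have c: "poly.coeff (p + q) (degree p) = 0" using assms(1) by simp
  have "degree (p + q) \<noteq> degree p"
  proof
    assume "degree (p + q) = degree p"
    then have "lead_coeff (p + q) = 0" using c by simp
    then show False using assms(4) by (simp only: leading_coeff_0_iff)
  qed
  moreover have "degree (p + q) \<le> degree p" using assms(1) by (intro degree_add_le) auto
  ultimately show ?thesis by simp
qed

text \<open>The residue field at infinity has two elements, so leading terms of equal degree cancel.\<close>
lemma pole_deg_add_less:
  assumes "pole_deg a = pole_deg b" "pole_deg a > 0"
  shows "pole_deg (a + b) < pole_deg a"
proof -
  obtain p q p' q' where ab: "a = lin p q" "b = lin p' q'" using lin_surj by metis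
  have par: "\<And>m n :: nat. 2 * m \<noteq> 2 * n + 3" by presburger
  have le: "degree (p + p') \<le> max (degree p) (degree p')" "degree (q + q') \<le> max (degree q) (degree q')"
    by (rule degree_add_le_max)+
  show ?thesis
  proof (cases "pole_deg a = 2 * degree p")
    case True
    have "degree p \<noteq> 0" using True assms by simp
    have p': "degree p' = degree p"
    proof -
      have "max (2 * degree p') (if q' = 0 then 0 else 2 * degree q' + 3) = 2 * degree p"
        using True assms(1) unfolding ab pole_deg_lin by simp
      then show ?thesis using par[of "degree p" "degree q'"] \<open>degree p \<noteq> 0\<close>
        by (simp add: max_def split: if_splits)
    qed
    then have 1: "degree (p + p') < degree p"
      using degree_add_less_bit_poly[of p p'] \<open>degree p \<noteq> 0\<close>
      by (cases "p + p' = 0"; cases "p' = 0"; cases "p = 0") auto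
    have "q = 0 \<or> 2 * degree q + 3 < 2 * degree p" "q' = 0 \<or> 2 * degree q' + 3 < 2 * degree p"
    proof -
      have "q = 0 \<or> 2 * degree q + 3 \<le> 2 * degree p" using True unfolding ab pole_deg_lin by (auto split: if_splits)
      then show "q = 0 \<or> 2 * degree q + 3 < 2 * degree p" using par[of "degree p" "degree q"] by auto
      have "q' = 0 \<or> 2 * degree q' + 3 \<le> 2 * degree p" using True assms(1) unfolding ab pole_deg_lin by (auto split: if_splits)
      then show "q' = 0 \<or> 2 * degree q' + 3 < 2 * degree p" using par[of "degree p" "degree q'"] by auto
    qed
    then have "q + q' = 0 \<or> 2 * degree (q + q') + 3 < 2 * degree p"
      using le(2) by (cases "q = 0"; cases "q' = 0"; auto)
    then show ?thesis using 1 True unfolding ab lin_add pole_deg_lin by auto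
  next
    case False
    then have q: "q \<noteq> 0" "2 * degree q + 3 > 2 * degree p" "pole_deg a = 2 * degree q + 3"
      unfolding ab pole_deg_lin by (auto simp: max_def split: if_splits)
    have "max (2 * degree p') (if q' = 0 then 0 else 2 * degree q' + 3) = 2 * degree q + 3"
      using q(3) assms(1) unfolding ab pole_deg_lin by simp
    then have q': "q' \<noteq> 0" "degree q' = degree q" "2 * degree q + 3 > 2 * degree p'"
      using par[of "degree p'" "degree q"] by (auto simp: max_def split: if_splits)
    then have "q + q' = 0 \<or> degree (q + q') < degree q"
      using degree_add_less_bit_poly[of q q'] q by auto
    moreover have "2 * degree (p + p') < 2 * degree q + 3" using q q' le(1) by auto
    ultimately show ?thesis using q(3) unfolding ab lin_add pole_deg_lin by auto
  qed
qed

text \<open>Degrees add, so a unit has degree 0 and is a nonzero constant. In particular every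
  determinant in the group is 1.\<close>

lemma coord_ring_unit: "a * b = 1 \<Longrightarrow> a = (1 :: coord_ring)"
  using pole_deg_mult[of a b] pole_deg_eq_0_iff[of a] by (cases "a = 0"; cases "b = 0") auto

text \<open>For \<open>pole_deg b < pole_deg a\<close> the equation reads
  \<open>b (a + b) = a^2 + 1\<close>, where the right side has the larger degree. Equal positive
  degrees reduce to this: leading terms cancel in \<open>a + b\<close>, and the form is unchanged
  when \<open>b\<close> is replaced by \<open>a + b\<close>.\<close>

lemma norm_form_eq_1:
  assumes "a * a + a * b + b * b = (1 :: coord_ring)"
  shows "a \<in> {0, 1} \<and> b \<in> {0, 1}"
proof (rule ccontr)
  assume "\<not> ?thesis"
  then have ab: "pole_deg a > 0 \<or> pole_deg b > 0" using pole_deg_eq_0_iff by auto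
  have nz: "a * a + a * b + b * b \<noteq> 1" if "pole_deg b < pole_deg a" for a b
  proof
    assume 1: "a * a + a * b + b * b = 1"
    have "a \<noteq> 0" using that by auto
    have "b * (a + b) = a * a + 1" using 1 by (simp add: algebra_simps flip: 1)
    moreover have "pole_deg (b * (a + b)) < pole_deg (a * a)"
    proof (cases "b = 0 \<or> a + b = 0")
      case False
      then show ?thesis using pole_deg_add_le[of a b] that \<open>a \<noteq> 0\<close> by (auto simp: pole_deg_mult)
    qed (use that \<open>a \<noteq> 0\<close> in \<open>auto simp: pole_deg_mult\<close>)
    moreover have "pole_deg (1 + a * a) = pole_deg (a * a)"
      using that \<open>a \<noteq> 0\<close> by (intro pole_deg_add_eq) (simp add: pole_deg_mult)
    ultimately show False by (simp add: add.commute)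
  qed
  consider "pole_deg b < pole_deg a" | "pole_deg a < pole_deg b" | "pole_deg a = pole_deg b" "pole_deg (a + b) < pole_deg a"
    using ab pole_deg_add_less[of a b] by linarith
  then show False
  proof cases
    case 1
    then show ?thesis using nz assms by blast
  next
    case 2
    then show ?thesis using nz[of a b] assms by (metis add.commute add.left_commute mult.commute nz)
  next
    case 3
    have "a * a + a * (a + b) + (a + b) * (a + b) = a * a + a * b + b * b"
      by (simp add: algebra_simps)
    then show ?thesis using nz[of "a + b" a] 3 assms by metis
  qed
qed

section \<open>Complements of the constants\<close>

lemma F2_emb_cases: "F2_emb c = 0 \<or> F2_emb c = 1"
  by (cases c) auto

lemma range_F2_emb: "range F2_emb = {0, 1}"
proof -
  have "range F2_emb \<subseteq> {0, 1}" using F2_emb_cases by auto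
  moreover have "{F2_emb 0, F2_emb 1} \<subseteq> range F2_emb" by blast
  ultimately show ?thesis unfolding F2_emb_simps by blast
qed

text \<open>Over a field with two elements, the hyperplanes that are complements to the line \<open>{0, 1}\<close>.\<close>
definition complement :: "coord_ring set \<Rightarrow> bool" where
  "complement V \<longleftrightarrow> 0 \<in> V \<and> (\<forall>u\<in>V. \<forall>v\<in>V. u + v \<in> V) \<and> 1 \<notin> V \<and> (\<forall>a. a \<in> V \<or> a + 1 \<in> V)"

text \<open>\<open>V\<close> has index 2, so membership behaves like the vanishing of a linear
  functional with values in the two-element field.\<close>

lemma complement_add_iff:
  assumes "complement V"
  shows "a + b \<in> V \<longleftrightarrow> (a \<in> V \<longleftrightarrow> b \<in> V)"
proof -
  have add: "u + v \<in> V" if "u \<in> V" "v \<in> V" for u v using assms that by (auto simp: complement_def)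
  have ex: "a \<in> V \<or> a + 1 \<in> V" for a using assms by (auto simp: complement_def)
  have one: "1 \<notin> V" using assms by (auto simp: complement_def)
  have "b \<in> V" if "a \<in> V" "a + b \<in> V" for a b using add[OF that] by simp
  moreover have "a + b \<in> V" if "a \<notin> V" "b \<notin> V"
    using add[of "a + 1" "b + 1"] ex[of a] ex[of b] that by (simp add: algebra_simps)
  ultimately show ?thesis using add by (metis add.commute)
qed

lemma complement_subspace: "complement V \<Longrightarrow> F2.subspace V"
  unfolding F2.subspace_def complement_def using F2_emb_cases by (metis mult_zero_left mult_1)

lemma complement_exists:
  assumes "k \<noteq> 0" "k \<noteq> 1"
  obtains V where "complement V" "k \<in> V"
proof -
  have "1 \<notin> F2.span {k}"
  proof
    assume "1 \<in> F2.span {k}"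
    then obtain c where "1 - F2_emb c * k \<in> F2.span {}" using F2.span_breakdown_eq[of 1 k "{}"] by auto
    then have "F2_emb c * k = 1" by (simp add: add_eq_0_iff)
    then show False using F2_emb_cases[of c] assms by auto
  qed
  moreover have "F2.independent {k}" using assms by simp
  ultimately have ind: "F2.independent {1, k}" using assms by (simp add: F2.independent_insert)
  define B where "B = F2.extend_basis {1, k}"
  have B: "{1, k} \<subseteq> B" "F2.independent B" "F2.span B = UNIV"
    using F2.extend_basis_superset[OF ind] F2.independent_extend_basis[OF ind] F2.span_extend_basis[OF ind]
    by (auto simp: B_def)
  define V where "V = F2.span (B - {1})"
  have "1 \<notin> V" using B by (auto simp: V_def F2.dependent_def)
  moreover have "a \<in> V \<or> a + 1 \<in> V" for a
  proof -
    have "a \<in> F2.span (insert 1 (B - {1}))" using B by (simp add: insert_absorb)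
    then obtain c where "a - F2_emb c * 1 \<in> V" unfolding V_def F2.span_breakdown_eq by blast
    then show ?thesis using F2_emb_cases[of c] by auto
  qed
  moreover have "k \<in> V" using B assms by (auto simp: V_def intro: F2.span_base)
  ultimately show ?thesis
    using that[of V] by (auto simp: complement_def V_def F2.span_zero F2.span_add)
qed

text \<open>\<open>W\<close> contains one of \<open>u\<close>, \<open>v\<close>,
  \<open>u + v\<close>, whatever \<open>u\<close> and \<open>v\<close> are, so two distinct nonzero
  elements of \<open>V\<close> suffice; \<open>x\<close> and \<open>y\<close>, shifted by 1 where
  necessary, provide them.\<close>

lemma complements_meet:
  assumes "complement V" "complement W"
  obtains m where "m \<in> V" "m \<in> W" "m \<noteq> 0"
proof -
  have V: "a \<notin> V \<Longrightarrow> a + 1 \<in> V" for a using assms by (auto simp: complement_def)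
  define x where "x = lin [:0, 1:] 0"
  define y where "y = lin 0 1"
  define u where "u = (if x \<in> V then x else x + 1)"
  define v where "v = (if y \<in> V then y else y + 1)"
  have "u \<in> V" "v \<in> V" using V by (auto simp: u_def v_def)
  moreover have "u \<noteq> 0" "v \<noteq> 0" "u \<noteq> v"
    by (auto simp: u_def v_def x_def y_def one_eq_lin zero_eq_lin lin_add one_pCons)
  moreover have "u \<in> W \<or> v \<in> W \<or> u + v \<in> W" using complement_add_iff[OF assms(2)] by blast
  ultimately show ?thesis
    using that complement_add_iff[OF assms(1)] by (metis add_eq_0_iff coord_ring_uminus)
qed

text \<open>
  The transvection \<open>a \<mapsto> a + \<delta> a * (1 + m)\<close> with \<open>m \<in> V \<inter> W\<close> and \<open>\<delta>\<close> the difference of the two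
  functionals with kernels \<open>V\<close> and \<open>W\<close>.
\<close>
lemma transvection_swapping_complements:
  assumes V: "complement V" and W: "complement W"
  obtains \<theta> U where "\<And>a b. \<theta> (a + b) = \<theta> a + \<theta> b" "\<And>a. \<theta> (\<theta> a) = a" "\<theta> 1 = 1"
    "complement U" "\<theta> ` U = U" "\<theta> ` V = W"
proof -
  obtain m where m: "m \<in> V" "m \<in> W" "m \<noteq> 0" using complements_meet[OF assms] .
  note Vi = complement_add_iff[OF V] and Wi = complement_add_iff[OF W]
  have one: "1 \<notin> V" "1 \<notin> W" using assms by (auto simp: complement_def)
  \<comment> \<open>Both functionals take the value 1 at \<open>k\<close>. So
    \<open>\<delta> k = 0\<close>, which makes \<open>\<theta>\<close> an involution, and adding
    \<open>k\<close> where the functionals differ exchanges their values, which carries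
    \<open>V\<close> to \<open>W\<close>. As \<open>m \<noteq> 0\<close>, \<open>k\<close> is not 1,
    and a complement \<open>U\<close> containing \<open>k\<close> exists; it is invariant because
    \<open>\<theta>\<close> moves elements only by \<open>k\<close>.\<close>
  define k where "k = 1 + m"
  have k: "k \<notin> V" "k \<notin> W" using m one Vi Wi by (auto simp: k_def)
  have "k \<noteq> 1" "k \<noteq> 0" using m V k by (auto simp: k_def complement_def)
  then obtain U where U: "complement U" "k \<in> U" using complement_exists by blast
  define \<theta> where "\<theta> a = (if a \<in> V \<longleftrightarrow> a \<in> W then a else a + k)" for a
  have "\<theta> (a + b) = \<theta> a + \<theta> b" for a b
    unfolding \<theta>_def Vi Wi by (auto simp: algebra_simps)
  moreover have inv: "\<theta> (\<theta> a) = a" for a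
    unfolding \<theta>_def using Vi Wi k by auto
  moreover have "\<theta> 1 = 1" using one by (simp add: \<theta>_def)
  moreover have \<theta>U: "\<theta> a \<in> U" if "a \<in> U" for a
    using that U complement_add_iff[OF U(1)] by (simp add: \<theta>_def)
  moreover have "\<theta> ` U = U" using \<theta>U inv by (metis image_eqI image_subsetI subsetI subset_antisym)
  moreover have "a \<in> V \<longleftrightarrow> \<theta> a \<in> W" for a using Vi Wi k by (auto simp: \<theta>_def)
  moreover from this have "\<theta> ` V = W" using inv by (metis image_eqI image_subsetI subsetI subset_antisym)
  ultimately show ?thesis using that U(1) by blast
qed

section \<open>Matrices over the coordinate ring\<close>

definition mat2 :: "'a \<Rightarrow> 'a \<Rightarrow> 'a \<Rightarrow> 'a \<Rightarrow> 'a^2^2" where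
  "mat2 a b c d = (\<chi> i j. if i = 1 then if j = 1 then a else b else if j = 1 then c else d)"

lemma mat2_nth [simp]:
  "mat2 a b c d $ 1 $ 1 = a" "mat2 a b c d $ 1 $ 2 = b"
  "mat2 a b c d $ 2 $ 1 = c" "mat2 a b c d $ 2 $ 2 = d"
  by (simp_all add: mat2_def)

lemma mat2_eq_iff [simp]: "mat2 a b c d = mat2 a' b' c' d' \<longleftrightarrow> a = a' \<and> b = b' \<and> c = c' \<and> d = d'"
  by (auto simp: vec_eq_iff forall_2)

lemma mat2_cases: obtains a b c d where "M = mat2 a b c d"
proof
  show "M = mat2 (M $ 1 $ 1) (M $ 1 $ 2) (M $ 2 $ 1) (M $ 2 $ 2)"
    by (simp add: vec_eq_iff forall_2)
qed

lemma mat2_mult [simp]: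
  "mat2 a b c d ** mat2 a' b' c' d' =
     mat2 (a * a' + b * c') (a * b' + b * d') (c * a' + d * c') (c * b' + d * d')"
  by (simp add: vec_eq_iff forall_2 matrix_matrix_mult_def sum_2)

lemma mat_1_eq_mat2: "mat 1 = mat2 1 0 0 1"
  by (simp add: vec_eq_iff forall_2 mat_def)

lemma det_mat2: "det (mat2 a b c d) = a * d - b * (c :: 'a :: comm_ring_1)"
  by (simp add: det_2)

lemma unip_eq_mat2: "unip a = mat2 1 a 0 1"
  by (simp add: vec_eq_iff forall_2 unip_def)

interpretation GL2A: group GL2A
  rewrites "mult GL2A = (**)" and "one GL2A = mat 1"
  by (rule group_GL2A) (simp_all add: GL2A_def)

lemma GL2A_simps: "mult GL2A = (**)" "one GL2A = mat 1" "carrier GL2A = {M. invertible M}"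
  by (simp_all add: GL2A_def)

lemma mat2_in_GL2A_iff: "mat2 a b c d \<in> carrier GL2A \<longleftrightarrow> a * d + b * c = 1"
proof
  assume "mat2 a b c d \<in> carrier GL2A"
  then obtain N where "mat2 a b c d ** N = mat 1" by (auto simp: GL2A_simps invertible_def)
  then have "det (mat2 a b c d) * det N = 1" by (metis det_mul det_I)
  then show "a * d + b * c = 1" using coord_ring_unit by (simp add: det_mat2)
next
  assume "a * d + b * c = 1"
  moreover from this have "d * a + b * c = 1" "b * c + a * d = 1" "c * b + d * a = 1" "c * b + a * d = 1"
    by (simp_all add: ac_simps)
  ultimately have "mat2 a b c d ** mat2 d b c a = mat 1" "mat2 d b c a ** mat2 a b c d = mat 1"
    by (simp_all add: mat_1_eq_mat2 ac_simps flip: distrib_left mult_2)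
  then show "mat2 a b c d \<in> carrier GL2A" unfolding GL2A_simps invertible_def by blast
qed

section \<open>Generators of \<open>H\<close>\<close>

definition S :: "coord_ring^2^2" where "S = mat2 0 1 1 0"

lemma unip_mult [simp]: "unip a ** unip b = unip (a + b)"
  by (simp add: unip_eq_mat2 add.commute)

lemma unip_0: "unip 0 = mat 1"
  by (simp add: unip_eq_mat2 mat_1_eq_mat2)

lemma unip_inject [simp]: "unip a = unip b \<longleftrightarrow> a = b"
  by (simp add: unip_eq_mat2)

lemma S_S [simp]: "S ** S = mat 1"
  by (simp add: S_def mat_1_eq_mat2)

text \<open>GL_2(F_2) is the symmetric group on three letters, with \<open>S\<close> and
  \<open>unip 1\<close> as two transpositions. The relation serves to eliminate letters 1 from
  words.\<close>

lemma braid: "S ** unip 1 ** S = unip 1 ** S ** unip 1"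
  by (simp add: S_def unip_eq_mat2)

lemma braid_mult:
  "S ** (unip 1 ** (S ** M)) = unip 1 ** (S ** (unip 1 ** M))" for M :: "coord_ring^2^2"
proof -
  have "S ** (unip 1 ** (S ** M)) = (S ** unip 1 ** S) ** M" by (simp only: matrix_mul_assoc)
  then show ?thesis unfolding braid by (simp only: matrix_mul_assoc)
qed

lemma unip_unip [simp]: "unip a ** (unip b ** M) = unip (a + b) ** M" "S ** (S ** M) = M"
  by (simp_all add: matrix_mul_assoc)

lemma S_closed [simp]: "S \<in> carrier GL2A" and unip_closed [simp]: "unip a \<in> carrier GL2A"
  by (simp_all add: S_def unip_eq_mat2 mat2_in_GL2A_iff)

lemma inv_S [simp]: "inv\<^bsub>GL2A\<^esub> S = S" and inv_unip [simp]: "inv\<^bsub>GL2A\<^esub> (unip a) = unip a"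
  by (intro GL2A.inv_equality; simp add: unip_0)+

lemma GL2F2_subset:
  "GL2F2 \<subseteq> {mat 1, unip 1, S, unip 1 ** S, S ** unip 1, unip 1 ** S ** unip 1}"
proof
  fix M assume "M \<in> GL2F2"
  then obtain N :: "bit^2^2" where N: "invertible N" "M = (\<chi> i j. F2_emb (N $ i $ j))"
    by (auto simp: GL2F2_def)
  obtain a b c d where abcd: "N = mat2 a b c d" by (rule mat2_cases)
  have M: "M = mat2 (F2_emb a) (F2_emb b) (F2_emb c) (F2_emb d)"
    by (simp add: N(2) abcd vec_eq_iff forall_2)
  obtain N' where "N ** N' = mat 1" using N(1) by (auto simp: invertible_def)
  then have "det N * det N' = 1" by (metis det_mul det_I)
  then have "a * d - b * c \<noteq> 0" using det_mat2[of a b c d] abcd by auto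
  then show "M \<in> {mat 1, unip 1, S, unip 1 ** S, S ** unip 1, unip 1 ** S ** unip 1}"
    by (cases a; cases b; cases c; cases d) (simp_all add: M S_def unip_eq_mat2 mat_1_eq_mat2)
qed

lemma S_in_GL2F2: "S \<in> GL2F2"
proof -
  have "mat2 0 1 1 0 ** mat2 0 1 1 0 = (mat 1 :: bit^2^2)" by (simp add: mat_1_eq_mat2)
  then have "invertible (mat2 0 1 1 0 :: bit^2^2)" unfolding invertible_def by blast
  moreover have "S = (\<chi> i j. F2_emb (mat2 0 1 1 0 $ i $ j))"
    by (simp add: S_def vec_eq_iff forall_2)
  ultimately show ?thesis unfolding GL2F2_def by blast
qed

lemma GL2F2_closed: "GL2F2 \<subseteq> carrier GL2A"
  using GL2F2_subset GL2A.m_closed[of "unip 1" S] GL2A.m_closed[of S "unip 1"]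
    GL2A.m_closed[of "unip 1 ** S" "unip 1"] GL2A.one_closed by auto

lemma UA_closed: "UA \<subseteq> carrier GL2A"
  by (auto simp: UA_def)

lemma subgroup_H: "subgroup H_subgroup GL2A"
  unfolding H_subgroup_def using GL2F2_closed UA_closed by (intro GL2A.generate_is_subgroup) auto

lemma H_closed: "h \<in> H_subgroup \<Longrightarrow> h \<in> carrier GL2A"
  using subgroup.mem_carrier[OF subgroup_H] .

lemma H_mult [simp]: "\<lbrakk>g \<in> H_subgroup; h \<in> H_subgroup\<rbrakk> \<Longrightarrow> g ** h \<in> H_subgroup"
  using subgroup.m_closed[OF subgroup_H] by (simp add: GL2A_simps)

lemma H_inv [simp]: "h \<in> H_subgroup \<Longrightarrow> inv\<^bsub>GL2A\<^esub> h \<in> H_subgroup"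
  using subgroup.m_inv_closed[OF subgroup_H] .

lemma S_in_H [simp]: "S \<in> H_subgroup" and unip_in_H [simp]: "unip a \<in> H_subgroup"
  unfolding H_subgroup_def using S_in_GL2F2 by (auto simp: UA_def intro: generate.incl)

lemma one_in_H [simp]: "mat 1 \<in> H_subgroup"
  using unip_in_H[of 0] by (simp add: unip_0)

lemma H_eq_generate: "H_subgroup = generate GL2A (insert S UA)"
proof
  let ?K = "generate GL2A (insert S UA)"
  have K: "subgroup ?K GL2A" using UA_closed by (intro GL2A.generate_is_subgroup) auto
  have u: "unip 1 \<in> ?K" "S \<in> ?K" "mat 1 \<in> ?K"
    using generate.one[of GL2A] by (auto simp: UA_def GL2A_simps intro: generate.incl)
  have m: "g ** h \<in> ?K" if "g \<in> ?K" "h \<in> ?K" for g h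
    using subgroup.m_closed[OF K that] by (simp add: GL2A_simps)
  have "GL2F2 \<subseteq> ?K" using GL2F2_subset u m by blast
  moreover have "UA \<subseteq> ?K" by (auto intro: generate.incl)
  ultimately show "H_subgroup \<subseteq> ?K"
    unfolding H_subgroup_def using GL2A.generate_subgroup_incl[OF _ K] by blast
  show "?K \<subseteq> H_subgroup"
    using subgroup_H by (intro GL2A.generate_subgroup_incl) (auto simp: UA_def)
qed

text \<open>Both kinds of generators are closed under inverses, so left multiplications by them
  reach all of \<open>H\<close>.\<close>

lemma H_induct [consumes 1, case_names one unip S]:
  assumes "h \<in> H_subgroup" "P (mat 1)"
    and "\<And>a h. \<lbrakk>h \<in> H_subgroup; P h\<rbrakk> \<Longrightarrow> P (unip a ** h)"
    and "\<And>h. \<lbrakk>h \<in> H_subgroup; P h\<rbrakk> \<Longrightarrow> P (S ** h)"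
  shows "P h"
proof -
  from assms(1) have "\<forall>g\<in>H_subgroup. P g \<longrightarrow> P (h ** g)"
    unfolding H_eq_generate
  proof (induction h rule: generate.induct)
    case one
    then show ?case by (simp add: GL2A_simps)
  next
    case (incl h)
    then show ?case using assms(3,4) by (auto simp: UA_def H_eq_generate)
  next
    case (inv h)
    then show ?case using assms(3,4) by (auto simp: UA_def H_eq_generate)
  next
    case (eng h1 h2)
    then have "h1 \<in> H_subgroup" "h2 \<in> H_subgroup" by (auto simp: H_eq_generate)
    then show ?case using eng H_mult by (simp add: GL2A_simps H_eq_generate flip: matrix_mul_assoc)
  qed
  then show ?thesis using one_in_H assms(2) by force
qed

section \<open>The amalgam structure of \<open>H\<close>\<close>

fun hword :: "coord_ring \<Rightarrow> coord_ring list \<Rightarrow> coord_ring^2^2" where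
  "hword a [] = unip a"
| "hword a (b # bs) = unip a ** (S ** hword b bs)"

text \<open>The normal form of the amalgam. An interior letter 0 or 1 would let
  \<open>S ** unip 0 ** S = mat 1\<close> or the braid relation shorten the word. The two end
  letters are arbitrary: the leading one is the separate argument of \<open>hword\<close>, the last
  one is removed by \<open>butlast\<close>.\<close>

definition interior_nonconstant :: "coord_ring list \<Rightarrow> bool" where
  "interior_nonconstant bs \<longleftrightarrow> (\<forall>x\<in>set (butlast bs). x \<noteq> 0 \<and> x \<noteq> 1)"

lemma interior_nonconstant_Nil [simp]: "interior_nonconstant []"
  and interior_nonconstant_Cons [simp]: "interior_nonconstant (b # bs) \<longleftrightarrow>
    interior_nonconstant bs \<and> (bs = [] \<or> b \<noteq> 0 \<and> b \<noteq> 1)"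
  by (auto simp: interior_nonconstant_def)

lemma unip_hword [simp]: "unip c ** hword a bs = hword (c + a) bs"
  by (cases bs) simp_all

lemma hword_in_H [simp]: "hword a bs \<in> H_subgroup"
  by (induction bs arbitrary: a) simp_all

lemma S_hword: "S ** hword a bs = hword 0 (a # bs)"
  by (simp add: unip_0)

lemma S_hword_reduce:
  "S ** hword 0 (b # bs) = hword b bs"
  "S ** hword 1 (b # bs) = hword 1 ((b + 1) # bs)"
  by (simp_all add: unip_0 braid_mult add.commute)

lemma hword_exists:
  "h \<in> H_subgroup \<Longrightarrow> \<exists>a bs. h = hword a bs \<and> interior_nonconstant bs"
proof (induction rule: H_induct)
  case one
  have "mat 1 = hword 0 []" by (simp add: unip_0)
  then show ?case using interior_nonconstant_Nil by blast
next
  case (unip a h)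
  then show ?case by force
next
  case (S h)
  then obtain a bs where h: "h = hword a bs" "interior_nonconstant bs" by blast
  show ?case
  proof (cases "bs = [] \<or> a \<noteq> 0 \<and> a \<noteq> 1")
    case True
    then show ?thesis using h S_hword by (metis interior_nonconstant_Cons)
  next
    case False
    then obtain b cs where bs: "bs = b # cs" by (cases bs) auto
    have "interior_nonconstant ((b + 1) # cs)" "interior_nonconstant cs"
      using h bs by (auto simp: add_eq_0_iff)
    then show ?thesis using False h(1) bs S_hword_reduce[of b cs] by metis
  qed
qed

text \<open>\<open>r\<close> is an admissible remainder on division by \<open>q\<close>. Zero is
  listed apart because \<open>pole_deg\<close> does not distinguish it from the constant 1.\<close>

definition dominated :: "coord_ring \<Rightarrow> coord_ring \<Rightarrow> bool" where
  "dominated r q \<longleftrightarrow> q \<noteq> 0 \<and> (r = 0 \<or> pole_deg r < pole_deg q)"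

lemma pole_deg_pos_iff: "pole_deg a > 0 \<longleftrightarrow> a \<noteq> 0 \<and> a \<noteq> 1"
  using pole_deg_eq_0_iff[of a] by auto

text \<open>Left multiplication by \<open>unip a ** S\<close> is a step of the Euclidean algorithm on the first column.\<close>
lemma first_column_step:
  fixes M :: "coord_ring^2^2"
  shows "(unip a ** (S ** M)) $ 1 $ 1 = a * M $ 1 $ 1 + M $ 2 $ 1"
  "(unip a ** (S ** M)) $ 2 $ 1 = M $ 1 $ 1"
  by (cases M rule: mat2_cases; simp add: unip_eq_mat2 S_def add.commute)+

text \<open>Each nonconstant letter strictly raises the degree of the upper entry, while the
  previous upper entry becomes the lower one.\<close>

lemma hword_first_column_dominated:
  "interior_nonconstant (b # cs) \<Longrightarrow> dominated (hword b cs $ 2 $ 1) (hword b cs $ 1 $ 1)"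
proof (induction cs arbitrary: b)
  case Nil
  then show ?case by (simp add: dominated_def unip_eq_mat2)
next
  case (Cons c ds)
  let ?p = "hword c ds $ 1 $ 1" and ?q = "hword c ds $ 2 $ 1"
  have IH: "?p \<noteq> 0" "?q = 0 \<or> pole_deg ?q < pole_deg ?p" using Cons by (auto simp: dominated_def)
  have b: "b \<noteq> 0" "pole_deg b > 0" using Cons.prems by (auto simp: pole_deg_pos_iff)
  have "pole_deg (?q + b * ?p) = pole_deg (b * ?p)"
    using IH b by (intro pole_deg_add_eq) (auto simp: pole_deg_mult)
  then have "pole_deg (b * ?p + ?q) > pole_deg ?p" using IH b by (simp add: add.commute pole_deg_mult)
  then show ?case by (auto simp: first_column_step dominated_def)
qed

text \<open>The lower left entry is 0 only for words without \<open>S\<close>. Otherwise call it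
  \<open>q\<close>: the upper left entry is \<open>a * q + r\<close> with \<open>r\<close> dominated
  by \<open>q\<close>, so the leading letter \<open>a\<close> is determined as a quotient, and the
  rest follows by induction after stripping \<open>unip a ** S\<close>.\<close>

lemma hword_unique:
  assumes "interior_nonconstant bs" "interior_nonconstant bs'" "hword a bs = hword a' bs'"
  shows "a = a' \<and> bs = bs'"
  using assms
proof (induction bs arbitrary: a a' bs')
  case Nil
  show ?case
  proof (cases bs')
    case Nil
    then show ?thesis using Nil.prems \<open>bs' = []\<close> by simp
  next
    case (Cons b' cs')
    have "dominated (hword b' cs' $ 2 $ 1) (hword b' cs' $ 1 $ 1)"
      using Nil.prems Cons by (intro hword_first_column_dominated) simp
    moreover have "hword a' bs' $ 2 $ 1 = 0" using Nil.prems(3) by (simp add: unip_eq_mat2 flip: Nil.prems(3))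
    ultimately show ?thesis using Cons by (simp add: first_column_step dominated_def)
  qed
next
  case outer: (Cons b cs)
  have d: "dominated (hword b cs $ 2 $ 1) (hword b cs $ 1 $ 1)"
    using outer.prems by (intro hword_first_column_dominated) simp
  show ?case
  proof (cases bs')
    case Nil
    then have "hword a (b # cs) $ 2 $ 1 = 0" using outer.prems(3) by (simp add: unip_eq_mat2)
    then show ?thesis using d by (simp add: first_column_step dominated_def)
  next
    case (Cons b' cs')
    have d': "dominated (hword b' cs' $ 2 $ 1) (hword b' cs' $ 1 $ 1)"
      using outer.prems Cons by (intro hword_first_column_dominated) simp
    define q where "q = hword b cs $ 1 $ 1"
    define r where "r = hword b cs $ 2 $ 1"
    define r' where "r' = hword b' cs' $ 2 $ 1"
    have e: "hword b' cs' $ 1 $ 1 = q" "a * q + r = a' * q + r'"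
      using arg_cong[OF outer.prems(3), of "\<lambda>M. M $ 1 $ 1"] arg_cong[OF outer.prems(3), of "\<lambda>M. M $ 2 $ 1"] Cons
      by (simp_all add: first_column_step q_def r_def r'_def)
    have dr: "q \<noteq> 0" "r = 0 \<or> pole_deg r < pole_deg q" "r' = 0 \<or> pole_deg r' < pole_deg q"
      using d d' e(1) by (auto simp: dominated_def q_def r_def r'_def)
    have "a = a'"
    proof (rule ccontr)
      assume "a \<noteq> a'"
      then have ne: "a + a' \<noteq> 0" by (simp add: add_eq_0_iff)
      have "(a + a') * q = (a * q + r) + (a' * q + r') + (r + r')"
        by (simp add: algebra_simps)
      then have eq: "(a + a') * q = r + r'" using e(2) by simp
      then have "r + r' \<noteq> 0" using ne dr(1) by (metis mult_eq_0_iff)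
      then have "pole_deg (r + r') < pole_deg q"
        using pole_deg_add_le[of r r'] dr by (cases "r = 0"; cases "r' = 0") auto
      then show False using eq ne dr(1) pole_deg_mult[of "a + a'" q] by simp
    qed
    moreover from this have "hword b cs = hword b' cs'"
    proof -
      have "S ** (unip a ** hword a (b # cs)) = S ** (unip a ** hword a' bs')" using outer.prems(3) by simp
      then show ?thesis using Cons \<open>a = a'\<close> by (simp add: unip_0)
    qed
    ultimately show ?thesis using outer Cons by auto
  qed
qed

section \<open>Extending additive maps of the ring to \<open>H\<close>\<close>

text \<open>The map acts letter by letter on normal forms and is well defined by
  \<open>hword_unique\<close>. It is multiplicative for additive \<open>\<psi>\<close> with
  \<open>\<psi> 1 = 1\<close>, because the reductions of words are triggered only by the letters 0
  and 1 and otherwise only add letters.\<close>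

definition H_extend :: "(coord_ring \<Rightarrow> coord_ring) \<Rightarrow> coord_ring^2^2 \<Rightarrow> coord_ring^2^2" where
  "H_extend \<psi> h = (THE M. \<exists>a bs. h = hword a bs \<and> interior_nonconstant bs \<and> M = hword (\<psi> a) (map \<psi> bs))"

lemma H_extend_hword:
  "interior_nonconstant bs \<Longrightarrow> H_extend \<psi> (hword a bs) = hword (\<psi> a) (map \<psi> bs)"
  unfolding H_extend_def by (rule the_equality) (auto dest: hword_unique)

context
  fixes \<psi> :: "coord_ring \<Rightarrow> coord_ring"
  assumes add: "\<And>a b. \<psi> (a + b) = \<psi> a + \<psi> b" and one: "\<psi> 1 = 1" and inj: "inj \<psi>"
begin

lemma psi_0: "\<psi> 0 = 0" using add[of 0 0] by simp

lemma H_extend_unip_mult: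
  assumes "h \<in> H_subgroup" shows "H_extend \<psi> (unip c ** h) = unip (\<psi> c) ** H_extend \<psi> h"
proof -
  obtain a bs where "h = hword a bs" "interior_nonconstant bs" using hword_exists[OF assms] by blast
  then show ?thesis by (simp add: H_extend_hword add)
qed

lemma H_extend_S_mult:
  assumes "h \<in> H_subgroup" shows "H_extend \<psi> (S ** h) = S ** H_extend \<psi> h"
proof -
  obtain a bs where h: "h = hword a bs" "interior_nonconstant bs" using hword_exists[OF assms] by blast
  show ?thesis
  proof (cases "bs = [] \<or> a \<noteq> 0 \<and> a \<noteq> 1")
    case True
    then show ?thesis using h
      by (simp only: h(1) S_hword H_extend_hword interior_nonconstant_Cons list.map psi_0)
  next
    case False
    then obtain b cs where bs: "bs = b # cs" by (cases bs) auto
    have i: "interior_nonconstant ((b + 1) # cs)" "interior_nonconstant cs"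
      using h bs by (auto simp: add_eq_0_iff)
    consider "a = 0" | "a = 1" using False by blast
    then show ?thesis
    proof cases
      case 1
      show ?thesis
        using h(2) unfolding h(1) bs 1 S_hword_reduce
        by (simp only: H_extend_hword i list.map psi_0 S_hword_reduce)
    next
      case 2
      show ?thesis
        using h(2) unfolding h(1) bs 2 S_hword_reduce
        by (simp only: H_extend_hword i list.map add one S_hword_reduce)
    qed
  qed
qed

lemma H_extend_one: "H_extend \<psi> (mat 1) = mat 1"
  using H_extend_hword[of "[]" \<psi> 0] by (simp add: unip_0 psi_0)

lemma H_extend_unip: "H_extend \<psi> (unip a) = unip (\<psi> a)"
  using H_extend_hword[of "[]"] by simp

lemma H_extend_S: "H_extend \<psi> S = S"
  using H_extend_S_mult[OF one_in_H] by (simp add: H_extend_one)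

lemma H_extend_mult:
  assumes "g \<in> H_subgroup" "h \<in> H_subgroup"
  shows "H_extend \<psi> (g ** h) = H_extend \<psi> g ** H_extend \<psi> h"
  using assms(1)
proof (induction rule: H_induct)
  case (unip a g)
  then show ?case using assms by (simp add: H_extend_unip_mult flip: matrix_mul_assoc del: unip_unip)
next
  case (S g)
  then show ?case using assms by (simp add: H_extend_S_mult flip: matrix_mul_assoc)
qed (simp add: H_extend_one)

lemma H_extend_closed: "h \<in> H_subgroup \<Longrightarrow> H_extend \<psi> h \<in> H_subgroup"
  by (induction rule: H_induct) (simp_all add: H_extend_one H_extend_unip_mult H_extend_S_mult)

lemma H_extend_involution:
  assumes "\<And>a. \<psi> (\<psi> a) = a" "h \<in> H_subgroup"
  shows "H_extend \<psi> (H_extend \<psi> h) = h"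
  using assms(2)
  by (induction rule: H_induct)
    (simp_all add: H_extend_one H_extend_unip_mult H_extend_S_mult H_extend_closed assms(1))

end

section \<open>Elements of finite order in \<open>H\<close>\<close>

text \<open>Written without inverses, so that associativity is enough for most computations.\<close>

definition conjugate_in_H :: "coord_ring^2^2 \<Rightarrow> coord_ring^2^2 \<Rightarrow> bool" where
  "conjugate_in_H g h \<longleftrightarrow> (\<exists>k\<in>H_subgroup. g ** k = k ** h)"

lemma conjugate_in_H_trans:
  assumes "conjugate_in_H f g" "conjugate_in_H g h" shows "conjugate_in_H f h"
proof -
  obtain k l where "k \<in> H_subgroup" "l \<in> H_subgroup" "f ** k = k ** g" "g ** l = l ** h"
    using assms by (auto simp: conjugate_in_H_def)
  moreover from this have "f ** (k ** l) = (k ** l) ** h" by (metis matrix_mul_assoc)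
  ultimately show ?thesis unfolding conjugate_in_H_def using H_mult by blast
qed

lemma conjugate_in_H_swap: "g \<in> H_subgroup \<Longrightarrow> conjugate_in_H (g ** h) (h ** g)"
  unfolding conjugate_in_H_def by (intro bexI[of _ g]) (simp_all add: matrix_mul_assoc)

lemma conjugate_in_H_refl: "conjugate_in_H h h"
  unfolding conjugate_in_H_def by (intro bexI[of _ "mat 1"]) simp_all

text \<open>Unlike in \<open>hword\<close>, every letter is followed by an \<open>S\<close>, so
  rotating the list amounts to a conjugation.\<close>

fun cycle_word :: "coord_ring list \<Rightarrow> coord_ring^2^2" where
  "cycle_word [] = mat 1"
| "cycle_word (c # cs) = unip c ** (S ** cycle_word cs)"

lemma cycle_word_append: "cycle_word (cs @ ds) = cycle_word cs ** cycle_word ds"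
  by (induction cs) (simp_all flip: matrix_mul_assoc del: unip_unip)

lemma cycle_word_in_H [simp]: "cycle_word cs \<in> H_subgroup"
  by (induction cs) simp_all

text \<open>A trailing \<open>unip a\<close> is moved to the front by conjugation, where it merges
  with the first letter if there is one.\<close>

lemma H_conj_cycle_word:
  assumes "h \<in> H_subgroup"
  shows "\<exists>cs. conjugate_in_H h (cycle_word cs) \<or> (\<exists>a. conjugate_in_H h (unip a))"
proof -
  from assms have "\<exists>cs a. h = cycle_word cs ** unip a"
  proof (induction rule: H_induct)
    case one
    have "mat 1 = cycle_word [] ** unip 0" by (simp add: unip_0)
    then show ?case by blast
  next
    case (unip c h)
    then obtain cs a where h: "h = cycle_word cs ** unip a" by blast
    show ?case
    proof (cases cs)
      case Nil
      then have "unip c ** h = cycle_word [] ** unip (c + a)" using h by simp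
      then show ?thesis by blast
    next
      case (Cons d ds)
      then have "unip c ** h = cycle_word ((c + d) # ds) ** unip a"
        using h by (simp flip: matrix_mul_assoc)
      then show ?thesis by blast
    qed
  next
    case (S h)
    then obtain cs a where "h = cycle_word cs ** unip a" by blast
    then have "S ** h = cycle_word (0 # cs) ** unip a" by (simp add: unip_0 flip: matrix_mul_assoc)
    then show ?case by blast
  qed
  then obtain cs a where h: "h = cycle_word cs ** unip a" by blast
  then have c: "conjugate_in_H h (unip a ** cycle_word cs)" by (simp add: conjugate_in_H_swap)
  show ?thesis
  proof (cases cs)
    case Nil
    then show ?thesis using c by auto
  next
    case (Cons d ds)
    then have "unip a ** cycle_word cs = cycle_word ((a + d) # ds)" by simp
    then show ?thesis using c by metis
  qed
qed

text \<open>A constant letter can be rotated to the front. If it is not alone, removing it by the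
  relations of GL_2(F_2) gives a shorter cyclic word or a single \<open>unip a\<close>; a lone
  constant letter is the second alternative.\<close>

lemma cycle_word_reduce:
  "(\<exists>a. conjugate_in_H (cycle_word cs) (unip a)) \<or>
   (\<exists>c\<in>{0, 1}. conjugate_in_H (cycle_word cs) (unip c ** S)) \<or>
   (\<exists>ds. ds \<noteq> [] \<and> (\<forall>d\<in>set ds. d \<noteq> 0 \<and> d \<noteq> 1) \<and> conjugate_in_H (cycle_word cs) (cycle_word ds))"
    (is "?goal cs")
proof (induction "length cs" arbitrary: cs rule: less_induct)
  case less
  have step: "?goal cs" if "conjugate_in_H (cycle_word cs) (cycle_word ds)" "length ds < length cs" for ds
    using less.hyps[OF that(2)] conjugate_in_H_trans[OF that(1)] by blast
  consider "cs = []" | "cs \<noteq> []" "\<forall>c\<in>set cs. c \<noteq> 0 \<and> c \<noteq> 1" | c where "c \<in> set cs" "c \<in> {0, 1}"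
    by fastforce
  then show ?case
  proof cases
    case 1
    then have "conjugate_in_H (cycle_word cs) (unip 0)" by (simp add: unip_0 conjugate_in_H_refl)
    then show ?thesis by blast
  next
    case 2
    then show ?thesis using conjugate_in_H_refl by blast
  next
    case 3
    then obtain us vs where cs: "cs = us @ c # vs" using split_list by metis
    have rot: "conjugate_in_H (cycle_word cs) (cycle_word (c # vs @ us))"
      using conjugate_in_H_swap[of "cycle_word us" "cycle_word (c # vs)"] cs
      by (simp only: cycle_word_append[symmetric] cycle_word_in_H append_Cons)
    show ?thesis
    proof (cases "vs @ us")
      case Nil
      then have "conjugate_in_H (cycle_word cs) (unip c ** S)" using rot by simp
      then show ?thesis using 3 by blast
    next
      case (Cons d es)
      have len: "length cs = Suc (Suc (length es))" using arg_cong[OF Cons, of length] cs by simp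
      let ?E = "cycle_word es"
      \<comment> \<open>Conjugation by \<open>S\<close> moves the initial \<open>S\<close> to the
        end, where it cancels the \<open>S\<close> after the last letter. For \<open>c = 1\<close>
        the same conjugation produces \<open>S ** unip 1 ** S\<close> at the front, and the braid
        relation applies.\<close>
      have c1: "conjugate_in_H (cycle_word cs) (unip d ** (S ** (?E ** S)))" if "c = 0"
        using rot conjugate_in_H_swap[of S "unip d ** (S ** ?E)"] conjugate_in_H_trans that Cons
        by (simp add: unip_0 flip: matrix_mul_assoc)
      have c2: "conjugate_in_H (cycle_word cs) (unip 1 ** (S ** (unip (1 + d) ** (S ** (?E ** S)))))" if "c = 1"
      proof -
        have "conjugate_in_H (cycle_word cs) (S ** (S ** cycle_word (1 # d # es)) )"
          using rot that Cons by simp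
        moreover have "conjugate_in_H (S ** (S ** cycle_word (1 # d # es))) ((S ** cycle_word (1 # d # es)) ** S)"
          by (rule conjugate_in_H_swap) simp
        ultimately have "conjugate_in_H (cycle_word cs) ((S ** cycle_word (1 # d # es)) ** S)"
          by (rule conjugate_in_H_trans)
        then show ?thesis by (simp add: braid_mult flip: matrix_mul_assoc)
      qed
      show ?thesis
      proof (cases es rule: rev_cases)
        case Nil
        show ?thesis
        proof (cases "c = 0")
          case True
          then show ?thesis using c1 Nil by auto
        next
          case False
          then have "conjugate_in_H (cycle_word cs) (unip 1 ** (S ** unip (1 + d)))"
            using c2 Nil 3 by (simp flip: matrix_mul_assoc)
          moreover have "conjugate_in_H (unip 1 ** S ** unip (1 + d)) (unip (1 + d) ** (unip 1 ** S))"
            by (rule conjugate_in_H_swap) simp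
          ultimately have "conjugate_in_H (cycle_word cs) (unip (1 + d) ** (unip 1 ** S))"
            using conjugate_in_H_trans by (simp flip: matrix_mul_assoc del: unip_unip)
          then have "conjugate_in_H (cycle_word cs) (cycle_word [1 + d + 1])" by simp
          then show ?thesis by (rule step) (simp add: len)
        qed
      next
        case (snoc fs e)
        have ES: "?E ** S = cycle_word fs ** unip e"
          using snoc by (simp add: cycle_word_append flip: matrix_mul_assoc)
        show ?thesis
        proof (cases "c = 0")
          case True
          let ?M = "unip d ** (S ** cycle_word fs)"
          have "conjugate_in_H (cycle_word cs) (?M ** unip e)"
            using c1[OF True] ES by (simp flip: matrix_mul_assoc)
          moreover have "conjugate_in_H (?M ** unip e) (unip e ** ?M)"
            by (rule conjugate_in_H_swap) simp
          ultimately have "conjugate_in_H (cycle_word cs) (unip e ** ?M)" by (rule conjugate_in_H_trans)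
          then have "conjugate_in_H (cycle_word cs) (cycle_word ((e + d) # fs))" by simp
          then show ?thesis by (rule step) (simp add: len snoc)
        next
          case False
          then have "c = 1" using 3 by simp
          let ?M = "unip 1 ** (S ** (unip (1 + d) ** (S ** cycle_word fs)))"
          have "conjugate_in_H (cycle_word cs) (?M ** unip e)"
            using c2[OF \<open>c = 1\<close>] ES by (simp flip: matrix_mul_assoc)
          moreover have "conjugate_in_H (?M ** unip e) (unip e ** ?M)"
            by (rule conjugate_in_H_swap) simp
          ultimately have "conjugate_in_H (cycle_word cs) (unip e ** ?M)" by (rule conjugate_in_H_trans)
          then have "conjugate_in_H (cycle_word cs) (cycle_word ((e + 1) # (1 + d) # fs))" by simp
          then show ?thesis by (rule step) (simp add: len snoc)
        qed
      qed
    qed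
  qed
qed

section \<open>Traces\<close>

definition tr2 :: "coord_ring^2^2 \<Rightarrow> coord_ring" where
  "tr2 M = M $ 1 $ 1 + M $ 2 $ 2"

lemma tr2_mat2 [simp]: "tr2 (mat2 a b c d) = a + d"
  by (simp add: tr2_def)

lemma tr2_mult_commute: "tr2 (M ** N) = tr2 (N ** M)"
  by (cases M rule: mat2_cases; cases N rule: mat2_cases) (simp add: algebra_simps)

lemma tr2_conjugate: assumes "conjugate_in_H g h" shows "tr2 g = tr2 h"
proof -
  obtain k where k: "k \<in> H_subgroup" "g ** k = k ** h" using assms by (auto simp: conjugate_in_H_def)
  let ?k' = "inv\<^bsub>GL2A\<^esub> k"
  have i: "k ** ?k' = mat 1" "?k' ** k = mat 1" using GL2A.r_inv GL2A.l_inv H_closed[OF k(1)] by auto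
  have "tr2 g = tr2 (g ** (k ** ?k'))" using i by simp
  also have "\<dots> = tr2 ((k ** h) ** ?k')" using k(2) by (simp add: matrix_mul_assoc)
  also have "\<dots> = tr2 (?k' ** (k ** h))" by (rule tr2_mult_commute)
  also have "\<dots> = tr2 h" using i by (simp add: matrix_mul_assoc)
  finally show ?thesis .
qed

text \<open>By induction the upper left entry has strictly larger degree than the other three, so it
  alone determines the degree of the trace.\<close>

lemma tr2_cycle_word:
  assumes "cs \<noteq> []" "\<forall>c\<in>set cs. c \<noteq> 0 \<and> c \<noteq> 1"
  shows "pole_deg (tr2 (cycle_word cs)) > 0"
proof -
  have "\<exists>p q r t. cycle_word cs = mat2 p q r t \<and> pole_deg q < pole_deg p \<and> pole_deg r < pole_deg p \<and>
      pole_deg t < pole_deg p"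
    using assms
  proof (induction cs)
    case (Cons c cs)
    have c: "c \<noteq> 0" "pole_deg c > 0" using Cons.prems by (auto simp: pole_deg_pos_iff)
    show ?case
    proof (cases "cs = []")
      case True
      then show ?thesis using c by (simp add: unip_eq_mat2 S_def)
    next
      case False
      then obtain p q r t where IH: "cycle_word cs = mat2 p q r t" "pole_deg q < pole_deg p"
          "pole_deg r < pole_deg p" "pole_deg t < pole_deg p"
        using Cons by auto
      then have p: "p \<noteq> 0" by auto
      have cp: "pole_deg (c * p) = pole_deg c + pole_deg p" using c p by (simp add: pole_deg_mult)
      have "pole_deg (r + c * p) = pole_deg (c * p)" using cp IH c by (intro pole_deg_add_eq) simp
      moreover have "pole_deg (c * q) \<le> pole_deg c + pole_deg q"
        using c by (cases "q = 0") (simp_all add: pole_deg_mult)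
      then have "pole_deg (t + c * q) < pole_deg c + pole_deg p"
        using pole_deg_add_le[of t "c * q"] IH by (auto simp: max_def split: if_splits)
      ultimately show ?thesis using IH cp c by (simp add: unip_eq_mat2 S_def add.commute)
    qed
  qed simp
  then obtain p q r t where "cycle_word cs = mat2 p q r t" "pole_deg t < pole_deg p" by blast
  then show ?thesis using pole_deg_add_eq[of t p] by (simp add: add.commute)
qed

lemma H_constant_trace:
  assumes "h \<in> H_subgroup" "tr2 h \<in> {0, 1}"
  shows "(\<exists>a. conjugate_in_H h (unip a)) \<or> conjugate_in_H h S \<or> conjugate_in_H h (unip 1 ** S)"
proof -
  have nc: False if "conjugate_in_H h (cycle_word ds)" "ds \<noteq> []" "\<forall>d\<in>set ds. d \<noteq> 0 \<and> d \<noteq> 1" for ds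
    using tr2_cycle_word[OF that(2,3)] tr2_conjugate[OF that(1)] assms(2) by auto
  obtain cs where "conjugate_in_H h (cycle_word cs) \<or> (\<exists>a. conjugate_in_H h (unip a))"
    using H_conj_cycle_word[OF assms(1)] by blast
  then show ?thesis
  proof
    assume c: "conjugate_in_H h (cycle_word cs)"
    show ?thesis using cycle_word_reduce[of cs] conjugate_in_H_trans[OF c] nc by (auto simp: unip_0)
  qed blast
qed

text \<open>Cayley-Hamilton with determinant 1 in characteristic 2 gives
  \<open>M^2 = \<tau> M + 1\<close> for the trace \<open>\<tau>\<close>, hence
  \<open>\<tau> M = 0\<close>. The proof reads this off the entries.\<close>

lemma trace_involution:
  assumes "M \<in> carrier GL2A" "M ** M = mat 1" shows "tr2 M = 0"
proof -
  obtain p q r t where M: "M = mat2 p q r t" by (rule mat2_cases)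
  then have det: "p * t + q * r = 1" using assms mat2_in_GL2A_iff by simp
  have e: "p * p + q * r = 1" "p * q + q * t = 0" "r * p + t * r = 0" "r * q + t * t = 1"
    using assms(2) by (simp_all add: M mat_1_eq_mat2)
  have "(p + t) * p = (p * p + q * r) + (p * t + q * r)" "(p + t) * q = p * q + q * t"
    by (simp_all add: algebra_simps)
  then have "(p + t) * p = 0" "(p + t) * q = 0" using det e by simp_all
  then show ?thesis using det M by (auto simp: add_eq_0_iff)
qed

text \<open>Cayley-Hamilton gives \<open>M^3 = (\<tau>^2 + 1) M + \<tau>\<close>, and
  \<open>\<tau>^2 + 1\<close> is the square of \<open>\<tau> + 1\<close>. So either
  \<open>\<tau> = 1\<close> or the off-diagonal entries vanish, and then the diagonal entries are
  units, hence 1.\<close>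

lemma trace_order_3:
  assumes "M \<in> carrier GL2A" "M ** (M ** M) = mat 1" shows "tr2 M \<in> {0, 1}"
proof -
  obtain p q r t where M: "M = mat2 p q r t" by (rule mat2_cases)
  then have det: "p * t + q * r = 1" using assms mat2_in_GL2A_iff by simp
  define \<tau> where "\<tau> = p + t"
  have t: "t = p + \<tau>" by (simp add: \<tau>_def)
  have e: "p * (p * p + q * r) + q * (r * p + t * r) = 1" "p * (p * q + q * t) + q * (r * q + t * t) = 0"
      "r * (p * p + q * r) + t * (r * p + t * r) = 0"
    using assms(2) by (simp_all add: M mat_1_eq_mat2)
  have "p * (p * q + q * t) + q * (r * q + t * t) = q * (\<tau> * \<tau> + (p * t + q * r))"
    by (simp add: t algebra_simps)
  then have q: "q * (\<tau> * \<tau> + 1) = 0" using e det by simp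
  have "r * (p * p + q * r) + t * (r * p + t * r) = r * (\<tau> * \<tau> + (p * t + q * r))"
    by (simp add: t algebra_simps)
  then have r: "r * (\<tau> * \<tau> + 1) = 0" using e det by simp
  have sq: "\<tau> * \<tau> + 1 = (\<tau> + 1) * (\<tau> + 1)" by (simp add: algebra_simps)
  show ?thesis
  proof (cases "\<tau> = 1")
    case False
    then have "q = 0" using q sq by (simp add: add_eq_0_iff)
    then have "p * t = 1" using det by simp
    then have "p = 1" "t = 1" using coord_ring_unit by (metis mult.commute)+
    then show ?thesis using M by simp
  qed (simp add: M \<tau>_def)
qed

section \<open>Automorphisms of \<open>H\<close>\<close>

text \<open>U(A) is thereby a centralizer, which is why automorphisms of \<open>H\<close> respect it
  up to conjugation.\<close>

lemma unip_commute:
  assumes "M \<in> carrier GL2A" "M ** unip a = unip a ** M" "a \<noteq> 0"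
  shows "M \<in> UA"
proof -
  obtain p q r t where M: "M = mat2 p q r t" by (rule mat2_cases)
  have det: "p * t + q * r = 1" using assms(1) M mat2_in_GL2A_iff by simp
  have e: "p = p + a * r" "p * a + q = q + a * t" using assms(2) by (simp_all add: M unip_eq_mat2)
  then have "a * r = 0" by (metis add_cancel_left_right)
  then have r: "r = 0" using assms(3) by simp
  have "a * p = a * t" using e(2) by (simp add: ac_simps)
  then have "p = t" using assms(3) by simp
  moreover have "p * t = 1" using det r by simp
  ultimately have "p = 1" "t = 1" using coord_ring_unit by blast+
  then have "M = unip q" using M r by (simp add: unip_eq_mat2)
  then show ?thesis by (simp add: UA_def)
qed

text \<open>The lower left entry vanishes, so the diagonal entries are units and thus 1. This
  compares the two conjugators in \<open>automorphism_of_H\<close>.\<close>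

lemma unip_conjugate_unip_1:
  assumes "M \<in> carrier GL2A" "M ** unip 1 = unip a ** M"
  shows "M \<in> UA \<and> a = 1"
proof -
  obtain p q r t where M: "M = mat2 p q r t" by (rule mat2_cases)
  have det: "p * t + q * r = 1" using assms(1) M mat2_in_GL2A_iff by simp
  have e: "p + q = q + a * t" "r + t = t" using assms(2) by (simp_all add: M unip_eq_mat2)
  then have r: "r = 0" by simp
  then have pt: "p * t = 1" using det by simp
  then have "p = 1" by (rule coord_ring_unit)
  with pt have t: "t = 1" by simp
  then have "a = 1" using e(1) \<open>p = 1\<close> by (simp add: add.commute)
  moreover have "M = unip q" using M r t \<open>p = 1\<close> by (simp add: unip_eq_mat2)
  ultimately show ?thesis by (simp add: UA_def)
qed

text \<open>Inverting an element of order 3 forces the norm form of \<open>norm_form_eq_1\<close> to equal 1.\<close>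
lemma inverting_order_3:
  assumes "z \<in> carrier GL2A" "z ** (unip 1 ** S) = (S ** unip 1) ** z"
  shows "z \<in> {unip 1, S, S ** unip 1 ** S}"
proof -
  obtain p q r t where z: "z = mat2 p q r t" by (rule mat2_cases)
  have det: "p * t + q * r = 1" using assms(1) z mat2_in_GL2A_iff by simp
  have "z ** (unip 1 ** S) = mat2 (p + q) p (r + t) r" by (simp add: z unip_eq_mat2 S_def)
  moreover have "(S ** unip 1) ** z = mat2 r t (p + r) (q + t)" by (simp add: z unip_eq_mat2 S_def)
  ultimately have "mat2 (p + q) p (r + t) r = mat2 r t (p + r) (q + t)" using assms(2) by (simp only:)
  then have e: "r = p + q" "t = p" unfolding mat2_eq_iff by metis+
  have "p * p + p * q + q * q = 1" using det e by (simp add: algebra_simps)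
  then have "p \<in> {0, 1} \<and> q \<in> {0, 1}" by (rule norm_form_eq_1)
  then show ?thesis using det e by (auto simp: z unip_eq_mat2 S_def)
qed

lemma conjugate_in_H_powers:
  assumes "conjugate_in_H h x"
  shows "conjugate_in_H (h ** h) (x ** x)" "conjugate_in_H (h ** (h ** h)) (x ** (x ** x))"
proof -
  obtain k where k: "k \<in> H_subgroup" "h ** k = k ** x" using assms by (auto simp: conjugate_in_H_def)
  have 2: "(h ** h) ** k = k ** (x ** x)" using k(2) by (metis matrix_mul_assoc)
  then have 3: "(h ** (h ** h)) ** k = k ** (x ** (x ** x))" using k(2) by (metis matrix_mul_assoc)
  show "conjugate_in_H (h ** h) (x ** x)" "conjugate_in_H (h ** (h ** h)) (x ** (x ** x))"
    unfolding conjugate_in_H_def using k(1) 2 3 by blast+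
qed

lemma conjugate_in_H_one_iff:
  assumes "conjugate_in_H h x"
  shows "h = mat 1 \<longleftrightarrow> x = mat 1"
proof -
  obtain k where k: "k \<in> H_subgroup" "h ** k = k ** x" using assms by (auto simp: conjugate_in_H_def)
  let ?i = "inv\<^bsub>GL2A\<^esub> k"
  have i: "k ** ?i = mat 1" "?i ** k = mat 1" using GL2A.r_inv GL2A.l_inv H_closed[OF k(1)] by auto
  have "h = h ** (k ** ?i)" by (simp add: i)
  also have "\<dots> = k ** x ** ?i" by (simp only: matrix_mul_assoc k(2))
  finally have h: "h = k ** x ** ?i" .
  have "x = ?i ** (k ** x)" by (simp add: matrix_mul_assoc i)
  then have x: "x = ?i ** (h ** k)" by (simp only: k(2))
  show ?thesis
  proof
    assume "h = mat 1" then show "x = mat 1" using x i by simp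
  next
    assume "x = mat 1" then show "h = mat 1" using h i by simp
  qed
qed

text \<open>Of the three classes left by the trace, \<open>S\<close> is conjugate to
  \<open>unip 1\<close> by the braid relation, and \<open>unip 1 ** S\<close> has order 3.\<close>

lemma H_involution:
  assumes "h \<in> H_subgroup" "h ** h = mat 1" "h \<noteq> mat 1"
  obtains k a where "k \<in> H_subgroup" "a \<noteq> 0" "h ** k = k ** unip a"
proof -
  have sq: "x ** x = mat 1 \<and> x \<noteq> mat 1" if "conjugate_in_H h x" for x
    using conjugate_in_H_one_iff[OF that] conjugate_in_H_one_iff[OF conjugate_in_H_powers(1)[OF that]] assms
    by blast
  have "tr2 h \<in> {0, 1}" using trace_involution H_closed assms by simp
  then consider a where "conjugate_in_H h (unip a)" | "conjugate_in_H h S" | "conjugate_in_H h (unip 1 ** S)"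
    using H_constant_trace assms(1) by blast
  then obtain a where a: "conjugate_in_H h (unip a)"
  proof cases
    case 2
    have "conjugate_in_H S (unip 1)"
      unfolding conjugate_in_H_def
      by (intro bexI[of _ "unip 1 ** S"]) (use braid in \<open>simp_all add: matrix_mul_assoc\<close>)
    then show ?thesis using that conjugate_in_H_trans 2 by blast
  next
    case 3
    then show ?thesis using sq by (force simp: unip_eq_mat2 S_def mat_1_eq_mat2)
  qed
  moreover have "a \<noteq> 0" using sq[OF a] by (auto simp: unip_0)
  ultimately show ?thesis using that by (auto simp: conjugate_in_H_def)
qed

lemma H_order_3:
  assumes "h \<in> H_subgroup" "h ** (h ** h) = mat 1" "h \<noteq> mat 1"
  shows "conjugate_in_H h (unip 1 ** S)"
proof -
  have cube: "x ** (x ** x) = mat 1 \<and> x \<noteq> mat 1" if "conjugate_in_H h x" for x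
    using conjugate_in_H_one_iff[OF that] conjugate_in_H_one_iff[OF conjugate_in_H_powers(2)[OF that]] assms
    by blast
  have "tr2 h \<in> {0, 1}" using trace_order_3 H_closed assms by simp
  then consider a where "conjugate_in_H h (unip a)" | "conjugate_in_H h S" | "conjugate_in_H h (unip 1 ** S)"
    using H_constant_trace assms(1) by blast
  then show ?thesis
  proof cases
    case 1
    then show ?thesis using cube by fastforce
  next
    case 2
    then show ?thesis using cube[of S] by (simp add: S_def mat_1_eq_mat2)
  qed
qed

text \<open>The conjugator \<open>k\<close> straightens \<open>f (unip 1)\<close> and with it the
  image of U(A), its centralizer; \<open>l\<close> straightens the image of
  \<open>t = unip 1 ** S\<close>, of order 3. Seen through \<open>l\<close>, the image of
  \<open>unip 1\<close> is an involution \<open>z\<close> inverting \<open>t\<close>, hence one of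
  the three involutions of GL_2(F_2), and a suitable \<open>\<sigma>\<close> commuting with
  \<open>t\<close> turns \<open>z\<close> into \<open>unip 1\<close>. So
  \<open>h = l ** \<sigma>\<close> is right for \<open>unip 1\<close> and \<open>S\<close>. Finally
  \<open>h\<close> differs from \<open>k\<close> by an element of U(A), which is abelian, so
  \<open>h\<close> is right for U(A) as well.\<close>

lemma automorphism_of_H:
  assumes cl: "\<And>h. h \<in> H_subgroup \<Longrightarrow> f h \<in> H_subgroup"
    and mult: "\<And>g h. \<lbrakk>g \<in> H_subgroup; h \<in> H_subgroup\<rbrakk> \<Longrightarrow> f (g ** h) = f g ** f h"
    and bij: "bij_betw f H_subgroup H_subgroup"
  obtains h where "h \<in> H_subgroup" "f S ** h = h ** S" "f (unip 1) ** h = h ** unip 1"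
    "\<And>a. \<exists>b. f (unip a) ** h = h ** unip b" "\<And>b. \<exists>a. f (unip a) ** h = h ** unip b"
proof -
  have inj: "g = h" if "f g = f h" "g \<in> H_subgroup" "h \<in> H_subgroup" for g h
    using bij that by (auto simp: bij_betw_def inj_on_def)
  have f1: "f (mat 1) = mat 1"
  proof -
    have "f (mat 1) ** f (mat 1) = f (mat 1)" using mult[of "mat 1" "mat 1"] by simp
    then show ?thesis using GL2A.r_cancel_one[of "f (mat 1)" "f (mat 1)"] H_closed cl by simp
  qed
  have ne: "f h \<noteq> mat 1" if "h \<in> H_subgroup" "h \<noteq> mat 1" for h
    using inj[of h "mat 1"] that f1 by auto
  have b: "f (unip 1) ** f (unip 1) = mat 1" using mult[of "unip 1" "unip 1"] f1 by (simp add: unip_0)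
  have "unip 1 \<noteq> mat 1" using unip_inject[of 1 0] unfolding unip_0 by simp
  then obtain k a where k: "k \<in> H_subgroup" "a \<noteq> 0" "f (unip 1) ** k = k ** unip a"
    using H_involution[OF cl[OF unip_in_H] b] ne[OF unip_in_H] by blast
  let ?k' = "inv\<^bsub>GL2A\<^esub> k"
  have ki: "k ** ?k' = mat 1" "?k' ** k = mat 1" using GL2A.r_inv GL2A.l_inv H_closed[OF k(1)] by auto
  have kc: "k ** (?k' ** M) = M" "?k' ** (k ** M) = M" for M using ki by (simp_all add: matrix_mul_assoc)
  have fU: "\<exists>d. f (unip c) ** k = k ** unip d" for c
  proof -
    let ?M = "?k' ** f (unip c) ** k"
    have "f (unip c) ** f (unip 1) = f (unip 1) ** f (unip c)"
      unfolding mult[OF unip_in_H unip_in_H, symmetric] by (simp add: add.commute)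
    then have "?k' ** ((f (unip c) ** f (unip 1)) ** k) = ?k' ** ((f (unip 1) ** f (unip c)) ** k)" by simp
    moreover have "?k' ** ((f (unip c) ** f (unip 1)) ** k) = ?M ** unip a"
      using k(3) by (metis matrix_mul_assoc)
    moreover have "?k' ** ((f (unip 1) ** f (unip c)) ** k) = unip a ** ?M"
    proof -
      have "?k' ** ((f (unip 1) ** f (unip c)) ** k) = ?k' ** (f (unip 1) ** k ** ?M)"
        by (simp add: kc flip: matrix_mul_assoc)
      then show ?thesis using k(3) by (simp add: kc flip: matrix_mul_assoc)
    qed
    ultimately have "?M ** unip a = unip a ** ?M" by simp
    moreover have "?M \<in> carrier GL2A" using H_closed cl k(1) by simp
    ultimately have "?M \<in> UA" using unip_commute k(2) by blast
    then obtain d where "?M = unip d" by (auto simp: UA_def)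
    then have "k ** ?M = k ** unip d" by simp
    then show ?thesis by (auto simp: kc simp flip: matrix_mul_assoc)
  qed
  have Uf: "\<exists>c. f (unip c) ** k = k ** unip d" for d
  proof -
    have "k ** unip d ** ?k' \<in> H_subgroup" using k(1) by simp
    then obtain h where h: "h \<in> H_subgroup" "f h = k ** unip d ** ?k'"
      using bij unfolding bij_betw_def by (metis imageE)
    have b': "f (unip 1) = k ** unip a ** ?k'" using k(3) ki by (metis matrix_mul_assoc matrix_mul_rid)
    have "f (h ** unip 1) = f (unip 1 ** h)"
      using h mult[OF h(1) unip_in_H] mult[OF unip_in_H h(1)] b'
      by (simp add: kc add.commute flip: matrix_mul_assoc)
    then have "h ** unip 1 = unip 1 ** h" using inj h by simp
    then have "h \<in> UA" using unip_commute H_closed h by simp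
    then obtain c where "h = unip c" by (auto simp: UA_def)
    then show ?thesis using h ki by (metis matrix_mul_assoc matrix_mul_rid)
  qed
  define t where "t = unip 1 ** S"
  have t: "t \<in> H_subgroup" "t ** (t ** t) = mat 1" "t \<noteq> mat 1"
    by (simp_all add: t_def) (simp_all add: unip_eq_mat2 S_def mat_1_eq_mat2)
  have "f t ** (f t ** f t) = mat 1"
    using t f1 mult[OF t(1) H_mult[OF t(1) t(1)]] mult[OF t(1) t(1)] by simp
  then have "conjugate_in_H (f t) t"
    using H_order_3[OF cl[OF t(1)] _ ne[OF t(1,3)]] by (simp only: t_def)
  then obtain l where l: "l \<in> H_subgroup" "f t ** l = l ** t" by (auto simp: conjugate_in_H_def)
  let ?l' = "inv\<^bsub>GL2A\<^esub> l"
  have li: "l ** ?l' = mat 1" "?l' ** l = mat 1" using GL2A.r_inv GL2A.l_inv H_closed[OF l(1)] by auto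
  have lc: "l ** (?l' ** M) = M" "?l' ** (l ** M) = M" for M using li by (simp_all add: matrix_mul_assoc)
  define z where "z = ?l' ** f (unip 1) ** l"
  have zH: "z \<in> H_subgroup" using l cl by (simp add: z_def)
  have lz: "f (unip 1) ** l = l ** z" by (simp add: z_def lc flip: matrix_mul_assoc)
  have tt: "(S ** unip 1) ** t = mat 1" "t ** (S ** unip 1) = mat 1" "unip 1 ** t = (S ** unip 1) ** unip 1"
    by (simp_all add: t_def unip_0 flip: matrix_mul_assoc)
  have "f (S ** unip 1) ** l = l ** (S ** unip 1)"
  proof -
    have "f (S ** unip 1) ** l = f (S ** unip 1) ** l ** (t ** (S ** unip 1))" using tt by simp
    also have "\<dots> = f (S ** unip 1) ** (f t ** l) ** (S ** unip 1)" using l(2) by (simp only: matrix_mul_assoc)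
    also have "f (S ** unip 1) ** (f t ** l) = f ((S ** unip 1) ** t) ** l"
      using mult[of "S ** unip 1" t] t by (simp only: matrix_mul_assoc) simp
    finally show ?thesis using tt f1 by simp
  qed
  moreover have "f (unip 1) ** f t = f (S ** unip 1) ** f (unip 1)"
    using mult[OF unip_in_H t(1), of 1] mult[OF H_mult[OF S_in_H unip_in_H] unip_in_H, of 1 1] tt(3) by metis
  ultimately have "l ** (z ** t) = l ** ((S ** unip 1) ** z)"
    using lz l(2) by (metis matrix_mul_assoc)
  then have "z ** t = (S ** unip 1) ** z" using lc by metis
  then have z: "z \<in> {unip 1, S, S ** unip 1 ** S}"
    using inverting_order_3[of z] H_closed[OF zH] unfolding t_def by simp
  \<comment> \<open>\<open>t\<close> and its inverse \<open>S ** unip 1\<close> commute with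
    \<open>t\<close> and permute the three involutions of GL_2(F_2) cyclically.\<close>
  have "\<exists>\<sigma>\<in>H_subgroup. z ** \<sigma> = \<sigma> ** unip 1 \<and> t ** \<sigma> = \<sigma> ** t"
  proof -
    consider "z = unip 1" | "z = S" | "z = S ** unip 1 ** S" using z by blast
    then show ?thesis
    proof cases
      case 1
      then show ?thesis by (intro bexI[of _ "mat 1"]) simp_all
    next
      case 2
      then show ?thesis
        by (intro bexI[of _ "unip 1 ** S"]) (simp_all add: t_def, simp_all add: S_def unip_eq_mat2)
    next
      case 3
      then show ?thesis
        by (intro bexI[of _ "S ** unip 1"]) (simp_all add: t_def, simp_all add: S_def unip_eq_mat2)
    qed
  qed
  then obtain \<sigma> where \<sigma>: "\<sigma> \<in> H_subgroup" "z ** \<sigma> = \<sigma> ** unip 1" "t ** \<sigma> = \<sigma> ** t" by blast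
  define h where "h = l ** \<sigma>"
  have h: "h \<in> H_subgroup" using l \<sigma> by (simp add: h_def)
  have h1: "f (unip 1) ** h = h ** unip 1"
    using lz \<sigma>(2) unfolding h_def by (metis matrix_mul_assoc)
  have ht: "f t ** h = h ** t"
    using l(2) \<sigma>(3) unfolding h_def by (metis matrix_mul_assoc)
  have "S = unip 1 ** t" by (simp add: t_def unip_0)
  then have hS: "f S ** h = h ** S"
    using h1 ht mult[OF unip_in_H[of 1] t(1)] by (metis matrix_mul_assoc)
  \<comment> \<open>Both \<open>k\<close> and \<open>h\<close> bring \<open>f (unip 1)\<close> into
    U(A), so \<open>?k' ** h\<close> conjugates \<open>unip 1\<close> into U(A) and therefore
    belongs to it.\<close>
  have "(?k' ** h) ** unip 1 = unip a ** (?k' ** h)"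
  proof -
    have "(?k' ** h) ** unip 1 = ?k' ** (f (unip 1) ** (k ** (?k' ** h)))"
      using h1 by (simp add: kc flip: matrix_mul_assoc)
    also have "\<dots> = ?k' ** ((k ** unip a) ** (?k' ** h))" using k(3) by (simp add: matrix_mul_assoc)
    also have "\<dots> = unip a ** (?k' ** h)" by (simp add: kc flip: matrix_mul_assoc)
    finally show ?thesis .
  qed
  then have "?k' ** h \<in> UA" using unip_conjugate_unip_1[of "?k' ** h"] H_closed h k(1) by simp
  then obtain e where "?k' ** h = unip e" by (auto simp: UA_def)
  then have he: "h = k ** unip e" using kc by metis
  have tr: "f (unip a) ** h = h ** unip b \<longleftrightarrow> f (unip a) ** k = k ** unip b" for a b
  proof
    assume "f (unip a) ** k = k ** unip b"
    then have "f (unip a) ** h = k ** unip b ** unip e" unfolding he by (simp only: matrix_mul_assoc)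
    then show "f (unip a) ** h = h ** unip b" unfolding he by (simp add: add.commute flip: matrix_mul_assoc)
  next
    assume "f (unip a) ** h = h ** unip b"
    then have "f (unip a) ** h ** unip e = h ** unip b ** unip e" by simp
    then show "f (unip a) ** k = k ** unip b"
      unfolding he by (simp add: unip_0 add.commute add.left_commute flip: matrix_mul_assoc)
  qed
  show ?thesis using that[OF h hS h1] fU Uf tr by blast
qed

section \<open>Images of the free factors\<close>

definition cj :: "coord_ring^2^2 \<Rightarrow> coord_ring^2^2 \<Rightarrow> coord_ring^2^2" where
  "cj k x = k ** x ** inv\<^bsub>GL2A\<^esub> k"

lemma cj_closed [simp]: "\<lbrakk>k \<in> carrier GL2A; x \<in> carrier GL2A\<rbrakk> \<Longrightarrow> cj k x \<in> carrier GL2A"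
  by (simp add: cj_def)

lemma cj_mult:
  "\<lbrakk>k \<in> carrier GL2A; x \<in> carrier GL2A; y \<in> carrier GL2A\<rbrakk> \<Longrightarrow> cj k (x ** y) = cj k x ** cj k y"
  unfolding cj_def by (rule GL2A.conj_mult)

lemma cj_cj:
  "\<lbrakk>g \<in> carrier GL2A; k \<in> carrier GL2A; x \<in> carrier GL2A\<rbrakk> \<Longrightarrow> cj g (cj k x) = cj (g ** k) x"
  unfolding cj_def by (rule GL2A.conj_conj)

lemma cj_one_left [simp]: "x \<in> carrier GL2A \<Longrightarrow> cj (mat 1) x = x"
  using GL2A.inv_one by (simp add: cj_def)

lemma cj_one_right [simp]: "k \<in> carrier GL2A \<Longrightarrow> cj k (mat 1) = mat 1"
  by (simp add: cj_def)

lemma cj_inv_cancel [simp]: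
  "\<lbrakk>k \<in> carrier GL2A; x \<in> carrier GL2A\<rbrakk> \<Longrightarrow> cj (inv\<^bsub>GL2A\<^esub> k) (cj k x) = x"
  "\<lbrakk>k \<in> carrier GL2A; x \<in> carrier GL2A\<rbrakk> \<Longrightarrow> cj k (cj (inv\<^bsub>GL2A\<^esub> k) x) = x"
  by (simp_all add: cj_cj)

lemma cj_eq_iff: "\<lbrakk>k \<in> carrier GL2A; x \<in> carrier GL2A; y \<in> carrier GL2A\<rbrakk> \<Longrightarrow> cj k x = cj k y \<longleftrightarrow> x = y"
  using cj_inv_cancel(1) by metis

lemma cj_eq_one_iff: "\<lbrakk>k \<in> carrier GL2A; x \<in> carrier GL2A\<rbrakk> \<Longrightarrow> cj k x = mat 1 \<longleftrightarrow> x = mat 1"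
  using cj_eq_iff[of k x "mat 1"] by simp

lemma cj_of_commute:
  "\<lbrakk>k \<in> carrier GL2A; x \<in> carrier GL2A; y \<in> carrier GL2A; y ** k = k ** x\<rbrakk> \<Longrightarrow> y = cj k x"
  unfolding cj_def by (simp add: GL2A.m_assoc flip: matrix_mul_assoc) (metis GL2A.r_inv matrix_mul_assoc matrix_mul_rid)

context
  fixes f assumes f: "f \<in> auto GL2A"
begin

lemma auto_hom: "f \<in> hom GL2A GL2A" and auto_bij: "bij_betw f (carrier GL2A) (carrier GL2A)"
  using f by (auto simp: auto_def Bij_def)

lemma auto_closed [simp]: "x \<in> carrier GL2A \<Longrightarrow> f x \<in> carrier GL2A"
  using auto_hom by (simp add: hom_in_carrier)

lemma auto_mult: "\<lbrakk>x \<in> carrier GL2A; y \<in> carrier GL2A\<rbrakk> \<Longrightarrow> f (x ** y) = f x ** f y"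
  using hom_mult[OF auto_hom] by (simp add: GL2A_simps)

lemma auto_one: "f (mat 1) = mat 1"
  using hom_one[OF auto_hom group_GL2A group_GL2A] by (simp add: GL2A_simps)

lemma auto_inv: "x \<in> carrier GL2A \<Longrightarrow> f (inv\<^bsub>GL2A\<^esub> x) = inv\<^bsub>GL2A\<^esub> (f x)"
  using group_hom.hom_inv[of GL2A GL2A f x] auto_hom group_GL2A
  by (simp add: group_hom_def group_hom_axioms_def)

lemma auto_eq_iff: "\<lbrakk>x \<in> carrier GL2A; y \<in> carrier GL2A\<rbrakk> \<Longrightarrow> f x = f y \<longleftrightarrow> x = y"
  using auto_bij by (auto simp: bij_betw_def inj_on_def)

lemma auto_eq_one_iff: "x \<in> carrier GL2A \<Longrightarrow> f x = mat 1 \<longleftrightarrow> x = mat 1"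
  using auto_eq_iff[of x "mat 1"] by (simp add: auto_one)

lemma auto_surj: "y \<in> carrier GL2A \<Longrightarrow> \<exists>x\<in>carrier GL2A. f x = y"
  using auto_bij unfolding bij_betw_def by (metis imageE)

lemma auto_cj: "\<lbrakk>k \<in> carrier GL2A; x \<in> carrier GL2A\<rbrakk> \<Longrightarrow> f (cj k x) = cj (f k) (f x)"
  by (simp add: cj_def auto_mult auto_inv)

end

interpretation A: group "AutoGroup GL2A"
  by (rule GL2A.AutoGroup)

lemma AutoGroup_apply:
  "\<lbrakk>f \<in> auto GL2A; g \<in> auto GL2A; x \<in> carrier GL2A\<rbrakk> \<Longrightarrow> (f \<otimes>\<^bsub>AutoGroup GL2A\<^esub> g) x = f (g x)"
  by (simp add: AutoGroup_mult compose_def)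

lemma AutoGroup_closed: "\<lbrakk>f \<in> auto GL2A; g \<in> auto GL2A\<rbrakk> \<Longrightarrow> f \<otimes>\<^bsub>AutoGroup GL2A\<^esub> g \<in> auto GL2A"
  using A.m_closed[of f g] by simp

lemma AutoGroup_inv_apply:
  assumes "f \<in> auto GL2A" "x \<in> carrier GL2A"
  shows "f ((inv\<^bsub>AutoGroup GL2A\<^esub> f) x) = x"
proof -
  have "inv\<^bsub>AutoGroup GL2A\<^esub> f \<in> auto GL2A" using A.inv_closed[of f] assms by simp
  then have "f ((inv\<^bsub>AutoGroup GL2A\<^esub> f) x) = (f \<otimes>\<^bsub>AutoGroup GL2A\<^esub> inv\<^bsub>AutoGroup GL2A\<^esub> f) x"
    by (rule AutoGroup_apply[OF assms(1) _ assms(2), symmetric])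
  also have "\<dots> = x" using A.r_inv[of f] assms by (simp add: AutoGroup_one)
  finally show ?thesis .
qed

lemma inner_auto:
  assumes "g \<in> carrier GL2A"
  shows "(\<lambda>x\<in>carrier GL2A. cj g x) \<in> auto GL2A"
proof -
  have "(\<lambda>x\<in>carrier GL2A. cj g x) \<in> hom GL2A GL2A"
    using assms by (auto simp: hom_def GL2A_simps(1,2) cj_mult)
  moreover have "bij_betw (\<lambda>x\<in>carrier GL2A. cj g x) (carrier GL2A) (carrier GL2A)"
    using assms by (intro bij_betw_byWitness[where f' = "cj (inv\<^bsub>GL2A\<^esub> g)"]) auto
  ultimately show ?thesis by (auto simp: auto_def Bij_def)
qed

lemma GL2A_pow:
  assumes "M \<in> carrier GL2A"
  shows "M [^]\<^bsub>GL2A\<^esub> (2::nat) = M ** M" "M [^]\<^bsub>GL2A\<^esub> (3::nat) = M ** (M ** M)"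
  using assms by (simp_all add: numeral_2_eq_2 numeral_3_eq_3 GL2A_simps(1,2) matrix_mul_assoc)

lemma order_3_cyc:
  assumes "M \<in> carrier GL2A" "group.ord GL2A M = 3"
  shows "cyc M = {mat 1, M, M ** M}" "M ** (M ** M) = mat 1" "M \<noteq> mat 1"
proof -
  have "M [^]\<^bsub>GL2A\<^esub> (3::nat) = mat 1" using GL2A.pow_ord_eq_1[OF assms(1)] assms(2) by simp
  then show 3: "M ** (M ** M) = mat 1"
    by (simp only: GL2A_pow[OF assms(1)])
  show "M \<noteq> mat 1" using GL2A.ord_eq_1[OF assms(1)] assms(2) by auto
  have inv: "inv\<^bsub>GL2A\<^esub> M = M ** M"
    using assms(1) 3 by (intro GL2A.inv_equality) (simp_all add: GL2A.m_assoc)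
  have M4: "M ** M ** (M ** M) = M" using 3 by (metis matrix_mul_assoc matrix_mul_rid)
  have M3: "M ** M ** M = mat 1" using 3 by (simp add: matrix_mul_assoc)
  show "cyc M = {mat 1, M, M ** M}"
  proof
    show "cyc M \<subseteq> {mat 1, M, M ** M}"
    proof
      fix x assume "x \<in> cyc M"
      then show "x \<in> {mat 1, M, M ** M}"
      proof (induction x rule: generate.induct)
        case (eng x y)
        then show ?case using 3 M4 M3 by (auto simp: GL2A_simps(1))
      qed (simp_all add: inv GL2A_simps(2))
    qed
    have "M \<in> cyc M" by (rule generate.incl) simp
    then have "M ** M \<in> cyc M" using generate.eng[of M GL2A "{M}" M] by (simp add: GL2A_simps(1))
    then show "{mat 1, M, M ** M} \<subseteq> cyc M"
      using \<open>M \<in> cyc M\<close> generate.one[of GL2A "{M}"] by (auto simp: GL2A_simps(2))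
  qed
qed

section \<open>Where an automorphism sends the three factors\<close>

locale spike_pair =
  fixes M0 M1 :: "coord_ring^2^2"
  assumes spike: "cyclic_spike_pair M0 M1"

sublocale spike_pair \<subseteq> internal_free_product GL2A "{..<3::nat}" "factor M0 M1"
  rewrites "mult GL2A = (**)" and "one GL2A = mat 1"
proof -
  show "internal_free_product GL2A {..<3::nat} (factor M0 M1)"
    using spike by unfold_locales (simp add: cyclic_spike_pair_def)
qed (simp_all add: GL2A_simps)

context spike_pair
begin

abbreviation X :: "nat \<Rightarrow> (coord_ring^2^2) set" where "X \<equiv> factor M0 M1"

abbreviation gens :: "(coord_ring^2^2 \<Rightarrow> coord_ring^2^2) set" where
  "gens \<equiv> inner_autos GL2A \<union> reiner_autos M0 M1 \<union> cyclic_spike_autos M0 M1"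

abbreviation Gen :: "(coord_ring^2^2 \<Rightarrow> coord_ring^2^2) set" where
  "Gen \<equiv> generate (AutoGroup GL2A) gens"

lemma X_0 [simp]: "X 0 = H_subgroup" and X_1 [simp]: "X (Suc 0) = cyc M0" and X_2 [simp]: "X 2 = cyc M1"
  by (simp_all add: factor_def numeral_2_eq_2)

lemma lessThan_3: "{..<3::nat} = {0, 1, 2}"
  by auto

lemma M_in [simp]: "M0 \<in> carrier GL2A" "M1 \<in> carrier GL2A" "M0 \<in> cyc M0" "M1 \<in> cyc M1"
  using spike by (auto simp: cyclic_spike_pair_def intro: generate.incl)

lemmas cyc_M0 = order_3_cyc[of M0] and cyc_M1 = order_3_cyc[of M1]

lemma cyc_element:
  assumes "i \<in> {1, 2}" "x \<in> X i" "x \<noteq> mat 1"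
  shows "X i = {mat 1, x, x ** x}" "x ** (x ** x) = mat 1"
proof -
  obtain M where M: "X i = {mat 1, M, M ** M}" "M ** (M ** M) = mat 1"
    using assms(1) cyc_M0 cyc_M1 spike by (auto simp: cyclic_spike_pair_def)
  then have M4: "M ** M ** (M ** M) = M" by (metis matrix_mul_assoc matrix_mul_rid)
  have M3: "M ** M ** M = mat 1" using M(2) by (simp only: matrix_mul_assoc)
  have "x = M \<or> x = M ** M" using M(1) assms(2,3) by blast
  then have "X i = {mat 1, x, x ** x} \<and> x ** (x ** x) = mat 1"
  proof
    assume "x = M ** M"
    then show ?thesis using M(1) M3 M4 by (simp add: insert_commute)
  qed (use M in simp)
  then show "X i = {mat 1, x, x ** x}" "x ** (x ** x) = mat 1" by blast+
qed

lemma malnormal: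
  assumes "i < 3" "j < 3" "x \<in> X i" "x \<noteq> mat 1" "g \<in> carrier GL2A" "cj g x \<in> X j"
  shows "i = j \<and> g \<in> X i"
  using factor_malnormal[of i j x g] assms unfolding cj_def lessThan_iff by blast

lemma torsion:
  assumes "g \<in> carrier GL2A" "g ** g = mat 1 \<or> g ** (g ** g) = mat 1" "g \<noteq> mat 1"
  obtains k i x where "k \<in> carrier GL2A" "i < 3" "x \<in> X i" "x \<noteq> mat 1" "x \<in> carrier GL2A" "g = cj k x"
proof -
  have "g [^]\<^bsub>GL2A\<^esub> (2::nat) = mat 1 \<or> g [^]\<^bsub>GL2A\<^esub> (3::nat) = mat 1"
    using assms by (auto simp: GL2A_pow)
  then obtain n :: nat where "g [^]\<^bsub>GL2A\<^esub> n = mat 1" "n > 0"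
    using zero_less_numeral by metis
  then obtain k i x where "k \<in> carrier GL2A" "i < 3" "x \<in> X i" "g = cj k x"
    using torsion_conj_factor[of g n] assms by (auto simp: cj_def)
  moreover from this have "x \<in> carrier GL2A" using factor_carrier by simp
  moreover from calculation have "x \<noteq> mat 1" using assms(3) by auto
  ultimately show ?thesis using that by blast
qed

text \<open>The involution \<open>f (unip 1)\<close> lies in a conjugate of \<open>H\<close>, as the
  cyclic factors have no elements of order 2. Since it inverts \<open>f t\<close>, malnormality
  places it in the conjugate factor containing \<open>f t\<close> as well, so the two conjugates
  agree. The elements \<open>f (unip a)\<close> commute with it and follow by malnormality, and
  \<open>S = unip 1 ** t\<close>.\<close>

lemma auto_H_subset:
  assumes f: "f \<in> auto GL2A"
  obtains k where "k \<in> carrier GL2A" "\<And>h. h \<in> H_subgroup \<Longrightarrow> cj (inv\<^bsub>GL2A\<^esub> k) (f h) \<in> H_subgroup"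
proof -
  note fs = auto_closed[OF f] auto_one[OF f] auto_eq_one_iff[OF f] and fm = auto_mult[OF f]
  define t where "t = unip 1 ** S"
  have t: "t \<in> carrier GL2A" "t ** (t ** t) = mat 1" "t \<noteq> mat 1"
    by (simp_all add: t_def) (simp_all add: unip_eq_mat2 S_def mat_1_eq_mat2)
  let ?b = "unip 1"
  have b: "?b \<noteq> mat 1" by (simp add: unip_eq_mat2 mat_1_eq_mat2)
  have fb: "f ?b ** f ?b = mat 1"
    by (simp only: fm[symmetric] unip_closed unip_mult coord_ring_add_self unip_0 fs(2))
  have fb1: "f ?b \<noteq> mat 1" using fs(3)[of ?b] b by simp
  obtain k i x where k: "k \<in> carrier GL2A" "i < 3" "x \<in> X i" "x \<noteq> mat 1" "x \<in> carrier GL2A" "f ?b = cj k x"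
    using torsion[OF fs(1)[OF unip_closed] disjI1[OF fb] fb1] by blast
  have "cj k (x ** x) = mat 1" using k fb by (simp add: cj_mult)
  then have xx: "x ** x = mat 1" using k by (simp add: cj_eq_one_iff)
  have "f t ** (f t ** f t) = f (t ** (t ** t))" using t(1) by (simp add: fm)
  then have ft: "f t ** (f t ** f t) = mat 1" "f t \<noteq> mat 1" using t fs by simp_all
  obtain l j w where l: "l \<in> carrier GL2A" "j < 3" "w \<in> X j" "w \<noteq> mat 1" "w \<in> carrier GL2A" "f t = cj l w"
    using torsion[OF fs(1)[OF t(1)] disjI2[OF ft(1)] ft(2)] by blast
  have i: "i = 0"
  proof (rule ccontr)
    assume "i \<noteq> 0"
    then have "i \<in> {1, 2}" using k(2) by auto
    then have "x ** (x ** x) = mat 1" using cyc_element(2) k(3,4) by blast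
    then show False using xx k by simp
  qed
  \<comment> \<open>\<open>?g\<close> compares the conjugators found for \<open>f (unip 1)\<close>
    and \<open>f t\<close>. It turns out to lie in \<open>H\<close>, so \<open>f t\<close> also lies
    in the conjugate of \<open>H\<close> by \<open>k\<close>.\<close>
  let ?g = "inv\<^bsub>GL2A\<^esub> l ** k"
  have bt: "cj ?b t = S ** unip 1" "t ** (S ** unip 1) = mat 1"
    by (simp_all add: cj_def t_def unip_0 flip: matrix_mul_assoc)
  have "f t ** f (S ** unip 1) = f (t ** (S ** unip 1))" using t(1) by (simp add: fm)
  then have "f t ** f (S ** unip 1) = mat 1" by (simp only: bt(2) fs(2))
  then have "f (S ** unip 1) = inv\<^bsub>GL2A\<^esub> (f t)"
    using t(1) fs(1) GL2A.inv_equality[of "f (S ** unip 1)" "f t"] GL2A.inv_comm[of "f t" "f (S ** unip 1)"]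
    by simp
  then have "cj (f ?b) (f t) = inv\<^bsub>GL2A\<^esub> (f t)"
    using auto_cj[OF f, of ?b t] bt t by simp
  moreover have "inv\<^bsub>GL2A\<^esub> (cj l w) = cj l (inv\<^bsub>GL2A\<^esub> w)"
    using l by (simp add: cj_def GL2A.inv_mult_group GL2A.m_assoc)
  ultimately have "cj (inv\<^bsub>GL2A\<^esub> l) (cj (f ?b) (cj l w)) = inv\<^bsub>GL2A\<^esub> w"
    using l by simp
  then have "cj (cj (inv\<^bsub>GL2A\<^esub> l) (f ?b)) w = inv\<^bsub>GL2A\<^esub> w"
    using l fs by (simp add: cj_cj GL2A.m_assoc) (simp add: cj_def GL2A.m_assoc)
  moreover have "inv\<^bsub>GL2A\<^esub> w \<in> X j" using factor_inv l by simp
  ultimately have "cj (cj (inv\<^bsub>GL2A\<^esub> l) (f ?b)) w \<in> X j" by (simp only:)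
  moreover have "cj (inv\<^bsub>GL2A\<^esub> l) (f ?b) \<in> carrier GL2A" using l(1) fs(1) by simp
  ultimately have "cj (inv\<^bsub>GL2A\<^esub> l) (f ?b) \<in> X j"
    using malnormal[OF l(2,2,3,4)] by blast
  then have "cj ?g x \<in> X j" using k(1,5,6) l(1) by (simp add: cj_cj)
  then have g: "0 = j \<and> ?g \<in> H_subgroup"
    using malnormal[of i j x ?g] k l i by simp
  have step: "cj (inv\<^bsub>GL2A\<^esub> k) (f t) \<in> H_subgroup"
  proof -
    have "cj (inv\<^bsub>GL2A\<^esub> k) (f t) = cj (inv\<^bsub>GL2A\<^esub> ?g) w"
      using k l by (simp add: cj_cj GL2A.inv_mult_group)
    then show ?thesis using g l unfolding cj_def by simp
  qed
  have un: "cj (inv\<^bsub>GL2A\<^esub> k) (f (unip a)) \<in> H_subgroup" for a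
  proof -
    let ?y = "cj (inv\<^bsub>GL2A\<^esub> k) (f (unip a))"
    have y: "?y \<in> carrier GL2A" using k fs by simp
    have "f (unip a) ** f ?b = f ?b ** f (unip a)"
      unfolding fm[OF unip_closed unip_closed, symmetric] by (simp add: add.commute)
    then have "cj (inv\<^bsub>GL2A\<^esub> k) (f (unip a) ** f ?b) = cj (inv\<^bsub>GL2A\<^esub> k) (f ?b ** f (unip a))" by simp
    moreover have "cj (inv\<^bsub>GL2A\<^esub> k) (f ?b) = x" using k by simp
    ultimately have "?y ** x = x ** ?y" using k fs by (simp add: cj_mult del: cj_inv_cancel)
    then have "cj ?y x = x" using cj_of_commute[of ?y x x] y k by simp
    then show ?thesis using malnormal[of 0 0 x ?y] k i y by simp
  qed
  have tS: "S = unip 1 ** t" by (simp add: t_def unip_0)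
  have sS: "cj (inv\<^bsub>GL2A\<^esub> k) (f S) \<in> H_subgroup"
    unfolding tS using un[of 1] step k(1) fs(1) t(1) by (simp add: fm cj_mult)
  have "cj (inv\<^bsub>GL2A\<^esub> k) (f h) \<in> H_subgroup" if "h \<in> H_subgroup" for h
    using that
  proof (induction rule: H_induct)
    case one
    then show ?case using k(1) by (simp add: fs(2))
  next
    case (unip a h)
    then show ?case using un[of a] k(1) fs(1) H_closed by (simp add: fm cj_mult)
  next
    case (S h)
    then show ?case using sS k(1) fs(1) H_closed by (simp add: fm cj_mult)
  qed
  then show ?thesis using that k by blast
qed

text \<open>The inclusion for the inverse of \<open>f\<close> gives the reverse inclusion up to a
  conjugator \<open>m\<close>. Since \<open>S\<close> lies in \<open>H\<close> and in its conjugate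
  by \<open>m\<close>, malnormality puts \<open>m\<close> into \<open>H\<close>.\<close>

lemma auto_H:
  assumes f: "f \<in> auto GL2A"
  obtains k where "k \<in> carrier GL2A" "f ` H_subgroup = cj k ` H_subgroup"
proof -
  let ?g = "inv\<^bsub>AutoGroup GL2A\<^esub> f"
  have g: "?g \<in> auto GL2A" using A.inv_closed[of f] f by simp
  note fg = AutoGroup_inv_apply[OF f]
  obtain k where k: "k \<in> carrier GL2A" "\<And>h. h \<in> H_subgroup \<Longrightarrow> cj (inv\<^bsub>GL2A\<^esub> k) (f h) \<in> H_subgroup"
    using auto_H_subset[OF f] by blast
  obtain l where l: "l \<in> carrier GL2A" "\<And>h. h \<in> H_subgroup \<Longrightarrow> cj (inv\<^bsub>GL2A\<^esub> l) (?g h) \<in> H_subgroup"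
    using auto_H_subset[OF g] by blast
  define m where "m = ?g k ** l"
  have m: "m \<in> carrier GL2A" using auto_closed[OF g] k l by (simp add: m_def)
  have gk: "?g (cj k h) = cj m (cj (inv\<^bsub>GL2A\<^esub> l) (?g h))" if "h \<in> H_subgroup" for h
    using that k l auto_closed[OF g] auto_cj[OF g] H_closed
    by (simp add: m_def flip: cj_cj)
  have gf: "?g (f x) = x" if "x \<in> carrier GL2A" for x
    using fg[of "f x"] auto_eq_iff[OF f] auto_closed[OF f] auto_closed[OF g] that by simp
  have "m \<in> H_subgroup"
  proof -
    let ?s = "cj (inv\<^bsub>GL2A\<^esub> k) (f S)"
    have s: "?s \<in> H_subgroup" "cj k ?s = f S" using k auto_closed[OF f] by simp_all
    then have eq: "cj m (cj (inv\<^bsub>GL2A\<^esub> l) (?g ?s)) = S" using gk[of ?s] gf by simp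
    have r: "cj (inv\<^bsub>GL2A\<^esub> l) (?g ?s) \<in> H_subgroup" using l s by simp
    moreover have "S \<noteq> mat 1" by (simp add: S_def mat_1_eq_mat2)
    ultimately have "cj (inv\<^bsub>GL2A\<^esub> l) (?g ?s) \<noteq> mat 1" using eq m by auto
    then show ?thesis using malnormal[of 0 0 "cj (inv\<^bsub>GL2A\<^esub> l) (?g ?s)" m] r eq m by simp
  qed
  have "cj k h \<in> f ` H_subgroup" if h: "h \<in> H_subgroup" for h
  proof -
    have "?g (cj k h) \<in> H_subgroup" using gk[OF h] l(2)[OF h] \<open>m \<in> H_subgroup\<close> by (simp add: cj_def)
    moreover have "f (?g (cj k h)) = cj k h" using fg k h H_closed by simp
    ultimately show ?thesis by (metis imageI)
  qed
  moreover have "f h \<in> cj k ` H_subgroup" if "h \<in> H_subgroup" for h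
    using k(2)[OF that] k(1) auto_closed[OF f] H_closed[OF that] by (metis cj_inv_cancel(2) imageI)
  ultimately have "f ` H_subgroup = cj k ` H_subgroup" by blast
  then show ?thesis using that k(1) by blast
qed

text \<open>The generator \<open>M\<close> goes to an element of order 3, conjugate into some
  factor. If that factor were \<open>H\<close>, then, as \<open>f\<close> maps \<open>H\<close> onto
  a conjugate of \<open>H\<close>, pulling back would make \<open>M\<close> conjugate to an element
  of \<open>H\<close>.\<close>

lemma auto_cyc:
  assumes f: "f \<in> auto GL2A" and i: "i \<in> {1, 2}"
  obtains k j where "k \<in> carrier GL2A" "j \<in> {1, 2}" "f ` X i = cj k ` X j"
proof -
  note fs = auto_closed[OF f] auto_one[OF f] auto_eq_one_iff[OF f] and fm = auto_mult[OF f]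
  define M where "M = (if i = 1 then M0 else M1)"
  have M: "M \<in> X i" "M \<noteq> mat 1" "M \<in> carrier GL2A"
    using i cyc_M0 cyc_M1 spike by (auto simp: M_def cyclic_spike_pair_def)
  note c = cyc_element[OF i M(1,2)]
  have "f M ** (f M ** f M) = f (M ** (M ** M))" using M(3) by (simp add: fm)
  then have "f M ** (f M ** f M) = mat 1" "f M \<noteq> mat 1" using M c(2) fs by simp_all
  then obtain k j x where k: "k \<in> carrier GL2A" "j < 3" "x \<in> X j" "x \<noteq> mat 1" "x \<in> carrier GL2A" "f M = cj k x"
    using torsion[OF fs(1)[OF M(3)]] by blast
  have "j \<noteq> 0"
  proof
    assume "j = 0"
    then have x: "x \<in> H_subgroup" using k by simp
    obtain k0 where k0: "k0 \<in> carrier GL2A" "f ` H_subgroup = cj k0 ` H_subgroup"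
      using auto_H[OF f] by blast
    then obtain h where h: "h \<in> H_subgroup" "f h = cj k0 x" using x by (metis imageE imageI)
    then have hc: "h \<in> carrier GL2A" using H_closed by simp
    obtain s where s: "s \<in> carrier GL2A" "f s = k ** inv\<^bsub>GL2A\<^esub> k0"
      using auto_surj[OF f] k k0 by (metis GL2A.inv_closed GL2A.m_closed)
    have "f (cj s h) = f M"
      using auto_cj[OF f s(1) hc] s h k k0 by (simp flip: cj_cj)
    then have "cj s h = M" using auto_eq_iff[OF f] s hc M by simp
    moreover have "h \<noteq> mat 1" using calculation M s by auto
    ultimately show False using malnormal[of 0 i h s] h s M i by auto
  qed
  then have j: "j \<in> {1, 2}" using k by auto
  note d = cyc_element[OF j k(3,4)]
  have "f ` X i = {mat 1, f M, f M ** f M}" using c M by (simp add: fm fs)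
  also have "\<dots> = cj k ` X j" using d k by (simp add: cj_mult)
  finally show ?thesis using that k j by blast
qed

text \<open>Pulling back the conjugation between the two images would make \<open>M0\<close>
  conjugate to an element of \<open>cyc M1\<close>, against malnormality.\<close>

lemma auto_cyc_distinct:
  assumes f: "f \<in> auto GL2A" and "k \<in> carrier GL2A" "l \<in> carrier GL2A" "j \<in> {1, 2}"
    and "f ` X 1 = cj k ` X j" "f ` X 2 = cj l ` X j"
  shows False
proof -
  have M: "M0 \<noteq> mat 1" using cyc_M0 spike by (auto simp: cyclic_spike_pair_def)
  obtain x where x: "x \<in> X j" "f M0 = cj k x" using assms(5) M_in(3) by (metis One_nat_def X_1 imageE imageI)
  have xc: "x \<in> carrier GL2A" using x(1) assms(4) factor_carrier[of j x] by auto
  obtain z where z: "z \<in> X 2" "f z = cj l x" using assms(6) x by (metis imageE imageI)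
  have zc: "z \<in> carrier GL2A" using z factor_carrier[of 2] by auto
  obtain s where s: "s \<in> carrier GL2A" "f s = k ** inv\<^bsub>GL2A\<^esub> l"
    using auto_surj[OF f] assms by (metis GL2A.inv_closed GL2A.m_closed)
  have "f (cj s z) = f M0"
    using auto_cj[OF f s(1) zc] s x z xc assms(2,3) by (simp flip: cj_cj)
  then have eq: "cj s z = M0" using auto_eq_iff[OF f] s zc by simp
  then have "z \<noteq> mat 1" using M s by auto
  then show False using malnormal[of 2 1 z s] z s eq by simp
qed

section \<open>The subgroup generated by the given automorphisms\<close>

lemma Gen_incl: "f \<in> gens \<Longrightarrow> f \<in> Gen"
  by (rule generate.incl)

lemma spike_gens_auto: "factor_autos M0 M1 \<union> swap_autos M0 M1 \<union> partial_conjugations M0 M1 \<subseteq> auto GL2A"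
  by (auto simp: factor_autos_def swap_autos_def partial_conjugations_def)

lemma gens_auto: "gens \<subseteq> carrier (AutoGroup GL2A)"
proof -
  have "inner_autos GL2A \<subseteq> auto GL2A"
    using inner_auto by (auto simp: inner_autos_def cj_def GL2A_simps(1))
  moreover have "cyclic_spike_autos M0 M1 \<subseteq> auto GL2A"
    using A.generate_incl[OF spike_gens_auto[folded carrier_AutoGroup]]
    by (simp add: cyclic_spike_autos_def)
  ultimately show ?thesis by (auto simp: reiner_autos_def)
qed

lemma subgroup_Gen: "subgroup Gen (AutoGroup GL2A)"
  using gens_auto by (rule A.generate_is_subgroup)

lemma Gen_auto: "f \<in> Gen \<Longrightarrow> f \<in> auto GL2A"
  using subgroup.mem_carrier[OF subgroup_Gen] by simp

lemma Gen_mult: "\<lbrakk>f \<in> Gen; g \<in> Gen\<rbrakk> \<Longrightarrow> f \<otimes>\<^bsub>AutoGroup GL2A\<^esub> g \<in> Gen"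
  by (rule generate.eng)

lemma Gen_cancel_right:
  assumes "f \<in> auto GL2A" "p \<in> Gen" "f \<otimes>\<^bsub>AutoGroup GL2A\<^esub> p \<in> Gen"
  shows "f \<in> Gen"
proof -
  have "f \<otimes>\<^bsub>AutoGroup GL2A\<^esub> p \<otimes>\<^bsub>AutoGroup GL2A\<^esub> inv\<^bsub>AutoGroup GL2A\<^esub> p \<in> Gen"
    using Gen_mult assms subgroup.m_inv_closed[OF subgroup_Gen] by blast
  then show ?thesis
    using A.m_assoc[of f p "inv\<^bsub>AutoGroup GL2A\<^esub> p"] A.inv_closed[of p] A.r_inv[of p] A.r_one[of f]
      assms Gen_auto[of p] by simp
qed

lemma Gen_cancel_left:
  assumes "f \<in> auto GL2A" "p \<in> Gen" "p \<otimes>\<^bsub>AutoGroup GL2A\<^esub> f \<in> Gen"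
  shows "f \<in> Gen"
proof -
  have "inv\<^bsub>AutoGroup GL2A\<^esub> p \<otimes>\<^bsub>AutoGroup GL2A\<^esub> (p \<otimes>\<^bsub>AutoGroup GL2A\<^esub> f) \<in> Gen"
    using Gen_mult assms subgroup.m_inv_closed[OF subgroup_Gen] by blast
  then show ?thesis using assms Gen_auto[of p] by simp
qed

lemma spike_gens_Gen:
  "f \<in> factor_autos M0 M1 \<union> swap_autos M0 M1 \<union> partial_conjugations M0 M1 \<Longrightarrow> f \<in> Gen"
  by (intro Gen_incl) (auto simp: cyclic_spike_autos_def intro: generate.incl)

lemma partial_conjs_Gen: "f \<in> partial_conjs \<Longrightarrow> f \<in> Gen"
  by (intro spike_gens_Gen) (simp add: partial_conjs_def partial_conjugations_def GL2A_simps(1))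

lemma auto_eqI:
  assumes "f \<in> auto GL2A" "g \<in> auto GL2A" "\<And>i x. \<lbrakk>i < 3; x \<in> X i\<rbrakk> \<Longrightarrow> f x = g x"
  shows "f = g"
proof (rule extensionalityI)
  show "f \<in> extensional (carrier GL2A)" "g \<in> extensional (carrier GL2A)"
    using assms by (auto simp: auto_def Bij_def)
  show "f x = g x" if "x \<in> carrier GL2A" for x
    using hom_eqI[OF group_GL2A auto_hom auto_hom] assms that by simp
qed

end

section \<open>Generation of the automorphism group\<close>

text \<open>The isomorphism \<open>cyc M \<rightarrow> cyc N\<close> with
  \<open>M \<mapsto> N\<close>; within \<open>cyc M\<close> the last branch is reached only by
  \<open>M ** M\<close>.\<close>

definition transport3 :: "coord_ring^2^2 \<Rightarrow> coord_ring^2^2 \<Rightarrow> coord_ring^2^2 \<Rightarrow> coord_ring^2^2" where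
  "transport3 M N x = (if x = mat 1 then mat 1 else if x = M then N else N ** N)"

lemma order_3_powers:
  assumes "M \<in> carrier GL2A" "group.ord GL2A M = 3"
  shows "M ** M \<noteq> mat 1" "M ** M \<noteq> M" "M ** M ** M = mat 1" "M ** (M ** M) = mat 1"
    "M ** M ** (M ** M) = M"
proof -
  note M = order_3_cyc(2,3)[OF assms]
  show "M ** (M ** M) = mat 1" by (rule M(1))
  show "M ** M ** M = mat 1" using M(1) by (simp only: matrix_mul_assoc)
  show "M ** M ** (M ** M) = M" using M(1) by (metis matrix_mul_assoc matrix_mul_rid)
  show "M ** M \<noteq> mat 1" using M by force
  show "M ** M \<noteq> M" using GL2A.r_cancel_one[of M M] assms M(2) by simp
qed

lemma transport3:
  assumes "M \<in> carrier GL2A" "group.ord GL2A M = 3" "N \<in> carrier GL2A" "group.ord GL2A N = 3"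
  shows "\<And>x. x \<in> cyc M \<Longrightarrow> transport3 M N x \<in> cyc N"
    and "\<And>x y. \<lbrakk>x \<in> cyc M; y \<in> cyc M\<rbrakk> \<Longrightarrow> transport3 M N (x ** y) = transport3 M N x ** transport3 M N y"
    and "\<And>x. x \<in> cyc M \<Longrightarrow> transport3 N M (transport3 M N x) = x"
  unfolding order_3_cyc(1)[OF assms(1,2)] order_3_cyc(1)[OF assms(3,4)]
  using order_3_powers[OF assms(1,2)] order_3_powers[OF assms(3,4)]
    order_3_cyc(3)[OF assms(1,2)] order_3_cyc(3)[OF assms(3,4)]
  by (auto simp: transport3_def)

context spike_pair
begin

lemma factor_extension:
  assumes "i < 3" "bij_betw a (X i) (X i)"
    and "\<And>x y. \<lbrakk>x \<in> X i; y \<in> X i\<rbrakk> \<Longrightarrow> a (x ** y) = a x ** a y"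
  obtains e where "e \<in> auto GL2A" "\<And>x. x \<in> X i \<Longrightarrow> e x = a x"
    "\<And>j x. \<lbrakk>j < 3; j \<noteq> i; x \<in> X j\<rbrakk> \<Longrightarrow> e x = x"
proof -
  define \<alpha> where "\<alpha> = (\<lambda>j. if j = i then a else (\<lambda>x. x))"
  have bij: "bij_betw (\<alpha> j) (X j) (X j)" if "j < 3" for j
    using assms(2) bij_betw_id[of "X j"] by (simp add: \<alpha>_def id_def)
  have "\<alpha> j \<in> hom (GL2A\<lparr>carrier := X j\<rparr>) (GL2A\<lparr>carrier := X j\<rparr>)" if "j < 3" for j
    using bij[OF that] assms(3) by (auto simp: hom_def GL2A_simps(1) \<alpha>_def bij_betw_def)
  then obtain e where e: "e \<in> auto GL2A" "\<And>j x. \<lbrakk>j \<in> {..<3}; x \<in> X j\<rbrakk> \<Longrightarrow> e x = \<alpha> j x"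
    using factorwise_auto[of \<alpha>] bij by (metis lessThan_iff)
  show ?thesis
  proof (rule that[OF e(1)])
    show "e x = a x" if "x \<in> X i" for x using e(2)[of i x] that assms(1) by (simp add: \<alpha>_def)
    show "e x = x" if "j < 3" "j \<noteq> i" "x \<in> X j" for j x using e(2)[of j x] that by (simp add: \<alpha>_def)
  qed
qed

text \<open>The two transports are inverse to each other, so the extension is an involution; this
  yields the condition with \<open>inv_into\<close> in \<open>swap_autos\<close>.\<close>

lemma swap_exists:
  obtains \<sigma> where "\<sigma> \<in> swap_autos M0 M1" "\<sigma> ` cyc M0 = cyc M1" "\<sigma> ` cyc M1 = cyc M0"
proof -
  have o: "M0 \<in> carrier GL2A" "group.ord GL2A M0 = 3" "M1 \<in> carrier GL2A" "group.ord GL2A M1 = 3"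
    using spike by (auto simp: cyclic_spike_pair_def)
  note t = transport3[OF o] transport3[OF o(3,4,1,2)]
  define \<alpha> :: "nat \<Rightarrow> coord_ring^2^2 \<Rightarrow> coord_ring^2^2" where
    "\<alpha> = (\<lambda>j. if j = 0 then (\<lambda>x. x) else if j = 1 then transport3 M0 M1 else transport3 M1 M0)"
  \<comment> \<open>\<open>c j\<close> is the index of the factor to which \<open>\<alpha> j\<close>
    maps \<open>X j\<close>.\<close>
  define c :: "nat \<Rightarrow> nat" where "c = (\<lambda>j. if j = 0 then 0 else if j = 1 then 2 else 1)"
  have cases: "P j" if "j < 3" "P 0" "P 1" "P 2" for P and j :: nat
    using that by (metis lessThan_3 lessThan_iff insertE singletonD)
  have c3: "j < 3 \<Longrightarrow> c j < 3" for j by (simp add: c_def)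
  have mem: "\<forall>x \<in> X j. \<alpha> j x \<in> X (c j) \<and> \<alpha> (c j) (\<alpha> j x) = x" if "j < 3" for j
    using that by (rule cases) (use t in \<open>simp_all add: \<alpha>_def c_def\<close>)
  have mult: "\<forall>x \<in> X j. \<forall>y \<in> X j. \<alpha> j (x ** y) = \<alpha> j x ** \<alpha> j y" if "j < 3" for j
    using that by (rule cases) (use t in \<open>simp_all add: \<alpha>_def\<close>)
  have hom: "\<alpha> j \<in> hom (GL2A\<lparr>carrier := X j\<rparr>) GL2A" if "j \<in> {..<3}" for j
  proof -
    have j: "j < 3" using that by simp
    have "\<alpha> j x \<in> carrier GL2A" if "x \<in> X j" for x
      using mem[OF j] that c3[OF j] factor_carrier[of "c j"] by simp
    then show ?thesis using mult[OF j] by (auto simp: hom_def GL2A_simps(1))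
  qed
  define \<sigma> where "\<sigma> = extend GL2A \<alpha>"
  have \<sigma>: "\<sigma> x = \<alpha> j x" if "j < 3" "x \<in> X j" for j x
    unfolding \<sigma>_def using extend_factor[OF group_GL2A hom] that by simp
  have inv: "\<sigma> (\<alpha> j x) = x" if "j < 3" "x \<in> X j" for j x
    using \<sigma>[OF c3[OF that(1)]] mem[OF that(1)] that by simp
  have auto: "\<sigma> \<in> auto GL2A"
    unfolding \<sigma>_def
  proof (rule extend_auto[where \<beta> = \<alpha>])
    show "\<alpha> j \<in> hom (GL2A\<lparr>carrier := X j\<rparr>) GL2A" if "j \<in> {..<3}" for j using hom[OF that] .
    then show "\<alpha> j \<in> hom (GL2A\<lparr>carrier := X j\<rparr>) GL2A" if "j \<in> {..<3}" for j using that .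
    show "extend GL2A \<alpha> (\<alpha> j x) = x" if "j \<in> {..<3}" "x \<in> X j" for j x
      using inv that by (simp add: \<sigma>_def)
    then show "extend GL2A \<alpha> (\<alpha> j x) = x" if "j \<in> {..<3}" "x \<in> X j" for j x using that .
  qed
  have \<sigma>0: "\<sigma> x \<in> cyc M1" "\<sigma> (\<sigma> x) = x" if "x \<in> cyc M0" for x
    using \<sigma>[of 1 x] \<sigma>[of 2 "\<sigma> x"] that t by (simp_all add: \<alpha>_def)
  have \<sigma>1: "\<sigma> x \<in> cyc M0" "\<sigma> (\<sigma> x) = x" if "x \<in> cyc M1" for x
    using \<sigma>[of 2 x] \<sigma>[of 1 "\<sigma> x"] that t by (simp_all add: \<alpha>_def)
  have bij: "bij_betw \<sigma> (cyc M0) (cyc M1)"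
    using \<sigma>0 \<sigma>1 by (intro bij_betw_byWitness[where f' = \<sigma>]) auto
  moreover have "\<sigma> (x ** y) = \<sigma> x ** \<sigma> y" if "x \<in> cyc M0" "y \<in> cyc M0" for x y
    using that factor_carrier[of 1] auto_mult[OF auto] by simp
  ultimately have "\<sigma> \<in> iso (GL2A\<lparr>carrier := cyc M0\<rparr>) (GL2A\<lparr>carrier := cyc M1\<rparr>)"
    using \<sigma>0 by (auto simp: iso_def hom_def GL2A_simps(1))
  moreover have "\<sigma> z = inv_into (cyc M0) \<sigma> z" if "z \<in> cyc M1" for z
    using bij \<sigma>1[OF that] inv_into_f_f[of \<sigma> "cyc M0" "\<sigma> z"] by (simp add: bij_betw_def)
  moreover have "\<sigma> z = z" if "z \<in> H_subgroup" for z
    using \<sigma>[of 0 z] that by (simp add: \<alpha>_def)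
  ultimately have "\<sigma> \<in> swap_autos M0 M1" using auto by (simp add: swap_autos_def)
  moreover have "\<sigma> ` cyc M0 = cyc M1" "\<sigma> ` cyc M1 = cyc M0"
    using \<sigma>0 \<sigma>1 by (auto simp: image_iff) metis+
  ultimately show ?thesis using that by blast
qed

text \<open>Conjugating \<open>H\<close> alone amounts to a global conjugation, undone on the cyclic factors.\<close>
lemma conj_H_Gen:
  assumes h: "h \<in> H_subgroup"
  obtains e where "e \<in> Gen" "\<And>x. x \<in> H_subgroup \<Longrightarrow> e x = cj h x"
    "\<And>x. x \<in> cyc M0 \<union> cyc M1 \<Longrightarrow> e x = x"
proof -
  have hc: "h \<in> carrier GL2A" using H_closed[OF h] .
  have pc: "\<exists>p\<in>Gen. (\<forall>z\<in>X j. p z = cj (inv\<^bsub>GL2A\<^esub> h) z) \<and> (\<forall>k<3. k \<noteq> j \<longrightarrow> (\<forall>z\<in>X k. p z = z))"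
    if j: "j \<in> {1, 2}" for j
  proof -
    have m: "0 \<in> {..<3::nat}" "j \<in> {..<3}" "0 \<noteq> j" "inv\<^bsub>GL2A\<^esub> h \<in> X 0" using j h by auto
    obtain p where p: "p \<in> auto GL2A" "\<And>z. z \<in> X j \<Longrightarrow> p z = cj (inv\<^bsub>GL2A\<^esub> h) z"
      "\<And>k z. \<lbrakk>k \<in> {..<3}; k \<noteq> j; z \<in> X k\<rbrakk> \<Longrightarrow> p z = z"
      unfolding cj_def using partial_conjugation[OF m] by blast
    have "p \<in> partial_conjs"
      unfolding partial_conjs_def
    proof (intro CollectI conjI bexI)
      show "inv\<^bsub>GL2A\<^esub> h \<in> X 0" using h by simp
      show "j \<in> {..<3} - {0}" using j by auto
      show "\<forall>z\<in>X j. p z = inv\<^bsub>GL2A\<^esub> h ** z ** inv\<^bsub>GL2A\<^esub> (inv\<^bsub>GL2A\<^esub> h)"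
        using p(2) by (simp add: cj_def)
    qed (use p in auto)
    then have "p \<in> Gen" by (rule partial_conjs_Gen)
    then show ?thesis using p by (intro bexI[of _ p]) simp_all
  qed
  obtain p where p: "p \<in> Gen" "\<And>z. z \<in> cyc M0 \<Longrightarrow> p z = cj (inv\<^bsub>GL2A\<^esub> h) z"
      "\<And>k z. \<lbrakk>k < 3; k \<noteq> 1; z \<in> X k\<rbrakk> \<Longrightarrow> p z = z"
    using pc[of 1] by auto
  obtain q where q: "q \<in> Gen" "\<And>z. z \<in> cyc M1 \<Longrightarrow> q z = cj (inv\<^bsub>GL2A\<^esub> h) z"
      "\<And>k z. \<lbrakk>k < 3; k \<noteq> 2; z \<in> X k\<rbrakk> \<Longrightarrow> q z = z"
    using pc[of 2] by auto
  define g where "g = (\<lambda>x\<in>carrier GL2A. cj h x)"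
  have "g \<in> inner_autos GL2A" using hc by (auto simp: g_def inner_autos_def cj_def GL2A_simps(1))
  then have g: "g \<in> Gen" by (intro Gen_incl) simp
  note auts = Gen_auto[OF p(1)] Gen_auto[OF q(1)] Gen_auto[OF g]
  let ?e = "g \<otimes>\<^bsub>AutoGroup GL2A\<^esub> (p \<otimes>\<^bsub>AutoGroup GL2A\<^esub> q)"
  have e: "?e x = g (p (q x))" if "x \<in> carrier GL2A" for x
    using that auts by (simp add: AutoGroup_apply AutoGroup_closed)
  have c: "x \<in> carrier GL2A" if "x \<in> cyc M0 \<union> cyc M1" for x
    using that factor_carrier[of 1 x] factor_carrier[of 2 x] by auto
  show ?thesis
  proof (rule that[of ?e])
    show "?e \<in> Gen" by (intro Gen_mult g p(1) q(1))
    show "?e x = cj h x" if x: "x \<in> H_subgroup" for x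
    proof -
      have "q x = x" "p x = x" using q(3)[of 0 x] p(3)[of 0 x] x by simp_all
      then show ?thesis using e[OF H_closed[OF x]] H_closed[OF x] by (simp add: g_def)
    qed
    show "?e x = x" if "x \<in> cyc M0 \<union> cyc M1" for x
    proof -
      have "p (q x) = cj (inv\<^bsub>GL2A\<^esub> h) x"
      proof (cases "x \<in> cyc M0")
        case True
        then show ?thesis using q(3)[of 1 x] p(2)[of x] by simp
      next
        case False
        then have x: "x \<in> cyc M1" using that by simp
        have "p (cj (inv\<^bsub>GL2A\<^esub> h) x) = cj (p (inv\<^bsub>GL2A\<^esub> h)) (p x)"
          using auto_cj[OF auts(1)] hc c[OF that] by simp
        then show ?thesis using q(2)[OF x] p(3)[of 2 x] p(3)[of 0 "inv\<^bsub>GL2A\<^esub> h"] x h by simp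
      qed
      then show ?thesis using e[OF c[OF that]] hc c[OF that] by (simp add: g_def)
    qed
  qed
qed

text \<open>Over the two-element field additivity is linearity, and \<open>S\<close> and
  \<open>unip 1\<close> generate GL_2(F_2); so the remaining conditions of
  \<open>reiner_autos\<close> follow from these.\<close>

lemma reinerI:
  assumes f: "f \<in> auto GL2A" and V: "complement V"
    and add: "\<And>a b. \<psi> (a + b) = \<psi> a + \<psi> b" and one: "\<psi> 1 = 1" and inj: "inj \<psi>" and \<psi>V: "\<psi> ` V = V"
    and fu: "\<And>a. f (unip a) = unip (\<psi> a)" and fS: "f S = S" and fM: "f M0 = M0" "f M1 = M1"
  shows "f \<in> reiner_autos M0 M1"
proof -
  have zero: "\<psi> 0 = 0" using add[of 0 0] by simp
  have emb: "\<psi> (F2_emb c) = F2_emb c" for c using F2_emb_cases[of c] zero one by auto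
  have emb_mult: "\<psi> (F2_emb c * v) = F2_emb c * \<psi> v" for c v
    using F2_emb_cases[of c] zero by auto
  have "\<exists>c. \<exists>v\<in>V. a = F2_emb c + v" for a
  proof (cases "a \<in> V")
    case True
    then show ?thesis by (intro exI[of _ 0] bexI[of _ a]) simp_all
  next
    case False
    then have "a + 1 \<in> V" using V by (auto simp: complement_def)
    then show ?thesis by (intro exI[of _ 1] bexI[of _ "a + 1"]) (simp_all add: add.commute)
  qed
  moreover have "range F2_emb \<inter> V = {0}" using V by (auto simp: range_F2_emb complement_def)
  moreover have "bij_betw \<psi> V V" using inj \<psi>V by (auto simp: bij_betw_def inj_on_def)
  moreover have "f (unip (F2_emb c + v)) = unip (F2_emb c + \<psi> v)" for c v by (simp add: fu add emb)
  moreover have "f M = M" if "M \<in> GL2F2" for M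
  proof -
    have "f (S ** unip 1) = S ** unip 1" "f (unip 1 ** S) = unip 1 ** S"
      using fu[of 1] fS one by (simp_all add: auto_mult[OF f])
    moreover from this have "f (unip 1 ** S ** unip 1) = unip 1 ** S ** unip 1"
      using fu[of 1] one auto_mult[OF f, of "unip 1 ** S" "unip 1"] by simp
    ultimately show ?thesis using that GL2F2_subset fu[of 1] one fS auto_one[OF f] by auto
  qed
  ultimately show ?thesis
    using f add emb_mult fM complement_subspace[OF V] unfolding reiner_autos_def by blast
qed

text \<open>\<open>E\<close> undoes the conjugation by \<open>h\<close>, so \<open>\<beta>\<close>
  fixes \<open>S\<close>, \<open>M0\<close> and \<open>M1\<close> and acts on U(A) through
  \<open>\<psi>\<close>. \<open>R\<close> realizes the transvection \<open>\<theta>\<close> that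
  carries \<open>V\<close> to its image under \<open>\<psi>\<close>. Both \<open>R\<close> and the
  product of \<open>R\<close> and \<open>\<beta>\<close> are Reiner automorphisms, with complements
  \<open>U\<close> and \<open>V\<close> respectively.\<close>

lemma H_auto_Gen:
  assumes f: "f \<in> auto GL2A" and fH: "f ` H_subgroup = H_subgroup"
    and fc: "\<And>x. x \<in> cyc M0 \<union> cyc M1 \<Longrightarrow> f x = x"
  shows "f \<in> Gen"
proof -
  have bij: "bij_betw f H_subgroup H_subgroup"
    using fH auto_bij[OF f] H_closed by (auto simp: bij_betw_def inj_on_def)
  have cl: "\<And>h. h \<in> H_subgroup \<Longrightarrow> f h \<in> H_subgroup" using fH by blast
  have mult: "\<And>g h. \<lbrakk>g \<in> H_subgroup; h \<in> H_subgroup\<rbrakk> \<Longrightarrow> f (g ** h) = f g ** f h"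
    using auto_mult[OF f] H_closed by blast
  obtain h where h: "h \<in> H_subgroup" "f S ** h = h ** S" "f (unip 1) ** h = h ** unip 1"
    "\<And>a. \<exists>b. f (unip a) ** h = h ** unip b" "\<And>b. \<exists>a. f (unip a) ** h = h ** unip b"
    using automorphism_of_H[OF cl mult bij] by blast
  have hc: "h \<in> carrier GL2A" using H_closed[OF h(1)] .
  have fcj: "f x = cj h y" if "f x ** h = h ** y" "x \<in> carrier GL2A" "y \<in> carrier GL2A" for x y
    using cj_of_commute[OF hc that(3) auto_closed[OF f that(2)] that(1)] .
  obtain E where E: "E \<in> Gen" "\<And>x. x \<in> H_subgroup \<Longrightarrow> E x = cj (inv\<^bsub>GL2A\<^esub> h) x"
    "\<And>x. x \<in> cyc M0 \<union> cyc M1 \<Longrightarrow> E x = x"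
    using conj_H_Gen[OF H_inv[OF h(1)]] by blast
  define \<beta> where "\<beta> = E \<otimes>\<^bsub>AutoGroup GL2A\<^esub> f"
  note Ea = Gen_auto[OF E(1)]
  have \<beta>: "\<beta> \<in> auto GL2A" using AutoGroup_closed[OF Ea f] by (simp add: \<beta>_def)
  have \<beta>_apply: "\<beta> x = E (f x)" if "x \<in> carrier GL2A" for x
    using AutoGroup_apply[OF Ea f that] by (simp add: \<beta>_def)
  have \<beta>H: "\<beta> x = y" if "f x ** h = h ** y" "x \<in> H_subgroup" "y \<in> H_subgroup" for x y
    using \<beta>_apply[of x] E(2)[OF cl[OF that(2)]] fcj[OF that(1)] that hc H_closed by simp
  have \<beta>S: "\<beta> S = S" using \<beta>H h(2) by simp
  have "\<forall>a. \<exists>b. \<beta> (unip a) = unip b" using \<beta>H h(4) by (metis unip_in_H)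
  then obtain \<psi> where \<psi>: "\<And>a. \<beta> (unip a) = unip (\<psi> a)" by metis
  have surj: "\<exists>a. \<psi> a = b" for b
  proof -
    obtain a where "f (unip a) ** h = h ** unip b" using h(5) by blast
    then have "unip (\<psi> a) = unip b" using \<beta>H[of "unip a" "unip b"] \<psi> by simp
    then show ?thesis by auto
  qed
  have inj: "inj \<psi>"
    using \<psi> auto_eq_iff[OF \<beta> unip_closed unip_closed] by (intro injI) (metis unip_inject)
  have one: "\<psi> 1 = 1" using \<beta>H[OF h(3)] \<psi>[of 1] by simp
  have add: "\<psi> (a + b) = \<psi> a + \<psi> b" for a b
    using auto_mult[OF \<beta>, of "unip a" "unip b"] \<psi> by simp
  have \<beta>M: "\<beta> M0 = M0" "\<beta> M1 = M1"
    using \<beta>_apply[of M0] \<beta>_apply[of M1] fc[of M0] fc[of M1] E(3)[of M0] E(3)[of M1] by simp_all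
  \<comment> \<open>Any complement serves as \<open>V\<close>; one exists because \<open>x\<close>
    is not a constant.\<close>
  have "lin [:0, 1:] 0 \<noteq> 0" "lin [:0, 1:] 0 \<noteq> 1" by (simp_all add: zero_eq_lin one_eq_lin one_pCons)
  then obtain V where V: "complement V" using complement_exists by blast
  have zero: "\<psi> 0 = 0" using add[of 0 0] by simp
  have W: "complement (\<psi> ` V)"
    unfolding complement_def
  proof (intro conjI ballI allI)
    have "0 \<in> V" using V by (simp add: complement_def)
    then show "0 \<in> \<psi> ` V" using zero by (metis imageI)
    show "u + v \<in> \<psi> ` V" if uv: "u \<in> \<psi> ` V" "v \<in> \<psi> ` V" for u v
    proof -
      obtain u' v' where "u' \<in> V" "v' \<in> V" "u = \<psi> u'" "v = \<psi> v'" using uv by blast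
      moreover from this have "u' + v' \<in> V" using V by (simp add: complement_def)
      ultimately show ?thesis using add by (metis imageI)
    qed
    show "1 \<notin> \<psi> ` V"
    proof
      assume "1 \<in> \<psi> ` V"
      then obtain v where "v \<in> V" "\<psi> v = \<psi> 1" using one by auto
      then show False using inj V by (auto simp: inj_def complement_def)
    qed
    show "a \<in> \<psi> ` V \<or> a + 1 \<in> \<psi> ` V" for a
    proof -
      obtain a' where a': "\<psi> a' = a" using surj by blast
      have "a' \<in> V \<or> a' + 1 \<in> V" using V by (auto simp: complement_def)
      then show ?thesis using a' add[of a' 1] one by (metis imageI)
    qed
  qed
  obtain \<theta> U where \<theta>: "\<And>a b. \<theta> (a + b) = \<theta> a + \<theta> b" "\<And>a. \<theta> (\<theta> a) = a" "\<theta> 1 = 1"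
    "complement U" "\<theta> ` U = U" "\<theta> ` V = \<psi> ` V"
    using transvection_swapping_complements[OF V W] by metis
  have \<theta>inj: "inj \<theta>" using \<theta>(2) by (metis injI)
  have "bij_betw (H_extend \<theta>) H_subgroup H_subgroup"
    using H_extend_involution[OF \<theta>(1,3) \<theta>inj \<theta>(2)] H_extend_closed[OF \<theta>(1,3) \<theta>inj]
    by (intro bij_betw_byWitness[where f' = "H_extend \<theta>"]) auto
  then obtain R where R: "R \<in> auto GL2A" "\<And>x. x \<in> H_subgroup \<Longrightarrow> R x = H_extend \<theta> x"
    "\<And>j x. \<lbrakk>j < 3; j \<noteq> 0; x \<in> X j\<rbrakk> \<Longrightarrow> R x = x"
    using factor_extension[of 0 "H_extend \<theta>"] H_extend_mult[OF \<theta>(1,3) \<theta>inj] X_0 by (metis zero_less_numeral)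
  have Ru: "R (unip a) = unip (\<theta> a)" for a using R(2) H_extend_unip[OF \<theta>(1,3) \<theta>inj] by simp
  have RS: "R S = S" using R(2) H_extend_S[OF \<theta>(1,3) \<theta>inj] by simp
  have RM: "R M0 = M0" "R M1 = M1" using R(3)[of 1 M0] R(3)[of 2 M1] by simp_all
  have "R \<in> reiner_autos M0 M1"
    using reinerI[OF R(1) \<theta>(4,1,3) \<theta>inj \<theta>(5) Ru RS RM] .
  then have RG: "R \<in> Gen" by (intro Gen_incl) simp
  have R\<beta>: "(R \<otimes>\<^bsub>AutoGroup GL2A\<^esub> \<beta>) x = R (\<beta> x)" if "x \<in> carrier GL2A" for x
    using AutoGroup_apply[OF R(1) \<beta> that] .
  have "R \<otimes>\<^bsub>AutoGroup GL2A\<^esub> \<beta> \<in> reiner_autos M0 M1"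
  proof (rule reinerI[where V = V and \<psi> = "\<lambda>a. \<theta> (\<psi> a)"])
    show "R \<otimes>\<^bsub>AutoGroup GL2A\<^esub> \<beta> \<in> auto GL2A" using AutoGroup_closed[OF R(1) \<beta>] .
    show "inj (\<lambda>a. \<theta> (\<psi> a))" using inj_compose[OF \<theta>inj inj] by (simp add: comp_def)
    \<comment> \<open>\<open>\<theta>\<close> is an involution carrying \<open>V\<close> to its
      image under \<open>\<psi>\<close>, so it carries that image back to \<open>V\<close>.\<close>
    have "(\<lambda>a. \<theta> (\<psi> a)) ` V = \<theta> ` (\<theta> ` V)" unfolding \<theta>(6) by (simp add: image_image)
    then show "(\<lambda>a. \<theta> (\<psi> a)) ` V = V" by (simp add: image_image \<theta>(2))
  qed (use V R\<beta> \<beta>S \<beta>M RS RM Ru \<psi> add one \<theta>(1,3) in simp_all)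
  then have "R \<otimes>\<^bsub>AutoGroup GL2A\<^esub> \<beta> \<in> Gen" by (intro Gen_incl) simp
  then have "\<beta> \<in> Gen" using Gen_cancel_left \<beta> RG by blast
  then show ?thesis using Gen_cancel_left f E(1) by (simp add: \<beta>_def)
qed

text \<open>Since \<open>f\<close> preserves every factor, it is the product of its restrictions to
  single factors, each extended by the identity. The two cyclic ones are spike generators; the one
  on \<open>H\<close> is covered by \<open>H_auto_Gen\<close>.\<close>

lemma factorwise_Gen:
  assumes f: "f \<in> auto GL2A" and fX: "\<And>i. i < 3 \<Longrightarrow> f ` X i = X i"
  shows "f \<in> Gen"
proof -
  have Xc: "x \<in> carrier GL2A" if "i < 3" "x \<in> X i" for i x using factor_carrier that by simp
  have bij: "bij_betw f (X i) (X i)" if "i < 3" for i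
    using fX[OF that] auto_bij[OF f] Xc[OF that] by (auto simp: bij_betw_def inj_on_def)
  have ext: "\<exists>e\<in>auto GL2A. (\<forall>x\<in>X i. e x = f x) \<and> (\<forall>j<3. j \<noteq> i \<longrightarrow> (\<forall>x\<in>X j. e x = x))" if "i < 3" for i
    using factor_extension[OF that bij[OF that]] auto_mult[OF f] Xc[OF that] by metis
  obtain e0 where e0: "e0 \<in> auto GL2A" "\<And>x. x \<in> X 0 \<Longrightarrow> e0 x = f x"
    "\<And>j x. \<lbrakk>j < 3; j \<noteq> 0; x \<in> X j\<rbrakk> \<Longrightarrow> e0 x = x" using ext[of 0] by auto
  obtain e1 where e1: "e1 \<in> auto GL2A" "\<And>x. x \<in> X 1 \<Longrightarrow> e1 x = f x"
    "\<And>j x. \<lbrakk>j < 3; j \<noteq> 1; x \<in> X j\<rbrakk> \<Longrightarrow> e1 x = x" using ext[of 1] by auto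
  obtain e2 where e2: "e2 \<in> auto GL2A" "\<And>x. x \<in> X 2 \<Longrightarrow> e2 x = f x"
    "\<And>j x. \<lbrakk>j < 3; j \<noteq> 2; x \<in> X j\<rbrakk> \<Longrightarrow> e2 x = x" using ext[of 2] by auto
  have fac: "e \<in> factor_autos M0 M1"
    if e: "e \<in> auto GL2A" "\<And>x. x \<in> X i \<Longrightarrow> e x = f x" "\<And>j x. \<lbrakk>j < 3; j \<noteq> i; x \<in> X j\<rbrakk> \<Longrightarrow> e x = x"
      and i: "i \<in> {1, 2}" for e i
  proof -
    have i3: "i < 3" using i by auto
    have b: "bij_betw (restrict e (X i)) (X i) (X i)"
      using bij[OF i3] e(2) by (simp cong: bij_betw_cong)
    moreover have "restrict e (X i) \<in> hom (GL2A\<lparr>carrier := X i\<rparr>) (GL2A\<lparr>carrier := X i\<rparr>)"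
    proof (rule homI)
      fix x y assume "x \<in> carrier (GL2A\<lparr>carrier := X i\<rparr>)" "y \<in> carrier (GL2A\<lparr>carrier := X i\<rparr>)"
      then have xy: "x \<in> X i" "y \<in> X i" by simp_all
      show "restrict e (X i) x \<in> carrier (GL2A\<lparr>carrier := X i\<rparr>)"
        using xy b by (auto simp: bij_betw_def)
      show "restrict e (X i) (x \<otimes>\<^bsub>GL2A\<lparr>carrier := X i\<rparr>\<^esub> y) =
          restrict e (X i) x \<otimes>\<^bsub>GL2A\<lparr>carrier := X i\<rparr>\<^esub> restrict e (X i) y"
        using xy factor_mult[of i x y] i3 auto_mult[OF e(1) Xc[OF i3 xy(1)] Xc[OF i3 xy(2)]]
        by (simp add: GL2A_simps(1))
    qed
    ultimately have "restrict e (X i) \<in> auto (GL2A\<lparr>carrier := X i\<rparr>)"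
      by (simp add: auto_def Bij_def)
    then show ?thesis unfolding factor_autos_def using e(1,3) i by blast
  qed
  have G: "e1 \<in> Gen" "e2 \<in> Gen" using fac[of e1 1, OF e1] fac[of e2 2, OF e2] spike_gens_Gen by simp_all
  have "e0 ` H_subgroup = H_subgroup" using e0(2) fX[of 0] by (simp cong: image_cong)
  then have "e0 \<in> Gen"
    using H_auto_Gen[OF e0(1)] e0(3)[of 1] e0(3)[of 2] by auto
  moreover have "f = e0 \<otimes>\<^bsub>AutoGroup GL2A\<^esub> (e1 \<otimes>\<^bsub>AutoGroup GL2A\<^esub> e2)"
  proof (rule auto_eqI[OF f])
    show "e0 \<otimes>\<^bsub>AutoGroup GL2A\<^esub> (e1 \<otimes>\<^bsub>AutoGroup GL2A\<^esub> e2) \<in> auto GL2A"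
      using AutoGroup_closed e0 e1 e2 by simp
    fix i x assume ix: "i < 3" "x \<in> X i"
    have "(e0 \<otimes>\<^bsub>AutoGroup GL2A\<^esub> (e1 \<otimes>\<^bsub>AutoGroup GL2A\<^esub> e2)) x = e0 (e1 (e2 x))"
      using AutoGroup_apply AutoGroup_closed e0(1) e1(1) e2(1) Xc[OF ix] by simp
    also have "\<dots> = f x"
    proof -
      have fx: "f x \<in> X i" using fX ix by blast
      consider "i = 0" | "i = 1" | "i = 2" using ix(1) by linarith
      then show ?thesis
      proof cases
        case 1
        then show ?thesis using e2(3)[of 0 x] e1(3)[of 0 x] e0(2)[of x] ix by simp
      next
        case 2
        then show ?thesis using e2(3)[of 1 x] e1(2)[of x] e0(3)[of 1 "f x"] ix fx by simp
      next
        case 3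
        then show ?thesis using e2(2)[of x] e1(3)[of 2 "f x"] e0(3)[of 2 "f x"] ix fx by simp
      qed
    qed
    finally show "f x = (e0 \<otimes>\<^bsub>AutoGroup GL2A\<^esub> (e1 \<otimes>\<^bsub>AutoGroup GL2A\<^esub> e2)) x" by simp
  qed
  ultimately show ?thesis using Gen_mult G by metis
qed

lemma conjugating_Gen:
  assumes f: "f \<in> auto GL2A" and g: "\<And>i. i < 3 \<Longrightarrow> g i \<in> carrier GL2A"
    and fX: "\<And>i. i < 3 \<Longrightarrow> f ` X i = cj (g i) ` X i"
  shows "f \<in> Gen"
proof -
  obtain p where p: "p \<in> generate (AutoGroup GL2A) partial_conjs" "\<And>i. i < 3 \<Longrightarrow> f ` p ` X i = X i"
    using partial_conj_reduction[OF finite_lessThan f, of g] g fX by (auto simp: cj_def)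
  have "generate (AutoGroup GL2A) partial_conjs \<subseteq> Gen"
    using A.generate_subgroup_incl[OF _ subgroup_Gen] partial_conjs_Gen by blast
  then have pG: "p \<in> Gen" using p(1) by blast
  note pa = Gen_auto[OF pG]
  have "f \<otimes>\<^bsub>AutoGroup GL2A\<^esub> p \<in> Gen"
  proof (rule factorwise_Gen)
    show "f \<otimes>\<^bsub>AutoGroup GL2A\<^esub> p \<in> auto GL2A" using AutoGroup_closed[OF f pa] .
    show "(f \<otimes>\<^bsub>AutoGroup GL2A\<^esub> p) ` X i = X i" if "i < 3" for i
    proof -
      have "(f \<otimes>\<^bsub>AutoGroup GL2A\<^esub> p) ` X i = f ` p ` X i"
        unfolding image_image using AutoGroup_apply[OF f pa] factor_carrier that
        by (intro image_cong) simp_all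
      then show ?thesis using p(2)[OF that] by simp
    qed
  qed
  then show ?thesis using Gen_cancel_right f pG by blast
qed

lemma auto_in_Gen:
  assumes f: "f \<in> auto GL2A"
  shows "f \<in> Gen"
proof -
  obtain k0 where k0: "k0 \<in> carrier GL2A" "f ` X 0 = cj k0 ` X 0"
    using auto_H[OF f] by auto
  obtain k1 j1 where k1: "k1 \<in> carrier GL2A" "j1 \<in> {1, 2}" "f ` X 1 = cj k1 ` X j1"
    using auto_cyc[OF f, of 1] by auto
  obtain k2 j2 where k2: "k2 \<in> carrier GL2A" "j2 \<in> {1, 2}" "f ` X 2 = cj k2 ` X j2"
    using auto_cyc[OF f, of 2] by auto
  have ne: "j1 \<noteq> j2" using auto_cyc_distinct[OF f k1(1) k2(1) k1(2) k1(3)] k2(3) by blast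
  have cases: "i = 0 \<or> i = 1 \<or> i = 2" if "i < 3" for i :: nat using that by linarith
  show ?thesis
  proof (cases "j1 = 1")
    case True
    then have j2: "j2 = 2" using ne k2 by auto
    define g where "g i = (if i = 0 then k0 else if i = 1 then k1 else k2)" for i :: nat
    show ?thesis
    proof (rule conjugating_Gen[OF f, of g])
      show "g i \<in> carrier GL2A" for i using k0 k1 k2 by (simp add: g_def)
      show "f ` X i = cj (g i) ` X i" if "i < 3" for i
        using cases[OF that] k0(2) k1(3) k2(3) True j2
        by (elim disjE) (simp_all add: g_def)
    qed
  next
    case False
    then have j: "j1 = 2" "j2 = 1" using ne k1 k2 by auto
    obtain \<sigma> where \<sigma>: "\<sigma> \<in> swap_autos M0 M1" "\<sigma> ` cyc M0 = cyc M1" "\<sigma> ` cyc M1 = cyc M0"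
      using swap_exists by blast
    have \<sigma>G: "\<sigma> \<in> Gen" using \<sigma>(1) by (intro spike_gens_Gen) simp
    have \<sigma>H: "\<sigma> ` H_subgroup = H_subgroup" using \<sigma>(1) by (simp add: swap_autos_def cong: image_cong)
    note \<sigma>a = Gen_auto[OF \<sigma>G]
    \<comment> \<open>The swap sends \<open>X 1\<close> to \<open>X 2\<close>, which
      \<open>f\<close> maps to the conjugate of \<open>X 1\<close> by \<open>k2\<close>; hence
      \<open>k1\<close> and \<open>k2\<close> trade places.\<close>
    define g where "g i = (if i = 0 then k0 else if i = 1 then k2 else k1)" for i :: nat
    have im: "(f \<otimes>\<^bsub>AutoGroup GL2A\<^esub> \<sigma>) ` X i = f ` \<sigma> ` X i" if "i < 3" for i
      unfolding image_image using AutoGroup_apply[OF f \<sigma>a] factor_carrier that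
      by (intro image_cong) simp_all
    have "f \<otimes>\<^bsub>AutoGroup GL2A\<^esub> \<sigma> \<in> Gen"
    proof (rule conjugating_Gen[of _ g])
      show "f \<otimes>\<^bsub>AutoGroup GL2A\<^esub> \<sigma> \<in> auto GL2A" using AutoGroup_closed[OF f \<sigma>a] .
      show "g i \<in> carrier GL2A" for i using k0 k1 k2 by (simp add: g_def)
      show "(f \<otimes>\<^bsub>AutoGroup GL2A\<^esub> \<sigma>) ` X i = cj (g i) ` X i" if "i < 3" for i
        unfolding im[OF that] using cases[OF that] k0(2) k1(3) k2(3) j \<sigma>(2,3) \<sigma>H
        by (elim disjE) (simp_all add: g_def)
    qed
    then show ?thesis using Gen_cancel_right f \<sigma>G by blast
  qed
qed

end

theorem theorem5p9:
  fixes M0 M1 :: "coord_ring^2^2"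
  assumes "cyclic_spike_pair M0 M1"
  shows "generate (AutoGroup GL2A)
           (inner_autos GL2A \<union> reiner_autos M0 M1 \<union> cyclic_spike_autos M0 M1)
         = carrier (AutoGroup GL2A)"
proof -
  interpret spike_pair M0 M1 using assms by unfold_locales
  show ?thesis using Gen_auto auto_in_Gen by auto
qed

end
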